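(* Let $q\in\mathbb{N}$, $q\ge2$, let $L$ be a locally compact group with neutral element $e_L$, and let $f:\overline{\mathbb D}\times L\to\mathbb{C}$ be continuous, where $\overline{\mathbb D}=\{z\in\mathbb{C}:|z|\le1\}$. Then the function $(A,u)\mapsto f(a_{11}(A),u)$ on $U(q)\times L$ (where $a_{11}(A)=Ae_1\cdot e_1$ is the upper left entry of $A$) is positive definite on the group $U(q)\times L$ if and only if there exists a double sequence $(\varphi^{q-2}_{m,n})_{m,n\ge0}$ of functions in $\mathcal P(L)$ with $\sum_{m,n\ge0}\varphi^{q-2}_{m,n}(e_L)<\infty$ such that $$f(z,u)=\sum_{m,n=0}^\infty\varphi^{q-2}_{m,n}(u)R^{q-2}_{m,n}(z),\qquad z\in\overline{\mathbb D},\ u\in L.$$ This expansion converges uniformly on $\overline{\mathbb D}\times L$, and $$\varphi^{q-2}_{m,n}(u)=N(q;m,n)\frac{q-1}{\pi}\int_0^1\int_0^{2\pi}f(re^{i\theta},u)\overline{R^{q-2}_{m,n}(re^{i\theta})}\,r(1-r^2)^{q-2}\,d\theta\,dr.$$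
   Context: $U(q)$ is the group of unitary $q\times q$ complex matrices, $e_1,\dots,e_q$ the standard basis of $\mathbb{C}^q$ and $z\cdot w=\sum_k z_k\overline{w_k}$. For a locally compact group $H$, a continuous $g:H\to\mathbb{C}$ is positive definite if $\sum_{j,k=1}^n g(x_j^{-1}x_k)c_j\overline{c_k}\ge0$ for all $n$, $x_j\in H$, $c_j\in\mathbb{C}$; $\mathcal P(H)$ is the set of such functions. For $\alpha,\beta>-1$ and $k\in\mathbb{N}_0$, $R^{(\alpha,\beta)}_k(x)=P^{(\alpha,\beta)}_k(x)/P^{(\alpha,\beta)}_k(1)$, where $P^{(\alpha,\beta)}_k$ is the Jacobi polynomial. The disc polynomials are $R^{\alpha}_{m,n}(re^{i\theta})=r^{|m-n|}e^{i(m-n)\theta}R^{(\alpha,|m-n|)}_{\min(m,n)}(2r^2-1)$ for $0\le r\le1$, $0\le\theta<2\pi$, $m,n\in\mathbb{N}_0$. Also $N(q;m,n)=\frac{m+n+q-1}{q-1}\binom{m+q-2}{q-2}\binom{n+q-2}{q-2}$. *)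

theory Defs
  imports "HOL-Analysis.Analysis"
begin

definition pos_def_on ::
  "'g::topological_space set \<Rightarrow> ('g \<Rightarrow> 'g \<Rightarrow> 'g) \<Rightarrow> ('g \<Rightarrow> 'g) \<Rightarrow> ('g \<Rightarrow> complex) \<Rightarrow> bool" where
  "pos_def_on G mul iv g \<longleftrightarrow> continuous_on G g \<and>
     (\<forall>(n::nat) (x::nat \<Rightarrow> 'g) (c::nat \<Rightarrow> complex). (\<forall>j<n. x j \<in> G) \<longrightarrow>
        (let s = (\<Sum>j<n. \<Sum>k<n. g (mul (iv (x j)) (x k)) * c j * cnj (c k))
         in Im s = 0 \<and> 0 \<le> Re s))"

text \<open>q x q complex matrices represented as functions nat => nat => complex,
  entries with an index >= q are zero; index 0 corresponds to e_1.\<close>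
definition unitary_group :: "nat \<Rightarrow> (nat \<Rightarrow> nat \<Rightarrow> complex) set" where
  "unitary_group q = {A. (\<forall>i j. (q \<le> i \<or> q \<le> j) \<longrightarrow> A i j = 0) \<and>
      (\<forall>i<q. \<forall>j<q. (\<Sum>k<q. cnj (A k i) * A k j) = (if i = j then 1 else 0))}"

definition mat_mult :: "nat \<Rightarrow> (nat \<Rightarrow> nat \<Rightarrow> complex) \<Rightarrow> (nat \<Rightarrow> nat \<Rightarrow> complex) \<Rightarrow> (nat \<Rightarrow> nat \<Rightarrow> complex)" where
  "mat_mult q A B = (\<lambda>i j. \<Sum>k<q. A i k * B k j)"

definition mat_adj :: "(nat \<Rightarrow> nat \<Rightarrow> complex) \<Rightarrow> (nat \<Rightarrow> nat \<Rightarrow> complex)" where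
  "mat_adj A = (\<lambda>i j. cnj (A j i))"

definition prod_mult :: "nat \<Rightarrow> (nat \<Rightarrow> nat \<Rightarrow> complex) \<times> 'a::group_add
      \<Rightarrow> (nat \<Rightarrow> nat \<Rightarrow> complex) \<times> 'a \<Rightarrow> (nat \<Rightarrow> nat \<Rightarrow> complex) \<times> 'a" where
  "prod_mult q x y = (mat_mult q (fst x) (fst y), snd x + snd y)"

definition prod_inv :: "(nat \<Rightarrow> nat \<Rightarrow> complex) \<times> 'a::group_add \<Rightarrow> (nat \<Rightarrow> nat \<Rightarrow> complex) \<times> 'a" where
  "prod_inv x = (mat_adj (fst x), - snd x)"

definition jacobiP :: "real \<Rightarrow> real \<Rightarrow> nat \<Rightarrow> real \<Rightarrow> real" where
  "jacobiP a b k x = (\<Sum>s\<le>k. ((of_nat k + a) gchoose (k - s)) * ((of_nat k + b) gchoose s)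
        * ((x - 1) / 2) ^ s * ((x + 1) / 2) ^ (k - s))"

definition jacobiR :: "real \<Rightarrow> real \<Rightarrow> nat \<Rightarrow> real \<Rightarrow> real" where
  "jacobiR a b k x = jacobiP a b k x / jacobiP a b k 1"

text \<open>Disc polynomials: r^|m-n| e^{i(m-n)theta} is z^(m-n) for m >= n and (conj z)^(n-m) otherwise.\<close>
definition disc_poly :: "real \<Rightarrow> nat \<Rightarrow> nat \<Rightarrow> complex \<Rightarrow> complex" where
  "disc_poly a m n z =
     (if n \<le> m then z ^ (m - n) else (cnj z) ^ (n - m)) *
     complex_of_real (jacobiR a (real (if n \<le> m then m - n else n - m)) (min m n)
        (2 * (cmod z)\<^sup>2 - 1))"

definition Ncoef :: "nat \<Rightarrow> nat \<Rightarrow> nat \<Rightarrow> real" where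
  "Ncoef q m n = real (m + n + q - 1) / real (q - 1) * real ((m + q - 2) choose (q - 2))
      * real ((n + q - 2) choose (q - 2))"

end

theory Submission
  imports Defs
begin

text \<open>
  The upper left entry of \<open>A\<^sup>* B\<close> is the inner product of the first columns of \<open>B\<close> and \<open>A\<close>, so positive
  definiteness on \<open>U(q) \<times> L\<close> is positive definiteness of the kernel \<open>f(\<langle>y, x\<rangle>, -u + v)\<close> on the unit sphere
  of \<open>\<complex>\<^sup>q\<close> times \<open>L\<close>. Integration over the group is replaced by explicit finite weighted point sets on
  the sphere whose moments converge to those of the invariant measure. They yield two facts: a continuous
  positive definite zonal function has nonnegative mean over the disc, and the disc polynomials are
  positive definite, since they are limits of averages over \<open>\<zeta>\<close> of the kernels
  \<open>\<langle>x, \<zeta>\<rangle>\<^sup>m \<langle>\<zeta>, y\<rangle>\<^sup>m (\<langle>y, x\<rangle> - \<langle>y, \<zeta>\<rangle> \<langle>\<zeta>, x\<rangle>)\<^sup>n\<close>. As Hadamard products of positive matrices are positive,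
  the orthogonal coefficients of \<open>f\<close> are positive definite on \<open>L\<close>. Testing against positive definite functions that
  concentrate at \<open>1\<close> bounds the sum of the coefficients at the neutral element by \<open>f(1, e)\<close>, and the
  series represents \<open>f\<close> because a continuous function with vanishing coefficients is zero.
\<close>

section \<open>Positive semidefinite matrices and Schur multipliers\<close>

text \<open>The weight \<open>r * (1 - r\<^sup>2) ^ a\<close> with \<open>a = q - 2\<close> is tied
  to the sphere by one fact: it is, up to normalization, the law of
  \<open>\<langle>x, y\<rangle>\<close> for independent uniform unit vectors in \<open>q\<close>
  complex dimensions. A positive zonal kernel averaged over both arguments therefore yields a
  nonnegative disc mean. Both uses of the point sets end in a closed condition, so convergence of
  the moments of \<open>\<langle>x, \<zeta>\<rangle>\<close> and
  \<open>\<langle>\<zeta>, y\<rangle>\<close> is all that is asked of them. The obstacle is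
  convergence: orthogonal coefficients of a merely continuous function need not give a convergent
  series. Positivity forces it. Subtracting a finite partial sum from \<open>f\<close> at the
  neutral element leaves nonnegative coefficients, hence a nonnegative real part at
  \<open>z = 1\<close>; since every disc polynomial is 1 there, the partial sums of the coefficients
  stay bounded. With \<open>|\<phi> u| \<le> \<phi> e\<close> and the bound 1 for disc polynomials,
  this single estimate dominates the series uniformly in both variables.\<close>

definition psd :: "nat \<Rightarrow> (nat \<Rightarrow> nat \<Rightarrow> complex) \<Rightarrow> bool" where
  "psd n A \<longleftrightarrow> (\<forall>c. (\<Sum>j<n. \<Sum>k<n. A j k * c j * cnj (c k)) \<in> \<real>\<^sub>\<ge>\<^sub>0)"

text \<open>A kernel is called Schur positive if Hadamard multiplication by it preserves positive
  semidefiniteness. For kernels this is equivalent to positive definiteness, but working with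
  the multiplier property makes the closure under products trivial.\<close>
definition schur_pos :: "'x set \<Rightarrow> ('x \<Rightarrow> 'x \<Rightarrow> complex) \<Rightarrow> bool" where
  "schur_pos X K \<longleftrightarrow> (\<forall>n x A. (\<forall>j<n. x j \<in> X) \<longrightarrow> psd n A \<longrightarrow> psd n (\<lambda>j k. A j k * K (x j) (x k)))"

lemma sum_in_nonneg_Reals:
  assumes "\<And>i. i \<in> I \<Longrightarrow> f i \<in> \<real>\<^sub>\<ge>\<^sub>0"
  shows "sum f I \<in> (\<real>\<^sub>\<ge>\<^sub>0 :: complex set)"
  using assms by (induction I rule: infinite_finite_induct) (auto intro: nonneg_Reals_add_I)

lemma mult_cnj_in_nonneg_Reals: "z * cnj z \<in> \<real>\<^sub>\<ge>\<^sub>0"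
  by (simp add: complex_mult_cnj complex_nonneg_Reals_iff)

lemma lim_in_nonneg_Reals:
  assumes "f \<longlonglongrightarrow> z" "\<And>n. f n \<in> \<real>\<^sub>\<ge>\<^sub>0"
  shows "z \<in> (\<real>\<^sub>\<ge>\<^sub>0 :: complex set)"
  using closed_sequentially[OF closed_nonneg_Reals_complex, of f z] assms by blast

lemma psd_cong:
  assumes "\<And>j k. j < n \<Longrightarrow> k < n \<Longrightarrow> A j k = B j k"
  shows "psd n A \<longleftrightarrow> psd n B"
  using assms by (simp add: psd_def)

lemma psd_one: "psd n (\<lambda>_ _. 1)"
proof -
  have "(\<Sum>j<n. \<Sum>k<n. 1 * c j * cnj (c k)) = (\<Sum>j<n. c j) * cnj (\<Sum>k<n. c k)" for c :: "nat \<Rightarrow> complex"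
    by (simp add: sum_product)
  thus ?thesis by (simp only: psd_def mult_cnj_in_nonneg_Reals) auto
qed

text \<open>Hermitian symmetry is not part of \<open>psd\<close>; it follows from the form being
  real at the vectors (1, 1) and (1, i). Both domination estimates of the proof, for disc
  polynomials and for functions on the group, are instances of this bound.\<close>

lemma psd_bound:
  assumes psd: "psd 2 A" and diag: "A 0 0 = a" "A 1 1 = a"
  shows "a \<in> \<real>\<^sub>\<ge>\<^sub>0" "cmod (A 0 1) \<le> Re a"
proof -
  have form: "A 0 0 * c * cnj c + A 0 1 * c * cnj d + A 1 0 * d * cnj c + A 1 1 * d * cnj d \<in> \<real>\<^sub>\<ge>\<^sub>0" for c d
  proof -
    show ?thesis
      using psd[unfolded psd_def, rule_format, of "\<lambda>j. if j = 0 then c else d"]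
      by (simp add: numeral_2_eq_2 algebra_simps)
  qed
  show a: "a \<in> \<real>\<^sub>\<ge>\<^sub>0" using form[of 1 0] diag by simp
  have "Im (A 0 1 + A 1 0) = 0" "Re (A 1 0) = Re (A 0 1)"
    using form[of 1 1] form[of 1 \<i>] a diag by (auto simp: complex_nonneg_Reals_iff algebra_simps)
  hence herm: "A 1 0 = cnj (A 0 1)" by (simp add: complex_eq_iff)
  show "cmod (A 0 1) \<le> Re a"
  proof (cases "A 0 1 = 0")
    case False
    define r where "r = complex_of_real (cmod (A 0 1))"
    \<comment> \<open>With this phase each cross term equals minus the modulus of
      \<open>A 0 1\<close>.\<close>
    define d where "d = - A 0 1 / r"
    have r: "r \<noteq> 0" "cnj r = r" "A 0 1 * cnj (A 0 1) = r * r"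
      using False complex_norm_square[of "A 0 1"] by (auto simp: r_def power2_eq_square)
    have d: "d * cnj d = 1" "A 0 1 * cnj d = - r" "cnj (A 0 1) * d = - r"
      using r by (auto simp: d_def mult.commute)
    have "2 * a - 2 * r \<in> \<real>\<^sub>\<ge>\<^sub>0"
      using form[of 1 d] d diag herm by (simp add: mult.assoc)
    hence "2 * a - 2 * complex_of_real (cmod (A 0 1)) \<in> \<real>\<^sub>\<ge>\<^sub>0"
      by (simp add: r_def)
    thus ?thesis by (simp add: complex_nonneg_Reals_iff)
  qed (use a in \<open>simp add: complex_nonneg_Reals_iff\<close>)
qed

lemma schur_pos_psd:
  assumes "schur_pos X K" "\<And>j. j < n \<Longrightarrow> x j \<in> X"
  shows "psd n (\<lambda>j k. K (x j) (x k))"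
proof -
  have "psd n (\<lambda>j k. 1 * K (x j) (x k))"
    using assms psd_one[of n] unfolding schur_pos_def by blast
  thus ?thesis by simp
qed

text \<open>The factor \<open>h x\<close> is absorbed into the coefficient vector of the quadratic
  form.\<close>

lemma schur_pos_rank_one: "schur_pos X (\<lambda>x y. h x * cnj (h y))"
  unfolding schur_pos_def psd_def
proof (intro allI impI)
  fix n :: nat and x :: "nat \<Rightarrow> 'a" and A :: "nat \<Rightarrow> nat \<Rightarrow> complex" and c :: "nat \<Rightarrow> complex"
  assume "\<forall>c. (\<Sum>j<n. \<Sum>k<n. A j k * c j * cnj (c k)) \<in> \<real>\<^sub>\<ge>\<^sub>0"
  from spec[OF this, of "\<lambda>j. h (x j) * c j"]
  show "(\<Sum>j<n. \<Sum>k<n. A j k * (h (x j) * cnj (h (x k))) * c j * cnj (c k)) \<in> \<real>\<^sub>\<ge>\<^sub>0"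
    by (simp add: mult_ac)
qed

lemma schur_pos_add:
  assumes "schur_pos X K" "schur_pos X L"
  shows "schur_pos X (\<lambda>x y. K x y + L x y)"
  using assms unfolding schur_pos_def psd_def
  by (auto simp: ring_distribs sum.distrib intro!: nonneg_Reals_add_I)

lemma schur_pos_zero: "schur_pos X (\<lambda>_ _. 0)"
  by (simp add: schur_pos_def psd_def)

lemma schur_pos_one: "schur_pos X (\<lambda>_ _. 1)"
  by (simp add: schur_pos_def psd_def)

lemma schur_pos_sum:
  assumes "\<And>i. i \<in> I \<Longrightarrow> schur_pos X (K i)"
  shows "schur_pos X (\<lambda>x y. \<Sum>i\<in>I. K i x y)"
  using assms by (induction I rule: infinite_finite_induct) (auto intro: schur_pos_add schur_pos_zero)

lemma schur_pos_mult:
  assumes K: "schur_pos X K" and L: "schur_pos X L"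
  shows "schur_pos X (\<lambda>x y. K x y * L x y)"
  unfolding schur_pos_def
proof (intro allI impI)
  fix n x A assume *: "\<forall>j<n. x j \<in> X" "psd n A"
  have "psd n (\<lambda>j k. A j k * K (x j) (x k))" using K * unfolding schur_pos_def by blast
  with L * have "psd n (\<lambda>j k. (A j k * K (x j) (x k)) * L (x j) (x k))" unfolding schur_pos_def by blast
  thus "psd n (\<lambda>j k. A j k * (K (x j) (x k) * L (x j) (x k)))" by (simp add: mult.assoc)
qed

lemma schur_pos_power:
  assumes "schur_pos X K"
  shows "schur_pos X (\<lambda>x y. K x y ^ n)"
  by (induction n) (auto intro: schur_pos_one schur_pos_mult assms)

lemma schur_pos_scale:
  assumes "schur_pos X K" "0 \<le> r"
  shows "schur_pos X (\<lambda>x y. complex_of_real r * K x y)"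
proof -
  have "schur_pos X (\<lambda>x y. complex_of_real (sqrt r) * cnj (complex_of_real (sqrt r)))"
    by (rule schur_pos_rank_one)
  also have "complex_of_real (sqrt r) * cnj (complex_of_real (sqrt r)) = complex_of_real r"
    using assms(2) by (simp flip: of_real_mult)
  finally show ?thesis using assms(1) by (rule schur_pos_mult)
qed

lemma schur_pos_lim:
  assumes "\<And>n. schur_pos X (K n)"
    and "\<And>x y. x \<in> X \<Longrightarrow> y \<in> X \<Longrightarrow> (\<lambda>n. K n x y) \<longlonglongrightarrow> L x y"
  shows "schur_pos X L"
  unfolding schur_pos_def psd_def
proof (intro allI impI)
  fix n :: nat and x :: "nat \<Rightarrow> 'a" and A :: "nat \<Rightarrow> nat \<Rightarrow> complex" and c :: "nat \<Rightarrow> complex"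
  assume *: "\<forall>j<n. x j \<in> X" "\<forall>c. (\<Sum>j<n. \<Sum>k<n. A j k * c j * cnj (c k)) \<in> \<real>\<^sub>\<ge>\<^sub>0"
  show "(\<Sum>j<n. \<Sum>k<n. A j k * L (x j) (x k) * c j * cnj (c k)) \<in> \<real>\<^sub>\<ge>\<^sub>0"
  proof (rule lim_in_nonneg_Reals)
    show "(\<lambda>N. \<Sum>j<n. \<Sum>k<n. A j k * K N (x j) (x k) * c j * cnj (c k))
            \<longlonglongrightarrow> (\<Sum>j<n. \<Sum>k<n. A j k * L (x j) (x k) * c j * cnj (c k))"
      using * by (intro tendsto_intros assms(2)) auto
    show "(\<Sum>j<n. \<Sum>k<n. A j k * K N (x j) (x k) * c j * cnj (c k)) \<in> \<real>\<^sub>\<ge>\<^sub>0" for N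
      using assms(1)[of N] * unfolding schur_pos_def psd_def by blast
  qed
qed

section \<open>The mean over the disc\<close>

text \<open>A probability mean: the law of one coordinate of a uniform point on the unit sphere in
  \<open>a + 2\<close> complex dimensions, kept as the iterated integral in which the coefficient
  formula is stated.\<close>

definition disc_mean :: "nat \<Rightarrow> (complex \<Rightarrow> complex) \<Rightarrow> complex" where
  "disc_mean a F = complex_of_real ((real a + 1) / pi) *
     integral {0..1} (\<lambda>r. integral {0..2 * pi} (\<lambda>\<theta>.
       F (complex_of_real r * exp (\<i> * complex_of_real \<theta>)) * complex_of_real (r * (1 - r\<^sup>2) ^ a)))"

definition polar :: "real \<Rightarrow> real \<Rightarrow> complex" where
  "polar r \<theta> = complex_of_real r * exp (\<i> * complex_of_real \<theta>)"

lemma norm_polar [simp]: "norm (polar r \<theta>) = \<bar>r\<bar>"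
  by (simp add: polar_def norm_mult)

lemma continuous_on_polar:
  fixes f g :: "'b::topological_space \<Rightarrow> real"
  assumes "continuous_on S f" "continuous_on S g"
  shows "continuous_on S (\<lambda>x. polar (f x) (g x))"
  unfolding polar_def by (intro continuous_intros assms)

text \<open>The parameter \<open>u\<close> serves the continuity of the expansion coefficients in
  the group variable; for a single function it is filled by a dummy.\<close>

lemma continuous_on_polar_integrand:
  fixes F :: "'b::topological_space \<Rightarrow> complex \<Rightarrow> complex"
  assumes F: "continuous_on (U \<times> cball 0 1) (\<lambda>(u, z). F u z)"
  shows "continuous_on ((U \<times> cbox 0 1) \<times> cbox 0 (2 * pi))
    (\<lambda>((u, r), \<theta>). F u (polar r \<theta>) * complex_of_real (r * (1 - r\<^sup>2) ^ a))"
proof -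
  have "continuous_on ((U \<times> cbox 0 1) \<times> cbox 0 (2 * pi))
          (\<lambda>x. (fst (fst x), polar (snd (fst x)) (snd x)))"
    by (intro continuous_intros continuous_on_polar)
  moreover have "(\<lambda>x. (fst (fst x), polar (snd (fst x)) (snd x))) ` ((U \<times> cbox 0 1) \<times> cbox 0 (2 * pi))
      \<subseteq> U \<times> cball 0 1" by auto
  ultimately have "continuous_on ((U \<times> cbox 0 1) \<times> cbox 0 (2 * pi))
          (\<lambda>x. F (fst (fst x)) (polar (snd (fst x)) (snd x)))"
    using continuous_on_compose2[OF F] by fastforce
  thus ?thesis unfolding split_def by (intro continuous_intros)
qed

abbreviation circle_int :: "nat \<Rightarrow> (complex \<Rightarrow> complex) \<Rightarrow> real \<Rightarrow> complex" where
  "circle_int a F \<equiv> \<lambda>r. integral {0..2 * pi} (\<lambda>\<theta>. F (polar r \<theta>) * complex_of_real (r * (1 - r\<^sup>2) ^ a))"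

lemma continuous_on_polar_inner:
  fixes F :: "'b::topological_space \<Rightarrow> complex \<Rightarrow> complex"
  assumes F: "continuous_on (U \<times> cball 0 1) (\<lambda>(u, z). F u z)"
  shows "continuous_on (U \<times> cbox 0 1)
    (\<lambda>(u, r). circle_int a (F u) r)"
  using integral_continuous_on_param[of "U \<times> cbox 0 1" 0 "2 * pi"
      "\<lambda>(u, r) \<theta>. F u (polar r \<theta>) * complex_of_real (r * (1 - r\<^sup>2) ^ a)"]
    continuous_on_polar_integrand[OF F] by (simp add: split_def)

lemma disc_mean_polar:
  "disc_mean a F = complex_of_real ((real a + 1) / pi) *
     integral {0..1} (circle_int a F)"
  by (simp add: disc_mean_def polar_def)

lemma continuous_on_disc_mean:
  fixes F :: "'b::topological_space \<Rightarrow> complex \<Rightarrow> complex"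
  assumes F: "continuous_on (U \<times> cball 0 1) (\<lambda>(u, z). F u z)"
  shows "continuous_on U (\<lambda>u. disc_mean a (F u))"
  unfolding disc_mean_polar
  using integral_continuous_on_param[OF continuous_on_polar_inner[OF F, of a]]
  by (intro continuous_intros) (simp add: split_def)

lemma
  assumes F: "continuous_on (cball 0 1) F"
  shows inner_integrable: "r \<in> {0..1} \<Longrightarrow>
      (\<lambda>\<theta>. F (polar r \<theta>) * complex_of_real (r * (1 - r\<^sup>2) ^ a)) integrable_on {0..2 * pi}"
    and outer_integrable:
      "(circle_int a F)
        integrable_on {0..1}"
proof -
  have F': "continuous_on (UNIV \<times> cball 0 1) (\<lambda>(u :: real, z). F z)"
    unfolding split_def by (rule continuous_on_compose2[OF F]) (auto intro!: continuous_intros)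
  show "(circle_int a F)
        integrable_on {0..1}"
  proof (intro integrable_continuous_real)
    have "continuous_on {0..1} (\<lambda>r::real. (0::real, r))" by (intro continuous_intros)
    from continuous_on_compose2[OF continuous_on_polar_inner[OF F', of a] this]
    show "continuous_on {0..1} (circle_int a F)"
      by (simp add: image_subset_iff del: integral_mult_left integral_mult_right)
  qed
  assume "r \<in> {0..1}"
  thus "(\<lambda>\<theta>. F (polar r \<theta>) * complex_of_real (r * (1 - r\<^sup>2) ^ a)) integrable_on {0..2 * pi}"
    by (intro integrable_continuous_real continuous_intros continuous_on_compose2[OF F] continuous_on_polar) auto
qed

lemma disc_mean_add:
  assumes F: "continuous_on (cball 0 1) F" and G: "continuous_on (cball 0 1) G"
  shows "disc_mean a (\<lambda>z. F z + G z) = disc_mean a F + disc_mean a G"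
proof -
  have "integral {0..1} (\<lambda>r. integral {0..2 * pi} (\<lambda>\<theta>. (F (polar r \<theta>) + G (polar r \<theta>)) * complex_of_real (r * (1 - r\<^sup>2) ^ a)))
    = integral {0..1} (\<lambda>r. circle_int a F r
         + circle_int a G r)"
    using inner_integrable[OF F] inner_integrable[OF G]
    by (intro integral_cong) (simp add: ring_distribs integral_add)
  also have "\<dots> = integral {0..1} (circle_int a F)
         + integral {0..1} (circle_int a G)"
    by (intro integral_add outer_integrable F G)
  finally show ?thesis unfolding disc_mean_polar by (simp add: ring_distribs)
qed

lemma disc_mean_scale: "disc_mean a (\<lambda>z. c * F z) = c * disc_mean a F"
  unfolding disc_mean_polar by (simp add: mult.assoc)

lemma disc_mean_cnj: "disc_mean a (\<lambda>z. cnj (F z)) = cnj (disc_mean a F)"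
  unfolding disc_mean_polar by (simp add: integral_cnj)

lemma disc_mean_zero: "disc_mean a (\<lambda>_. 0) = 0"
  using disc_mean_scale[of a 0 "\<lambda>_. 0"] by simp

lemma disc_mean_diff:
  assumes F: "continuous_on (cball 0 1) F" and G: "continuous_on (cball 0 1) G"
  shows "disc_mean a (\<lambda>z. F z - G z) = disc_mean a F - disc_mean a G"
proof -
  have "disc_mean a (\<lambda>z. F z + (-1) * G z) = disc_mean a F + disc_mean a (\<lambda>z. (-1) * G z)"
    by (intro disc_mean_add continuous_intros F G)
  thus ?thesis using disc_mean_scale[of a "-1" G] by simp
qed

lemma disc_mean_sum:
  assumes "\<And>i. i \<in> I \<Longrightarrow> continuous_on (cball 0 1) (F i)"
  shows "disc_mean a (\<lambda>z. \<Sum>i\<in>I. F i z) = (\<Sum>i\<in>I. disc_mean a (F i))"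
  using assms
  by (induction I rule: infinite_finite_induct)
    (auto simp: disc_mean_zero disc_mean_add continuous_on_sum)

text \<open>The constant is crude: a weight of at most 1 on a rectangle of area
  \<open>2 * pi\<close>. It enters only estimates in which \<open>B\<close> is made arbitrarily
  small.\<close>

lemma norm_disc_mean_le:
  assumes F: "continuous_on (cball 0 1) F" and B: "\<And>z. z \<in> cball 0 1 \<Longrightarrow> norm (F z) \<le> B"
  shows "norm (disc_mean a F) \<le> 2 * (real a + 1) * B"
proof -
  have B0: "0 \<le> B" using order_trans[OF norm_ge_zero B[of 0]] by simp
  have "norm (circle_int a F r) \<le> B * (2 * pi - 0)"
    if r: "r \<in> {0..1}" for r
  proof (rule integral_bound)
    show "continuous_on {0..2 * pi} (\<lambda>\<theta>. F (polar r \<theta>) * complex_of_real (r * (1 - r\<^sup>2) ^ a))"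
      using r by (intro continuous_intros continuous_on_compose2[OF F] continuous_on_polar) auto
    fix t :: real
    have "(1 - r\<^sup>2) ^ a \<le> 1" "0 \<le> 1 - r\<^sup>2" using r by (auto intro!: power_le_one simp: power_le_one)
    hence "\<bar>r * (1 - r\<^sup>2) ^ a\<bar> \<le> 1 * 1" unfolding abs_mult using r by (intro mult_mono) auto
    hence "norm (F (polar r t)) * \<bar>r * (1 - r\<^sup>2) ^ a\<bar> \<le> B * 1" using B[of "polar r t"] r B0 by (intro mult_mono) auto
    thus "norm (F (polar r t) * complex_of_real (r * (1 - r\<^sup>2) ^ a)) \<le> B" by (simp only: norm_mult norm_of_real)
  qed auto
  hence "norm (integral {0..1} (circle_int a F))
     \<le> integral {0..1} (\<lambda>r::real. B * (2 * pi))"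
    by (intro integral_norm_bound_integral outer_integrable[OF F]) auto
  hence "norm (disc_mean a F) \<le> (real a + 1) / pi * (B * (2 * pi))"
    unfolding disc_mean_polar norm_mult norm_of_real by (intro mult_mono) auto
  also have "(real a + 1) / pi * (B * (2 * pi)) = 2 * (real a + 1) * B" by simp
  finally show ?thesis .
qed

section \<open>Beta integrals and the moments of the disc\<close>

text \<open>The function \<open>r ^ (2 * p + 2) * (1 - r\<^sup>2) ^ Suc a\<close> vanishes at both
  ends, so the integral of its derivative is 0; this trades a factor \<open>1 - r\<^sup>2\<close>
  for a larger \<open>p\<close>.\<close>

lemma radial_integral:
  "((\<lambda>r::real. r ^ (2 * p + 1) * (1 - r\<^sup>2) ^ a) has_integral (fact p * fact a / (2 * fact (p + a + 1)))) {0..1}"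
proof (induction a arbitrary: p)
  case 0
  have "((\<lambda>r::real. r ^ (2 * p + 1)) has_integral (1 ^ (2 * p + 2) / (2 * p + 2) - 0 ^ (2 * p + 2) / (2 * p + 2))) {0..1}"
  proof (intro fundamental_theorem_of_calculus)
    fix x :: real
    have "((\<lambda>r. r ^ (2 * p + 2) / (2 * p + 2)) has_real_derivative
            real (2 * p + 2) * x ^ (2 * p + 2 - Suc 0) / (2 * p + 2)) (at x within {0..1})"
      by (intro DERIV_cdivide has_field_derivative_at_within[OF DERIV_pow])
    thus "((\<lambda>r. r ^ (2 * p + 2) / (2 * p + 2)) has_vector_derivative x ^ (2 * p + 1)) (at x within {0..1})"
      by (simp add: has_real_derivative_iff_has_vector_derivative)
  qed simp
  moreover have "fact p * fact 0 / (2 * fact (p + 0 + 1)) = (1 ^ (2 * p + 2) / (2 * p + 2) - 0 ^ (2 * p + 2) / (2 * p + 2) :: real)"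
    by (simp add: divide_simps)
  ultimately show ?case by (simp only: power_0 mult_1_right)
next
  case (Suc a)
  let ?I = "\<lambda>r::real. (2 * p + 2) * (r ^ (2 * p + 1) * (1 - r\<^sup>2) ^ Suc a) -
            2 * (real a + 1) * (r ^ (2 * Suc p + 1) * (1 - r\<^sup>2) ^ a)"
  have "(?I has_integral (1 ^ (2 * p + 2) * (1 - 1\<^sup>2) ^ Suc a - 0 ^ (2 * p + 2) * (1 - 0\<^sup>2) ^ Suc a)) {0..1}"
  proof (intro fundamental_theorem_of_calculus)
    fix x :: real
    have "((\<lambda>r. 1 - r\<^sup>2) has_real_derivative (- 2 * x)) (at x within {0..1})"
      by (auto intro!: derivative_eq_intros)
    hence "((\<lambda>r. r ^ Suc (2 * p + 1) * (1 - r\<^sup>2) ^ Suc a) has_real_derivative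
        ((1 + real (2 * p + 1)) * (1 * x ^ (2 * p + 1))) * (1 - x\<^sup>2) ^ Suc a +
        ((1 + real a) * ((- 2 * x) * (1 - x\<^sup>2) ^ a)) * x ^ Suc (2 * p + 1)) (at x within {0..1})"
      by (intro DERIV_mult DERIV_power_Suc DERIV_ident)
    also have "((1 + real (2 * p + 1)) * (1 * x ^ (2 * p + 1))) * (1 - x\<^sup>2) ^ Suc a +
        ((1 + real a) * ((- 2 * x) * (1 - x\<^sup>2) ^ a)) * x ^ Suc (2 * p + 1) = ?I x"
      by (simp add: algebra_simps)
    finally show "((\<lambda>r. r ^ (2 * p + 2) * (1 - r\<^sup>2) ^ Suc a) has_vector_derivative ?I x) (at x within {0..1})"
      by (simp add: has_real_derivative_iff_has_vector_derivative)
  qed simp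
  hence "(?I has_integral 0) {0..1}" by simp
  from has_integral_add[OF this has_integral_mult_right[OF Suc.IH[of "Suc p"], of "2 * (real a + 1)"]]
  have "((\<lambda>r::real. (2 * p + 2) * (r ^ (2 * p + 1) * (1 - r\<^sup>2) ^ Suc a)) has_integral
      (2 * (real a + 1) * (fact (Suc p) * fact a / (2 * fact (Suc p + a + 1))))) {0..1}" by simp
  from has_integral_mult_right[OF this, of "1 / real (2 * p + 2)"]
  have "((\<lambda>r::real. r ^ (2 * p + 1) * (1 - r\<^sup>2) ^ Suc a) has_integral
      1 / real (2 * p + 2) * (2 * (real a + 1) * (fact (Suc p) * fact a / (2 * fact (Suc p + a + 1))))) {0..1}"
  proof -
    have "1 / real (2 * p + 2) * (real (2 * p + 2) * y) = y" for y by simp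
    with \<open>((\<lambda>r. 1 / real (2 * p + 2) * _ r) has_integral _) _\<close> show ?thesis by (simp only:)
  qed
  moreover have "1 / real (2 * p + 2) * (2 * (real a + 1) * (fact (Suc p) * fact a / (2 * fact (Suc p + a + 1))))
     = (fact p * fact (Suc a) / (2 * fact (p + Suc a + 1)) :: real)"
    by (simp add: divide_simps) (simp add: algebra_simps)
  ultimately show ?case by (simp only:)
qed

lemma integral_exp_int:
  assumes "k \<noteq> (0::int)"
  shows "integral {0..2 * pi} (\<lambda>\<theta>. exp (\<i> * of_int k * complex_of_real \<theta>)) = 0"
proof -
  have "((\<lambda>\<theta>. exp (\<i> * of_int k * complex_of_real \<theta>)) has_integral
          (exp (\<i> * of_int k * complex_of_real (2 * pi)) / (\<i> * of_int k) - exp (\<i> * of_int k * complex_of_real 0) / (\<i> * of_int k))) {0..2 * pi}"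
  proof (intro fundamental_theorem_of_calculus)
    fix x :: real
    have "((\<lambda>z. exp (\<i> * of_int k * z) / (\<i> * of_int k)) has_field_derivative
            exp (\<i> * of_int k * complex_of_real x)) (at (complex_of_real x))"
      using assms by (auto intro!: derivative_eq_intros)
    thus "((\<lambda>\<theta>. exp (\<i> * of_int k * complex_of_real \<theta>) / (\<i> * of_int k)) has_vector_derivative
            exp (\<i> * of_int k * complex_of_real x)) (at x within {0..2 * pi})"
      by (rule has_vector_derivative_real_field)
  qed simp
  moreover have "exp (\<i> * of_int k * complex_of_real (2 * pi)) = 1"
    by (simp add: exp_eq_1 exI[of _ k])
  ultimately show ?thesis by (auto intro: integral_unique)
qed

lemma disc_mean_monomial:
  "disc_mean a (\<lambda>z. z ^ m * cnj z ^ n) =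
     (if m = n then complex_of_real (fact m * fact (a + 1) / fact (m + a + 1)) else 0)"
proof -
  have eq: "polar r \<theta> ^ m * cnj (polar r \<theta>) ^ n * complex_of_real (r * (1 - r\<^sup>2) ^ a)
     = complex_of_real (r ^ (m + n + 1) * (1 - r\<^sup>2) ^ a) * exp (\<i> * of_int (int m - int n) * complex_of_real \<theta>)" for r \<theta>
    by (simp add: polar_def exp_cnj power_mult_distrib exp_of_nat_mult[symmetric] power_add mult_ac ring_distribs
        exp_diff exp_minus field_simps)
  show ?thesis
  proof (cases "m = n")
    case True
    have "((\<lambda>r. complex_of_real (r ^ (2 * m + 1) * (1 - r\<^sup>2) ^ a)) has_integral
        complex_of_real (fact m * fact a / (2 * fact (m + a + 1)))) {0..1}"
      using has_integral_linear[OF radial_integral[of m a] bounded_linear_of_real] by (simp only: o_def)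
    from has_integral_mult_left[OF this, of "2 * complex_of_real pi"]
    have "integral {0..1} (\<lambda>r. complex_of_real (r ^ (2 * m + 1) * (1 - r\<^sup>2) ^ a) * (2 * complex_of_real pi)) =
       complex_of_real (fact m * fact a / (2 * fact (m + a + 1))) * (2 * complex_of_real pi)"
      by (rule integral_unique)
    moreover have "integral {0..2 * pi} (\<lambda>\<theta>. complex_of_real (r ^ (m + n + 1) * (1 - r\<^sup>2) ^ a) *
        exp (\<i> * of_int (int m - int n) * complex_of_real \<theta>)) =
        complex_of_real (r ^ (2 * m + 1) * (1 - r\<^sup>2) ^ a) * (2 * complex_of_real pi)" for r
    proof -
      have "integral {0..2 * pi} (\<lambda>\<theta>::real. c) = c * (2 * complex_of_real pi)" for c :: complex
        by (simp add: scaleR_conv_of_real)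
      thus ?thesis using True by (simp only: diff_self of_int_0 mult_zero_right mult_zero_left exp_zero mult_1_right mult_2)
    qed
    ultimately have "disc_mean a (\<lambda>z. z ^ m * cnj z ^ n) = complex_of_real ((real a + 1) / pi) *
        (complex_of_real (fact m * fact a / (2 * fact (m + a + 1))) * (2 * complex_of_real pi))"
      unfolding disc_mean_polar eq by (simp only:)
    also have "\<dots> = complex_of_real ((real a + 1) / pi * (fact m * fact a / (2 * fact (m + a + 1)) * (2 * pi)))"
      by simp
    also have "(real a + 1) / pi * (fact m * fact a / (2 * fact (m + a + 1)) * (2 * pi)) = fact m * fact (a + 1) / fact (m + a + 1)"
      by (simp add: mult_ac)
    finally show ?thesis using True by (simp only: if_True simp_thms)
  next
    case False
    hence k: "int m - int n \<noteq> 0" by simp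
    have "integral {0..2 * pi} (\<lambda>\<theta>. c * exp (\<i> * of_int (int m - int n) * complex_of_real \<theta>)) = 0" for c
      by (simp only: integral_mult_right integral_exp_int[OF k] mult_zero_right)
    thus ?thesis using False unfolding disc_mean_polar eq by (simp only: if_False integral_0 mult_zero_right)
  qed
qed

lemma disc_mean_one: "disc_mean a (\<lambda>_. 1) = 1"
  using disc_mean_monomial[of a 0 0] by simp

lemma exists_polar:
  obtains \<theta> where "\<theta> \<in> {0..2 * pi}" "z = polar (cmod z) \<theta>"
  using that[of "Arg2pi z"] Arg2pi[of z] by (simp add: polar_def is_Arg_def)

lemma disc_mean_of_real:
  fixes h :: "complex \<Rightarrow> real"
  assumes h: "continuous_on (cball 0 1) h"
  shows "disc_mean a (\<lambda>z. complex_of_real (h z)) = complex_of_real ((real a + 1) / pi *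
     integral {0..1} (\<lambda>r. integral {0..2 * pi} (\<lambda>\<theta>. h (polar r \<theta>) * (r * (1 - r\<^sup>2) ^ a))))"
    and "continuous_on {0..1} (\<lambda>r. integral {0..2 * pi} (\<lambda>\<theta>. h (polar r \<theta>) * (r * (1 - r\<^sup>2) ^ a)))"
proof -
  let ?H = "\<lambda>r. integral {0..2 * pi} (\<lambda>\<theta>. complex_of_real (h (polar r \<theta>)) * complex_of_real (r * (1 - r\<^sup>2) ^ a))"
  let ?J = "\<lambda>r. integral {0..2 * pi} (\<lambda>\<theta>. h (polar r \<theta>) * (r * (1 - r\<^sup>2) ^ a))"
  have h': "continuous_on (UNIV \<times> cball 0 1) (\<lambda>(u :: real, z). complex_of_real (h z))"
    unfolding split_def by (intro continuous_intros continuous_on_compose2[OF h]) auto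
  have J: "?H r
      = complex_of_real (?J r)" if "r \<in> {0..1}" for r
  proof -
    have "(\<lambda>\<theta>. h (polar r \<theta>) * (r * (1 - r\<^sup>2) ^ a)) integrable_on {0..2 * pi}"
      using that by (intro integrable_continuous_real continuous_intros continuous_on_compose2[OF h] continuous_on_polar) auto
    from integral_linear[OF this bounded_linear_of_real[where ?'a = complex]]
    show ?thesis by (simp add: o_def)
  qed
  have "continuous_on {0..1} (\<lambda>r::real. (0::real, r))" by (intro continuous_intros)
  from continuous_on_compose2[OF continuous_on_polar_inner[OF h', of a] this]
  have "continuous_on {0..1} (\<lambda>r. ?H r)"
    by (simp add: image_subset_iff del: integral_mult_left integral_mult_right)
  also have "?this \<longleftrightarrow> continuous_on {0..1} (\<lambda>r. complex_of_real (?J r))"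
    by (intro continuous_on_cong refl J)
  finally have "continuous_on {0..1} (\<lambda>r. Re (complex_of_real (?J r)))"
    by (rule continuous_on_Re)
  thus cont: "continuous_on {0..1} ?J" by (simp only: Re_complex_of_real)
  have "integral {0..1} (\<lambda>r. ?H r)
     = integral {0..1} (\<lambda>r. complex_of_real (?J r))"
    by (intro integral_cong J)
  also have "\<dots> = complex_of_real (integral {0..1} ?J)"
    using integral_linear[OF integrable_continuous_real[OF cont] bounded_linear_of_real[where ?'a = complex]]
    by (simp add: o_def)
  finally show "disc_mean a (\<lambda>z. complex_of_real (h z)) = complex_of_real ((real a + 1) / pi * integral {0..1} ?J)"
    unfolding disc_mean_polar by simp
qed

text \<open>The weight vanishes at the origin and, for positive \<open>a\<close>, on the unit
  circle. A vanishing mean therefore gives \<open>h = 0\<close> first on the punctured open disc and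
  then, by continuity, everywhere.\<close>

lemma disc_mean_pos:
  fixes h :: "complex \<Rightarrow> real"
  assumes h: "continuous_on (cball 0 1) h" and nonneg: "\<And>z. z \<in> cball 0 1 \<Longrightarrow> 0 \<le> h z"
  shows disc_mean_nonneg: "0 \<le> Re (disc_mean a (\<lambda>z. complex_of_real (h z)))"
    and disc_mean_eq_0_imp: "\<lbrakk>disc_mean a (\<lambda>z. complex_of_real (h z)) = 0; z \<in> cball 0 1\<rbrakk> \<Longrightarrow> h z = 0"
proof -
  let ?J = "\<lambda>r. integral {0..2 * pi} (\<lambda>\<theta>. h (polar r \<theta>) * (r * (1 - r\<^sup>2) ^ a))"
  note eq = disc_mean_of_real[OF h, of a]
  have w: "0 \<le> r * (1 - r\<^sup>2) ^ a" if "r \<in> {0..1}" for r :: real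
    using that by (auto intro!: mult_nonneg_nonneg zero_le_power simp: power_le_one)
  have cont: "continuous_on {0..2 * pi} (\<lambda>\<theta>. h (polar r \<theta>) * (r * (1 - r\<^sup>2) ^ a))" if "r \<in> {0..1}" for r
    using that by (intro continuous_intros continuous_on_compose2[OF h] continuous_on_polar) auto
  have J: "0 \<le> ?J r" if "r \<in> {0..1}" for r
    using that
    by (intro integral_nonneg integrable_continuous_real cont mult_nonneg_nonneg[OF nonneg w]) auto
  have I: "0 \<le> integral {0..1} ?J"
    by (rule integral_nonneg[OF integrable_continuous_real[OF eq(2)] J])
  thus "0 \<le> Re (disc_mean a (\<lambda>z. complex_of_real (h z)))"
    unfolding eq(1) Re_complex_of_real by (intro mult_nonneg_nonneg) auto
  assume zero: "disc_mean a (\<lambda>z. complex_of_real (h z)) = 0" and z: "z \<in> cball 0 1"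
  have "integral {0..1} ?J = 0"
    using zero pi_gt_zero unfolding eq(1) of_real_eq_0_iff by (auto simp: add_nonneg_eq_0_iff)
  hence J0: "?J r = 0" if "r \<in> {0..1}" for r
    using integral_eq_0_iff[OF eq(2)] J that by fastforce
  have *: "h y = 0" if y: "0 < cmod y" "cmod y < 1" for y
  proof -
    obtain \<theta> where \<theta>: "\<theta> \<in> {0..2 * pi}" "y = polar (cmod y) \<theta>" by (rule exists_polar)
    have "h (polar (cmod y) t) * (cmod y * (1 - (cmod y)\<^sup>2) ^ a) = 0" if "t \<in> {0..2 * pi}" for t
      using integral_eq_0_iff[OF cont[of "cmod y"]] J0[of "cmod y"] w[of "cmod y"] nonneg y that
      by (auto simp del: integral_mult_left mult_eq_0_iff)
    from this[OF \<theta>(1)] show ?thesis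
      using y \<theta>(2) by (auto simp: power_eq_1_iff abs_square_eq_1)
  qed
  \<comment> \<open>A sequence in the punctured open disc with limit \<open>z\<close>; the centre is
    treated separately because shrinking would leave it fixed.\<close>
  define y where "y n = (if z = 0 then complex_of_real (1 / real (n + 2)) else complex_of_real (1 - 1 / real (n + 2)) * z)" for n
  have lim: "y \<longlonglongrightarrow> z"
  proof (cases "z = 0")
    case True
    have "(\<lambda>n. 1 / real (n + 2)) \<longlonglongrightarrow> 0"
      by (rule LIMSEQ_ignore_initial_segment[OF lim_1_over_n])
    from tendsto_of_real[OF this, where ?'a = complex] True show ?thesis by (simp add: y_def[abs_def])
  next
    case False
    have "(\<lambda>n. 1 / real (n + 2)) \<longlonglongrightarrow> 0"
      by (rule LIMSEQ_ignore_initial_segment[OF lim_1_over_n])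
    hence "(\<lambda>n. complex_of_real (1 - 1 / real (n + 2)) * z) \<longlonglongrightarrow> complex_of_real (1 - 0) * z"
      by (intro tendsto_intros)
    thus ?thesis using False by (simp add: y_def[abs_def])
  qed
  have y: "0 < cmod (y n)" "cmod (y n) < 1" for n
  proof -
    define t where "t = 1 / real (n + 2)"
    have t: "0 < t" "t < 1" by (auto simp: t_def)
    have "(1 - t) * cmod z \<le> (1 - t) * 1"
      using z t by (intro mult_left_mono) auto
    also have "\<dots> < 1" using t by simp
    finally have "(1 - t) * cmod z < 1" .
    moreover have "y n = (if z = 0 then complex_of_real t else complex_of_real (1 - t) * z)"
      by (simp only: y_def t_def)
    ultimately show "0 < cmod (y n)" "cmod (y n) < 1"
      using t by (auto simp: norm_mult simp del: of_real_diff)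
  qed
  have "(\<lambda>n. h (y n)) \<longlonglongrightarrow> h z"
    using y by (intro continuous_on_tendsto_compose[OF h lim z] always_eventually allI) (auto intro: less_imp_le)
  moreover have "(\<lambda>n. h (y n)) = (\<lambda>_. 0)" using * y by blast
  ultimately show "h z = 0" using LIMSEQ_unique tendsto_const by metis
qed

section \<open>Polynomials in \<open>z\<close> and its conjugate, and their density\<close>

inductive zpoly :: "(complex \<Rightarrow> complex) \<Rightarrow> bool" where
  monom: "zpoly (\<lambda>z. z ^ m * cnj z ^ n)"
| add: "zpoly f \<Longrightarrow> zpoly g \<Longrightarrow> zpoly (\<lambda>z. f z + g z)"
| scale: "zpoly f \<Longrightarrow> zpoly (\<lambda>z. c * f z)"

lemma zpoly_const: "zpoly (\<lambda>_. c)"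
  using zpoly.scale[OF zpoly.monom[of 0 0], of c] by simp

lemma zpoly_sum: "(\<And>i. i \<in> I \<Longrightarrow> zpoly (f i)) \<Longrightarrow> zpoly (\<lambda>z. \<Sum>i\<in>I. f i z)"
  by (induction I rule: infinite_finite_induct) (auto intro: zpoly.add zpoly_const)

lemma zpoly_mult:
  assumes "zpoly f" "zpoly g"
  shows "zpoly (\<lambda>z. f z * g z)"
  using assms
proof (induction rule: zpoly.induct)
  case (monom m n)
  thus ?case
  proof (induction rule: zpoly.induct)
    case (monom m' n')
    have "(\<lambda>z::complex. z ^ m * cnj z ^ n * (z ^ m' * cnj z ^ n')) = (\<lambda>z. z ^ (m + m') * cnj z ^ (n + n'))"
      by (simp add: power_add mult_ac)
    thus ?case by (simp only: zpoly.monom)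
  next
    case (add f g)
    from zpoly.add[OF add.IH] show ?case by (simp add: ring_distribs)
  next
    case (scale f c)
    from zpoly.scale[OF scale.IH, of c] show ?case by (simp add: mult_ac)
  qed
next
  case (add f g')
  from zpoly.add[OF add.IH] add.prems show ?case by (simp add: ring_distribs)
next
  case (scale f c)
  from zpoly.scale[OF scale.IH, of c] scale.prems show ?case by (simp add: mult_ac)
qed

lemma zpoly_power: "zpoly f \<Longrightarrow> zpoly (\<lambda>z. f z ^ n)"
  by (induction n) (auto intro: zpoly_const zpoly_mult)

lemma zpoly_continuous: "zpoly f \<Longrightarrow> continuous_on S f"
  by (induction rule: zpoly.induct) (auto intro!: continuous_intros)

lemma zpoly_real_polynomial:
  "real_polynomial_function f \<Longrightarrow> zpoly (\<lambda>z. complex_of_real (f z))"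
proof (induction rule: real_polynomial_function.induct)
  case (linear f)
  \<comment> \<open>A real linear functional is determined by its values at 1 and i, and
    \<open>Re z\<close> and \<open>Im z\<close> are combinations of \<open>z\<close> and
    \<open>cnj z\<close>.\<close>
  define c d where "c = complex_of_real (f 1)" and "d = complex_of_real (f \<i>)"
  have "zpoly (\<lambda>z. ((c - \<i> * d) / 2) * (z ^ 1 * cnj z ^ 0) + ((c + \<i> * d) / 2) * (z ^ 0 * cnj z ^ 1))"
    by (intro zpoly.intros)
  also have "(\<lambda>z. ((c - \<i> * d) / 2) * (z ^ 1 * cnj z ^ 0) + ((c + \<i> * d) / 2) * (z ^ 0 * cnj z ^ 1)) = (\<lambda>z. complex_of_real (f z))"
  proof
    fix z :: complex
    have "f z = f (Re z *\<^sub>R 1 + Im z *\<^sub>R \<i>)"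
      by (rule arg_cong[of _ _ f]) (simp add: complex_eq_iff)
    also have "\<dots> = Re z * f 1 + Im z * f \<i>"
      using linear by (simp add: linear_simps)
    finally show "((c - \<i> * d) / 2) * (z ^ 1 * cnj z ^ 0) + ((c + \<i> * d) / 2) * (z ^ 0 * cnj z ^ 1) = complex_of_real (f z)"
      by (simp add: complex_eq_iff c_def d_def field_simps)
  qed
  finally show ?case .
qed (auto intro: zpoly_const zpoly.add zpoly_mult)

lemma zpoly_dense:
  assumes F: "continuous_on (cball 0 1) F" and e: "0 < e"
  obtains P where "zpoly P" "\<And>z. z \<in> cball 0 1 \<Longrightarrow> cmod (F z - P z) < e"
proof -
  obtain g where g: "polynomial_function g" "\<And>z. z \<in> cball 0 1 \<Longrightarrow> cmod (F z - g z) < e"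
    using Stone_Weierstrass_polynomial_function[OF compact_cball F e] by blast
  have "real_polynomial_function (\<lambda>z. Re (g z))" "real_polynomial_function (\<lambda>z. Im (g z))"
    using g(1) bounded_linear_Re bounded_linear_Im unfolding polynomial_function_def by (auto simp: o_def)
  hence "zpoly (\<lambda>z. complex_of_real (Re (g z)) + \<i> * complex_of_real (Im (g z)))"
    by (intro zpoly.add zpoly.scale zpoly_real_polynomial)
  hence "zpoly g" by (simp flip: complex_eq)
  thus ?thesis using that g(2) by blast
qed

section \<open>Disc polynomials\<close>

text \<open>Pascal's rule: a difference of order \<open>n + 1\<close> is the difference of order
  \<open>n\<close> of the first difference.\<close>

lemma alt_sum_Suc:
  fixes f :: "nat \<Rightarrow> 'a::comm_ring_1"
  shows "(\<Sum>i\<le>Suc n. (-1) ^ i * of_nat (Suc n choose i) * f i) =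
         (\<Sum>i\<le>n. (-1) ^ i * of_nat (n choose i) * (f i - f (Suc i)))"
proof -
  have "(\<Sum>i\<le>Suc n. (-1) ^ i * of_nat (Suc n choose i) * f i) =
     f 0 - (\<Sum>i\<le>n. (-1) ^ i * of_nat (n choose Suc i) * f (Suc i)) - (\<Sum>i\<le>n. (-1) ^ i * of_nat (n choose i) * f (Suc i))"
    by (subst sum.atMost_Suc_shift)
      (simp add: ring_distribs sum.distrib sum_subtractf sum_negf)
  also have "f 0 - (\<Sum>i\<le>n. (-1) ^ i * of_nat (n choose Suc i) * f (Suc i)) = (\<Sum>i\<le>Suc n. (-1) ^ i * of_nat (n choose i) * f i)"
    by (subst sum.atMost_Suc_shift) (simp add: sum_negf)
  also have "\<dots> = (\<Sum>i\<le>n. (-1) ^ i * of_nat (n choose i) * f i)"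
    by (simp add: binomial_eq_0)
  finally show ?thesis by (simp only: right_diff_distrib sum_subtractf)
qed

text \<open>A difference of order \<open>n\<close> annihilates polynomials of degree below
  \<open>n\<close>. Lists of linear factors are the form in which quotients of factorials arise.
  Absorbing \<open>s\<close> into the binomial coefficient shifts \<open>s\<close> by one, which is
  why the induction generalizes over \<open>x\<close>.\<close>

lemma alt_sum_prod_eq_0:
  fixes cs :: "real list"
  assumes "length cs < n"
  shows "(\<Sum>s\<le>n. (-1) ^ s * real (n choose s) * (\<Prod>c\<leftarrow>cs. real s + x + c)) = 0"
  using assms
proof (induction cs arbitrary: n x)
  case Nil
  then obtain n' where n: "n = Suc n'" by (cases n) auto
  show ?case using alt_sum_Suc[of n' "\<lambda>_. 1 :: real"] by (simp add: n)
next
  case (Cons c cs)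
  then obtain n' where n: "n = Suc n'" by (cases n) auto
  let ?g = "\<lambda>x s. \<Prod>c\<leftarrow>cs. real s + x + c"
  have "(\<Sum>s\<le>n. (-1) ^ s * real (n choose s) * (\<Prod>c\<leftarrow>c # cs. real s + x + c)) =
     (\<Sum>s\<le>n. (-1) ^ s * (real s * real (n choose s)) * ?g x s)
      + (x + c) * (\<Sum>s\<le>n. (-1) ^ s * real (n choose s) * ?g x s)"
    by (simp add: sum_distrib_left sum.distrib[symmetric] algebra_simps)
  also have "(\<Sum>s\<le>n. (-1) ^ s * real (n choose s) * ?g x s) = 0"
    using Cons.prems by (intro Cons.IH) simp
  also have "(\<Sum>s\<le>n. (-1) ^ s * (real s * real (n choose s)) * ?g x s)
     = - (real n * (\<Sum>s\<le>n'. (-1) ^ s * real (n' choose s) * ?g (x + 1) s))"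
  proof -
    have absorb: "real (Suc s) * real (Suc n' choose Suc s) = real (Suc n') * real (n' choose s)" for s
      using Suc_times_binomial[of s n'] by (metis of_nat_mult)
    have shift: "?g x (Suc s) = ?g (x + 1) s" for s by (simp add: add_ac)
    have "(\<Sum>s\<le>n. (-1) ^ s * (real s * real (n choose s)) * ?g x s) =
       (\<Sum>s\<le>n'. (-1) ^ Suc s * (real (Suc s) * real (Suc n' choose Suc s)) * ?g x (Suc s))"
      unfolding n by (subst sum.atMost_Suc_shift) (simp del: of_nat_Suc binomial_Suc_Suc)
    also have "\<dots> = (\<Sum>s\<le>n'. (-1) ^ Suc s * (real n * real (n' choose s)) * ?g (x + 1) s)"
      by (simp only: absorb shift n)
    finally show ?thesis by (simp add: sum_distrib_left sum_negf mult_ac)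
  qed
  also have "(\<Sum>s\<le>n'. (-1) ^ s * real (n' choose s) * ?g (x + 1) s) = 0"
    using Cons.prems n by (intro Cons.IH) simp
  finally show ?case by simp
qed

text \<open>Division by \<open>s + d\<close> with remainder: the quotient has degree below
  \<open>n\<close> and is annihilated, and the remainder is the value of the product at
  \<open>s = - d\<close>.\<close>

lemma alt_sum_prod_divide:
  fixes cs :: "real list"
  assumes "length cs \<le> n" "0 < d"
  shows "(\<Sum>s\<le>n. (-1) ^ s * real (n choose s) * ((\<Prod>c\<leftarrow>cs. real s + c) / (real s + d))) =
         (\<Prod>c\<leftarrow>cs. c - d) * (\<Sum>s\<le>n. (-1) ^ s * real (n choose s) * (1 / (real s + d)))"
  using assms(1)
proof (induction cs)
  case (Cons c cs)
  have "(\<Prod>c\<leftarrow>c # cs. real s + c) / (real s + d) =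
          (\<Prod>c\<leftarrow>cs. real s + 0 + c) + (c - d) * ((\<Prod>c\<leftarrow>cs. real s + c) / (real s + d))" for s
  proof -
    have "real s + d \<noteq> 0" using assms(2) by (simp add: add_nonneg_eq_0_iff)
    thus ?thesis by (simp add: field_simps)
  qed
  hence "(\<Sum>s\<le>n. (-1) ^ s * real (n choose s) * ((\<Prod>c\<leftarrow>c # cs. real s + c) / (real s + d))) =
     (\<Sum>s\<le>n. (-1) ^ s * real (n choose s) * (\<Prod>c\<leftarrow>cs. real s + 0 + c)) +
     (c - d) * (\<Sum>s\<le>n. (-1) ^ s * real (n choose s) * ((\<Prod>c\<leftarrow>cs. real s + c) / (real s + d)))"
    by (simp only: sum_distrib_left sum.distrib[symmetric] ring_distribs mult_ac)
  also have "(\<Sum>s\<le>n. (-1) ^ s * real (n choose s) * (\<Prod>c\<leftarrow>cs. real s + 0 + c)) = 0"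
    using Cons.prems by (intro alt_sum_prod_eq_0) simp
  finally show ?case using Cons by simp
qed simp

text \<open>Up to \<open>fact L\<close>, the ratio of factorials is the integral of
  \<open>t ^ (k + i) * (1 - t) ^ L\<close> over the unit interval; the alternating sum inserts the
  factor \<open>(1 - t) ^ n\<close>.\<close>

lemma alt_sum_fact_divide:
  "(\<Sum>i\<le>n. (-1) ^ i * real (n choose i) * (fact (k + i) / fact (k + i + L + 1))) =
     fact (L + n) * fact k / (fact L * fact (k + n + L + 1))"
proof (induction n arbitrary: k)
  case (Suc n)
  have "(\<Sum>i\<le>Suc n. (-1) ^ i * real (Suc n choose i) * (fact (k + i) / fact (k + i + L + 1))) =
     (\<Sum>i\<le>n. (-1) ^ i * real (n choose i) * (fact (k + i) / fact (k + i + L + 1))) -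
     (\<Sum>i\<le>n. (-1) ^ i * real (n choose i) * (fact (Suc k + i) / fact (Suc k + i + L + 1)))"
    by (subst alt_sum_Suc) (simp add: sum_subtractf right_diff_distrib del: fact_Suc)
  also have "\<dots> = fact (L + n) * fact k / (fact L * fact (k + n + L + 1)) -
      fact (L + n) * fact (Suc k) / (fact L * fact (Suc k + n + L + 1))"
    by (simp only: Suc.IH)
  also have "\<dots> = fact (L + Suc n) * fact k / (fact L * fact (k + Suc n + L + 1))"
    by (simp add: divide_simps) (simp add: algebra_simps)
  finally show ?case .
qed simp

lemma fact_ratio:
  "fact (s + c + k) / fact (s + c) = (\<Prod>r\<leftarrow>map real [c + 1..<c + k + 1]. real s + r)"
proof (induction k)
  case (Suc k)
  have "fact (s + c + Suc k) / (fact (s + c) :: real) = (fact (s + c + k) / fact (s + c)) * (real s + real (c + k + 1))"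
    by (simp add: algebra_simps add_divide_distrib)
  thus ?case using Suc.IH by simp
qed simp

text \<open>Together with \<open>disc_const\<close> this is the coefficient of
  \<open>z ^ (m - k) * cnj z ^ (n - k)\<close> in the disc polynomial. The split isolates what does
  not depend on \<open>k\<close>, and both factors are symmetric in \<open>m\<close> and
  \<open>n\<close>.\<close>

definition disc_coeff :: "nat \<Rightarrow> nat \<Rightarrow> nat \<Rightarrow> nat \<Rightarrow> real" where
  "disc_coeff a m n k = (-1) ^ k * fact (m + n + a - k) / (fact k * fact (m - k) * fact (n - k))"

definition disc_const :: "nat \<Rightarrow> nat \<Rightarrow> nat \<Rightarrow> real" where
  "disc_const a m n = fact a * fact m * fact n / (fact (m + a) * fact (n + a))"

lemma disc_coeff_commute: "disc_coeff a m n k = disc_coeff a n m k"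
  by (simp add: disc_coeff_def add.commute mult_ac)

lemma disc_const_commute: "disc_const a m n = disc_const a n m"
  by (simp add: disc_const_def mult_ac)

lemma disc_const_pos: "0 < disc_const a m n"
  by (simp add: disc_const_def)

text \<open>Up to \<open>disc_const a m n\<close> this is the pairing of the disc polynomial with
  \<open>z ^ (m - i) * cnj z ^ (n - i)\<close>. After the reversal \<open>s = n - l\<close> it is a
  difference of order \<open>n\<close> in \<open>s\<close>: of a polynomial of degree
  \<open>n - 1\<close> if \<open>i > 0\<close>, and of one of degree \<open>n\<close> divided by
  \<open>s + m + a + 1\<close> if \<open>i = 0\<close>.\<close>

lemma alt_sum_moment_aux:
  assumes nm: "n \<le> m" and i: "i \<le> n"
  shows "(\<Sum>l\<le>n. disc_coeff a m n l * (fact (m + n - l - i) * fact (a + 1) / fact (m + n - l - i + a + 1))) =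
     (if i = 0 then (real a + 1) * fact (n + a) * fact (m + a) / fact (m + n + a + 1) else 0)"
    (is "?S = _")
proof -
  let ?P = "\<lambda>s. \<Prod>r\<leftarrow>map real [m - n + 1..<m - i + 1]. real s + r"
  have P: "fact (m + s - i) / fact (m - n + s) = ?P s" if "s \<le> n" for s
  proof -
    have "s + (m - n) + (n - i) = m + s - i" "m - n + (n - i) + 1 = m - i + 1" "s + (m - n) = m - n + s"
      using nm i by auto
    with fact_ratio[of s "m - n" "n - i"] show ?thesis by simp
  qed
  have "?S =
     (\<Sum>s\<le>n. disc_coeff a m n (n - s) * (fact (m + n - (n - s) - i) * fact (a + 1) / fact (m + n - (n - s) - i + a + 1)))"
    by (rule sum.reindex_bij_witness[of _ "\<lambda>s. n - s" "\<lambda>s. n - s"]) auto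
  also have "\<dots> = (\<Sum>s\<le>n. (-1) ^ n * fact (a + 1) / fact n *
       ((-1) ^ s * real (n choose s) * (?P s * (fact (m + a + s) / fact (m + s - i + a + 1)))))"
  proof (rule sum.cong[OF refl], goal_cases)
    case s: (1 s)
    have e: "m + n - (n - s) - i = m + s - i" "m + n + a - (n - s) = m + a + s" "m - (n - s) = m - n + s" "n - (n - s) = s"
      using s nm by auto
    have sgn: "(-1 :: real) ^ (n - s) = (-1) ^ n * (-1) ^ s"
      using s by (simp add: power_add[symmetric] minus_one_power_iff)
    have "real (n choose s) = fact n / (fact s * fact (n - s))"
      using s by (simp add: binomial_fact)
    thus ?case
      using s P[of s, symmetric] by (simp only: disc_coeff_def e sgn) (simp add: field_simps del: fact_Suc)
  qed
  also have "\<dots> = (-1) ^ n * fact (a + 1) / fact n *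
       (\<Sum>s\<le>n. (-1) ^ s * real (n choose s) * (?P s * (fact (m + a + s) / fact (m + s - i + a + 1))))"
    by (simp add: sum_distrib_left)
  finally have *: "?S = \<dots>" .
  show ?thesis
  proof (cases "i = 0")
    case False
    let ?Q = "\<lambda>s. \<Prod>r\<leftarrow>map real [m + a + 1 - i + 1..<m + a + 1]. real s + r"
    have Q: "fact (m + a + s) / fact (m + s - i + a + 1) = ?Q s" for s
    proof -
      have "m + s - i + a + 1 + (i - 1) = m + a + s" "m + a + 1 - i + (i - 1) + 1 = m + a + 1"
        "s + (m + a + 1 - i) = m + s - i + a + 1" using nm i False by auto
      with fact_ratio[of s "m + a + 1 - i" "i - 1"] show ?thesis by (simp only:)
    qed
    have "(\<Sum>s\<le>n. (-1) ^ s * real (n choose s) * (\<Prod>c\<leftarrow>map real [m - n + 1..<m - i + 1] @ map real [m + a + 1 - i + 1..<m + a + 1]. real s + 0 + c)) = 0"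
      using nm i False by (intro alt_sum_prod_eq_0) auto
    hence "(\<Sum>s\<le>n. (-1) ^ s * real (n choose s) * (?P s * ?Q s)) = 0"
      by simp
    thus ?thesis unfolding * Q using False by simp
  next
    case True
    have Q: "fact (m + a + s) / fact (m + s - i + a + 1) = 1 / (real s + real (m + a + 1))" for s
    proof -
      have e: "m + s - i + a + 1 = Suc (m + a + s)" "real s + real (m + a + 1) = real (Suc (m + a + s))"
        using True by auto
      show ?thesis unfolding e fact_Suc by (simp del: of_nat_Suc)
    qed
    have "(\<Prod>c\<leftarrow>map real [m - n + 1..<m - i + 1]. c - real (m + a + 1)) = (-1) ^ n * (fact (n + a) / fact a)"
    proof -
      have "(\<Prod>c\<leftarrow>map real [m - k + 1..<m + 1]. c - real (m + a + 1)) = (-1) ^ k * (fact (k + a) / fact a)" if "k \<le> m" for k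
        using that
      proof (induction k)
        case (Suc k)
        have "[m - Suc k + 1..<m + 1] = (m - k) # [m - k + 1..<m + 1]"
          using Suc.prems by (subst upt_rec) (auto simp: Suc_diff_Suc)
        hence "(\<Prod>c\<leftarrow>map real [m - Suc k + 1..<m + 1]. c - real (m + a + 1)) =
          (real (m - k) - real (m + a + 1)) * ((-1) ^ k * (fact (k + a) / fact a))"
          using Suc by (simp del: upt_Suc)
        also have "real (m - k) - real (m + a + 1) = - real (Suc (k + a))" using Suc.prems by (simp add: of_nat_diff)
        finally show ?case by (simp add: algebra_simps)
      qed simp
      from this[OF nm] True show ?thesis by simp
    qed
    moreover have "(\<Sum>s\<le>n. (-1) ^ s * real (n choose s) * (1 / (real s + real (m + a + 1)))) =
        fact n * fact (m + a) / fact (m + a + n + 1)"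
      using alt_sum_fact_divide[of n "m + a" 0]
      by (simp add: add_ac mult_ac divide_simps fact_reduce) 
    ultimately have S: "(\<Sum>s\<le>n. (-1) ^ s * real (n choose s) * (?P s * (1 / (real s + real (m + a + 1))))) =
       (-1) ^ n * (fact (n + a) / fact a) * (fact n * fact (m + a) / fact (m + a + n + 1))"
    proof -
      have "length (map real [m - n + 1..<m - i + 1]) \<le> n" "0 < real (m + a + 1)"
        using nm i by auto
      note alt_sum_prod_divide[OF this]
      also note \<open>(\<Prod>c\<leftarrow>map real [m - n + 1..<m - i + 1]. c - real (m + a + 1)) = _\<close>
      also note \<open>(\<Sum>s\<le>n. (-1) ^ s * real (n choose s) * (1 / (real s + real (m + a + 1)))) = _\<close>
      finally show ?thesis by (simp only: mult_1_right times_divide_eq_right)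
    qed
    have regroup: "f \<noteq> 0 \<Longrightarrow> x * u / f * (x * (v / w) * (f * y / t)) = (x * x) * (u / w) * v * y / t" for x u f v w y t :: real
      by (simp add: field_simps)
    have "(-1) ^ n * (-1) ^ n = (1 :: real)" "fact (a + 1) / fact a = real a + 1" "m + a + n + 1 = m + n + a + 1"
      by (auto simp flip: power_mult_distrib)
    thus ?thesis unfolding * Q S if_P[OF True] regroup[OF fact_nonzero] by (simp only: mult_1_left)
  qed
qed

lemma alt_sum_moment:
  assumes "i \<le> min m n"
  shows "(\<Sum>l\<le>min m n. disc_coeff a m n l * (fact (m + n - l - i) * fact (a + 1) / fact (m + n - l - i + a + 1))) =
     (if i = 0 then (real a + 1) * fact (n + a) * fact (m + a) / fact (m + n + a + 1) else 0)"
proof (cases "n \<le> m")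
  case True
  thus ?thesis using alt_sum_moment_aux[of n m i a] assms by (simp only: min_absorb2)
next
  case False
  hence le: "m \<le> n" by simp
  show ?thesis using alt_sum_moment_aux[of m n i a] assms le
    by (simp only: min_absorb1 disc_coeff_commute[of a n m] add.commute[of n m] mult_ac)
qed

section \<open>Monomial form of the Jacobi and disc polynomials\<close>

text \<open>The variable \<open>t\<close> stands for \<open>(cmod z)\<^sup>2\<close>, so that the
  two linear factors become \<open>t - 1\<close> and \<open>t\<close>. Expanding the powers of
  \<open>t - 1\<close> leaves, at each power of \<open>t\<close>, a Vandermonde convolution.\<close>

lemma jacobiP_expand:
  "jacobiP (real a) (real b) k (2 * t - 1) =
     (\<Sum>l\<le>k. (-1) ^ l * real ((k + b) choose l) * real ((2 * k + a + b - l) choose (k - l)) * t ^ (k - l))"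
proof -
  have gb: "(of_nat k + real c) gchoose j = real ((k + c) choose j)" for c j
    by (simp add: binomial_gbinomial)
  let ?T = "\<lambda>l s. real ((k + a) choose (k - s)) * real ((k + b) choose s) * real (s choose l) * (-1) ^ l * t ^ (s - l) * t ^ (k - s)"
  have x: "(2 * t - 1 - 1) / 2 = - 1 + t" "(2 * t - 1 + 1) / 2 = t" by (auto simp: field_simps)
  have "jacobiP (real a) (real b) k (2 * t - 1) =
      (\<Sum>s\<le>k. real ((k + a) choose (k - s)) * real ((k + b) choose s) * (\<Sum>l\<le>k. real (s choose l) * (-1) ^ l * t ^ (s - l)) * t ^ (k - s))"
    unfolding jacobiP_def gb x
  proof (intro sum.cong refl arg_cong2[of _ _ _ _ "(*)"])
    fix s assume s: "s \<in> {..k}"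
    have "(- 1 + t) ^ s = (\<Sum>l\<le>s. real (s choose l) * (-1) ^ l * t ^ (s - l))"
      by (rule binomial_ring)
    also have "\<dots> = (\<Sum>l\<le>k. real (s choose l) * (-1) ^ l * t ^ (s - l))"
      using s by (intro sum.mono_neutral_left) auto
    finally show "(- 1 + t) ^ s = \<dots>" .
  qed
  also have "\<dots> = (\<Sum>l\<le>k. \<Sum>s\<le>k. ?T l s)"
    by (subst sum.swap) (simp add: sum_distrib_left sum_distrib_right mult_ac)
  also have "\<dots> = (\<Sum>l\<le>k. (-1) ^ l * real ((k + b) choose l) * real ((2 * k + a + b - l) choose (k - l)) * t ^ (k - l))"
  proof (rule sum.cong[OF refl])
    fix l assume l: "l \<in> {..k}"
    have "(\<Sum>s\<le>k. ?T l s)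
       = (\<Sum>s\<in>{l..k}. ?T l s)"
      by (rule sum.mono_neutral_right) auto
    also have "\<dots> = (\<Sum>j\<le>k-l. (-1) ^ l * t ^ (k - l) * real ((k + b) choose l) * real (((k + b - l) choose j) * ((k + a) choose (k - l - j))))"
    proof (rule sum.reindex_bij_witness[of _ "\<lambda>j. l + j" "\<lambda>s. s - l"])
      fix s assume s: "s \<in> {l..k}"
      have "((k + b) choose s) * (s choose l) = ((k + b) choose l) * ((k + b - l) choose (s - l))"
        using s by (intro choose_mult) auto
      hence "real ((k + b) choose s) * real (s choose l) = real ((k + b) choose l) * real ((k + b - l) choose (s - l))"
        by (metis of_nat_mult)
      moreover have "t ^ (s - l) * t ^ (k - s) = t ^ (k - l)" using s by (simp flip: power_add)
      moreover have "k - l - (s - l) = k - s" using s by auto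
      ultimately have "(-1) ^ l * t ^ (k - l) * real ((k + b) choose l) * real (((k + b - l) choose (s - l)) * ((k + a) choose (k - l - (s - l))))
        = (-1) ^ l * (t ^ (s - l) * t ^ (k - s)) * real ((k + a) choose (k - s)) * (real ((k + b) choose s) * real (s choose l))"
        by (simp only: of_nat_mult mult_ac)
      thus "(-1) ^ l * t ^ (k - l) * real ((k + b) choose l) * real (((k + b - l) choose (s - l)) * ((k + a) choose (k - l - (s - l))))
        = ?T l s"
        by (simp only: mult_ac)
    qed (use l in auto)
    also have "\<dots> = (-1) ^ l * t ^ (k - l) * real ((k + b) choose l) *
        real (\<Sum>j\<le>k-l. ((k + b - l) choose j) * ((k + a) choose (k - l - j)))"
      by (simp add: sum_distrib_left)
    also have "(\<Sum>j\<le>k-l. ((k + b - l) choose j) * ((k + a) choose (k - l - j))) = (2 * k + a + b - l) choose (k - l)"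
    proof -
      have e: "2 * k + a + b - l = (k + b - l) + (k + a)" using l by simp
      show ?thesis unfolding e by (rule vandermonde)
    qed
    finally show "(\<Sum>s\<le>k. ?T l s)
       = (-1) ^ l * real ((k + b) choose l) * real ((2 * k + a + b - l) choose (k - l)) * t ^ (k - l)"
      by (simp add: mult_ac)
  qed
  finally show ?thesis .
qed

lemma jacobiP_at_1: "jacobiP (real a) b k 1 = real ((k + a) choose k)"
proof -
  have "jacobiP (real a) b k 1 = (\<Sum>s\<le>k. if s = 0 then real ((k + a) choose k) else 0)"
    unfolding jacobiP_def by (intro sum.cong) (auto simp: binomial_gbinomial)
  thus ?thesis by simp
qed

lemma jacobiR_expand:
  assumes "n \<le> m"
  shows "jacobiR (real a) (real (m - n)) n (2 * t - 1) =
     (\<Sum>l\<le>n. disc_const a m n * disc_coeff a m n l * t ^ (n - l))"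
  unfolding jacobiR_def jacobiP_expand jacobiP_at_1 sum_divide_distrib
proof (rule sum.cong[OF refl], goal_cases)
  case l: (1 l)
  have e: "n + (m - n) = m" "2 * n + a + (m - n) - l = m + n + a - l" "m + n + a - l - (n - l) = m + a" using assms l by auto
  have b: "real (m choose l) = fact m / (fact l * fact (m - l))" "real ((n + a) choose n) = fact (n + a) / (fact n * fact a)"
     "real ((m + n + a - l) choose (n - l)) = fact (m + n + a - l) / (fact (n - l) * fact (m + a))"
    using binomial_fact[of l m, where ?'a = real] binomial_fact[of n "n + a", where ?'a = real] binomial_fact[of "n - l" "m + n + a - l", where ?'a = real] assms l e by auto
  show ?case
    unfolding e b disc_const_def disc_coeff_def by (simp add: field_simps)
qed

abbreviation dpoly :: "nat \<Rightarrow> nat \<Rightarrow> nat \<Rightarrow> complex \<Rightarrow> complex" where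
  "dpoly a \<equiv> disc_poly (real a)"

abbreviation dpoly_coeff :: "nat \<Rightarrow> nat \<Rightarrow> nat \<Rightarrow> nat \<Rightarrow> complex" where
  "dpoly_coeff a m n l \<equiv> complex_of_real (disc_const a m n * disc_coeff a m n l)"

lemma disc_poly_cnj: "disc_poly \<alpha> m n (cnj z) = disc_poly \<alpha> n m z"
  by (cases "m = n") (auto simp: disc_poly_def)

lemma disc_poly_expand:
  "dpoly a m n z =
     (\<Sum>l\<le>min m n. dpoly_coeff a m n l * (z ^ (m - l) * cnj z ^ (n - l)))"
proof -
  have main: "dpoly a m n z =
     (\<Sum>l\<le>min m n. dpoly_coeff a m n l * (z ^ (m - l) * cnj z ^ (n - l)))"
    if "n \<le> m" for m n z
  proof -
    have sq: "(complex_of_real (cmod z))\<^sup>2 = z * cnj z" using complex_norm_square[of z] by simp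
    have "dpoly a m n z = (\<Sum>l\<le>n. z ^ (m - n) * dpoly_coeff a m n l * (z * cnj z) ^ (n - l))"
      unfolding disc_poly_def if_P[OF that] min_absorb2[OF that] jacobiR_expand[OF that]
      by (simp add: sum_distrib_left sq mult_ac)
    also have "\<dots> = (\<Sum>l\<le>n. dpoly_coeff a m n l * (z ^ (m - l) * cnj z ^ (n - l)))"
    proof (rule sum.cong[OF refl])
      fix l assume "l \<in> {..n}"
      hence "z ^ (m - l) = z ^ (m - n) * z ^ (n - l)" using that by (simp flip: power_add)
      thus "z ^ (m - n) * dpoly_coeff a m n l * (z * cnj z) ^ (n - l) =
        dpoly_coeff a m n l * (z ^ (m - l) * cnj z ^ (n - l))"
        by (simp add: power_mult_distrib mult_ac)
    qed
    finally show ?thesis using that by (simp add: min_def)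
  qed
  show ?thesis
  proof (cases "n \<le> m")
    case False
    hence "m \<le> n" by simp
    from main[OF this, of "cnj z"] show ?thesis
      by (simp add: disc_poly_cnj min.commute disc_coeff_commute[of a n m] disc_const_commute[of a n m] mult_ac)
  qed (rule main)
qed

lemma cnj_disc_poly: "cnj (dpoly a m n z) = dpoly a n m z"
  unfolding disc_poly_expand
  by (simp add: disc_coeff_commute[of a m n] disc_const_commute[of a m n] min.commute mult_ac)

lemma disc_poly_at_1: "dpoly a m n 1 = 1"
  using binomial_eq_0_iff unfolding disc_poly_def jacobiR_def by (auto simp: jacobiP_at_1)

lemma zpoly_disc_poly: "zpoly (dpoly a m n)"
proof -
  have "zpoly (\<lambda>z. dpoly a m n z)"
    unfolding disc_poly_expand by (intro zpoly_sum zpoly.scale zpoly.monom)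
  thus ?thesis .
qed

lemma disc_poly_continuous: "continuous_on S (dpoly a m n)"
  by (rule zpoly_continuous[OF zpoly_disc_poly])

section \<open>Orthogonality of the disc polynomials\<close>

lemma disc_mean_disc_poly_monomial:
  "disc_mean a (\<lambda>z. dpoly a m n z * cnj (z ^ p * cnj z ^ p')) =
     (\<Sum>l\<le>min m n. dpoly_coeff a m n l *
        (if m - l + p' = n - l + p
         then complex_of_real (fact (m - l + p') * fact (a + 1) / fact (m - l + p' + a + 1)) else 0))"
proof -
  have "disc_mean a (\<lambda>z. dpoly a m n z * cnj (z ^ p * cnj z ^ p')) =
    disc_mean a (\<lambda>z. \<Sum>l\<le>min m n. dpoly_coeff a m n l *
        (z ^ (m - l + p') * cnj z ^ (n - l + p)))"
    unfolding disc_poly_expand sum_distrib_right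
    by (simp only: power_add complex_cnj_mult complex_cnj_power complex_cnj_cnj mult_ac)
  also have "\<dots> = (\<Sum>l\<le>min m n. dpoly_coeff a m n l *
        disc_mean a (\<lambda>z. z ^ (m - l + p') * cnj z ^ (n - l + p)))"
    by (subst disc_mean_sum) (auto intro!: continuous_intros simp: disc_mean_scale)
  finally show ?thesis by (simp only: disc_mean_monomial)
qed

lemma disc_mean_disc_poly_lower:
  assumes i: "i \<le> min m n"
  shows "disc_mean a (\<lambda>z. dpoly a m n z * cnj (z ^ (m - i) * cnj z ^ (n - i))) =
     (if i = 0 then complex_of_real (disc_const a m n *
        ((real a + 1) * fact (n + a) * fact (m + a) / fact (m + n + a + 1))) else 0)"
proof -
  have "disc_mean a (\<lambda>z. dpoly a m n z * cnj (z ^ (m - i) * cnj z ^ (n - i))) =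
    (\<Sum>l\<le>min m n. complex_of_real (disc_const a m n *
       (disc_coeff a m n l * (fact (m + n - l - i) * fact (a + 1) / fact (m + n - l - i + a + 1)))))"
    unfolding disc_mean_disc_poly_monomial
  proof (rule sum.cong[OF refl], goal_cases)
    case (1 l)
    hence e: "m - l + (n - i) = n - l + (m - i)" "m - l + (n - i) = m + n - l - i" using i by auto
    show ?case
      by (simp only: if_P[OF e(1)]) (simp only: e(2) of_real_mult[symmetric] mult.assoc)
  qed
  also have "\<dots> = complex_of_real (disc_const a m n * (\<Sum>l\<le>min m n.
       disc_coeff a m n l * (fact (m + n - l - i) * fact (a + 1) / fact (m + n - l - i + a + 1))))"
    by (simp only: of_real_sum sum_distrib_left)
  finally show ?thesis unfolding alt_sum_moment[OF i] by simp
qed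

text \<open>Every monomial of \<open>dpoly a m n\<close> has angular frequency
  \<open>m - n\<close>.\<close>

lemma disc_mean_disc_poly_frequency:
  assumes "m + p' \<noteq> n + p"
  shows "disc_mean a (\<lambda>z. dpoly a m n z * cnj (z ^ p * cnj z ^ p')) = 0"
  unfolding disc_mean_disc_poly_monomial using assms by (intro sum.neutral) auto

lemma disc_mean_mult_cnj_disc_poly:
  assumes "continuous_on (cball 0 1) F"
  shows "disc_mean a (\<lambda>z. F z * cnj (dpoly a m n z)) =
    (\<Sum>l\<le>min m n. dpoly_coeff a m n l *
       disc_mean a (\<lambda>z. F z * cnj (z ^ (m - l) * cnj z ^ (n - l))))"
proof -
  have "disc_mean a (\<lambda>z. F z * cnj (dpoly a m n z)) =
     disc_mean a (\<lambda>z. \<Sum>l\<le>min m n. dpoly_coeff a m n l *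
       (F z * cnj (z ^ (m - l) * cnj z ^ (n - l))))"
    by (simp add: disc_poly_expand sum_distrib_left mult_ac)
  thus ?thesis using assms
    by (subst (asm) disc_mean_sum) (auto intro!: continuous_intros simp: disc_mean_scale)
qed

text \<open>Only equal frequencies matter. Since \<open>m' \<le> m\<close>, the monomials of the
  second polynomial are then \<open>z ^ (m - i) * cnj z ^ (n - i)\<close> with \<open>i > 0\<close>,
  the lower ones to which the first is orthogonal.\<close>

lemma disc_poly_orthogonal_aux:
  assumes "m' \<le> m" "(m, n) \<noteq> (m', n')"
  shows "disc_mean a (\<lambda>z. dpoly a m n z * cnj (dpoly a m' n' z)) = 0"
  unfolding disc_mean_mult_cnj_disc_poly[OF disc_poly_continuous]
proof (rule sum.neutral, rule ballI)
  fix l assume l: "l \<in> {..min m' n'}"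
  have "disc_mean a (\<lambda>z. dpoly a m n z * cnj (z ^ (m' - l) * cnj z ^ (n' - l))) = 0"
  proof (cases "m + n' = n + m'")
    case True
    define i where "i = m - m' + l"
    have "m' - l = m - i" "n' - l = n - i" "i \<le> min m n" "i \<noteq> 0"
      using assms l True by (auto simp: i_def)
    thus ?thesis using disc_mean_disc_poly_lower[of i m n a] by simp
  next
    case False
    hence "m + (n' - l) \<noteq> n + (m' - l)" using l by auto
    thus ?thesis by (rule disc_mean_disc_poly_frequency)
  qed
  thus "dpoly_coeff a m' n' l *
       disc_mean a (\<lambda>z. dpoly a m n z * cnj (z ^ (m' - l) * cnj z ^ (n' - l))) = 0" by simp
qed

lemma Ncoef_eq: "Ncoef (a + 2) m n = (real (m + n + a) + 1) / (real a + 1) * (fact (m + a) / (fact m * fact a)) * (fact (n + a) / (fact n * fact a))"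
  using binomial_fact[of a "m + a", where ?'a = real] binomial_fact[of a "n + a", where ?'a = real]
  by (simp add: Ncoef_def add_ac mult_ac)

lemma Ncoef_pos: "0 < Ncoef (a + 2) m n"
  unfolding Ncoef_eq by simp

text \<open>This identifies \<open>Ncoef\<close> as the reciprocal of the squared norm. On the
  diagonal only the leading monomial of the second factor contributes.\<close>

lemma disc_poly_orthogonal:
  "disc_mean a (\<lambda>z. dpoly a m n z * cnj (dpoly a m' n' z)) =
     (if (m, n) = (m', n') then complex_of_real (1 / Ncoef (a + 2) m n) else 0)"
proof (cases "(m, n) = (m', n')")
  case False
  show ?thesis
  proof (cases "m' \<le> m")
    case True
    thus ?thesis using disc_poly_orthogonal_aux[OF True False, of a] by (simp only: if_not_P[OF False])
  next
    case nle: False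
    have "disc_mean a (\<lambda>z. cnj (dpoly a m' n' z * cnj (dpoly a m n z))) = 0"
      unfolding disc_mean_cnj using disc_poly_orthogonal_aux[of m m' n' n a] False nle by auto
    thus ?thesis unfolding if_not_P[OF False] by (simp add: mult.commute)
  qed
next
  case True
  have "disc_mean a (\<lambda>z. dpoly a m n z * cnj (dpoly a m n z)) =
    (\<Sum>l\<le>min m n. if l = 0 then dpoly_coeff a m n 0 * complex_of_real (disc_const a m n *
        ((real a + 1) * fact (n + a) * fact (m + a) / fact (m + n + a + 1))) else 0)"
    unfolding disc_mean_mult_cnj_disc_poly[OF disc_poly_continuous]
  proof (rule sum.cong[OF refl], goal_cases)
    case (1 l)
    hence "l \<le> min m n" by simp
    from disc_mean_disc_poly_lower[OF this, of a]
    show ?case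
      by (cases "l = 0") (simp_all only: if_True if_False simp_thms mult_zero_right)
  qed
  also have "\<dots> = complex_of_real (disc_const a m n * disc_coeff a m n 0 * (disc_const a m n *
        ((real a + 1) * fact (n + a) * fact (m + a) / fact (m + n + a + 1))))"
    by simp
  also have "disc_const a m n * disc_coeff a m n 0 * (disc_const a m n *
        ((real a + 1) * fact (n + a) * fact (m + a) / fact (m + n + a + 1))) = 1 / Ncoef (a + 2) m n"
  proof -
    have F: "(fact (m + n + a + 1) :: real) = (real (m + n + a) + 1) * fact (m + n + a)" by simp
    have regroup: "x * M * N / (P * Q) * (1 * F / (1 * M * N)) * (x * M * N / (P * Q) * (A * Q * P / (S * F))) =
        1 / (S / A * (P / (M * x)) * (Q / (N * x)))"
      if "x \<noteq> 0" "M \<noteq> 0" "N \<noteq> 0" "P \<noteq> 0" "Q \<noteq> 0" "F \<noteq> 0" "A \<noteq> 0" "S \<noteq> 0" for x M N P Q F A S :: real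
      using that by (simp add: divide_simps)
    show ?thesis unfolding Ncoef_eq disc_const_def disc_coeff_def F power_0 diff_zero fact_0
      by (rule regroup) (auto simp: add_nonneg_eq_0_iff)
  qed
  finally show ?thesis using True by simp
qed

section \<open>The span of the disc polynomials\<close>

definition disc_span :: "nat \<Rightarrow> (complex \<Rightarrow> complex) \<Rightarrow> bool" where
  "disc_span a P \<longleftrightarrow> (\<exists>F c. finite F \<and> P = (\<lambda>z. \<Sum>p\<in>F. c p * dpoly a (fst p) (snd p) z))"

lemma disc_spanI:
  assumes "finite F" "\<And>z. P z = (\<Sum>p\<in>F. c p * dpoly a (fst p) (snd p) z)"
  shows "disc_span a P"
  unfolding disc_span_def by (intro exI[of _ F] exI[of _ c] conjI assms ext)

lemma disc_spanE:
  assumes "disc_span a P"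
  obtains F c where "finite F" "P = (\<lambda>z. \<Sum>p\<in>F. c p * dpoly a (fst p) (snd p) z)"
  using assms unfolding disc_span_def by blast

lemma disc_span_add:
  assumes "disc_span a f" "disc_span a g"
  shows "disc_span a (\<lambda>z. f z + g z)"
proof -
  let ?R = "\<lambda>p. dpoly a (fst p) (snd p)"
  obtain F c where F: "finite F" "f = (\<lambda>z. \<Sum>p\<in>F. c p * ?R p z)" by (rule disc_spanE[OF assms(1)])
  obtain G d where G: "finite G" "g = (\<lambda>z. \<Sum>p\<in>G. d p * ?R p z)" by (rule disc_spanE[OF assms(2)])
  define e where "e p = (if p \<in> F then c p else 0) + (if p \<in> G then d p else 0)" for p
  show ?thesis
  proof (rule disc_spanI)
    show "finite (F \<union> G)" using F(1) G(1) by simp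
    fix z
    have "f z = (\<Sum>p\<in>F \<union> G. (if p \<in> F then c p else 0) * ?R p z)"
      unfolding F(2) using F(1) G(1) by (intro sum.mono_neutral_cong_left) auto
    moreover have "g z = (\<Sum>p\<in>F \<union> G. (if p \<in> G then d p else 0) * ?R p z)"
      unfolding G(2) using F(1) G(1) by (intro sum.mono_neutral_cong_left) auto
    ultimately show "f z + g z = (\<Sum>p\<in>F \<union> G. e p * ?R p z)"
      by (simp only: e_def ring_distribs sum.distrib)
  qed
qed

lemma disc_span_scale:
  assumes "disc_span a f"
  shows "disc_span a (\<lambda>z. x * f z)"
proof -
  obtain F c where F: "finite F" "f = (\<lambda>z. \<Sum>p\<in>F. c p * dpoly a (fst p) (snd p) z)"
    by (rule disc_spanE[OF assms])
  show ?thesis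
    by (rule disc_spanI[OF F(1), of _ "\<lambda>p. x * c p"]) (simp add: F(2) sum_distrib_left mult.assoc)
qed

lemma disc_span_zero: "disc_span a (\<lambda>z. 0)"
  by (rule disc_spanI[of "{}"]) auto

lemma disc_span_disc_poly: "disc_span a (\<lambda>z. dpoly a m n z)"
  by (rule disc_spanI[of "{(m, n)}" _ "\<lambda>_. 1"]) auto

lemma disc_span_sum:
  assumes "\<And>i. i \<in> I \<Longrightarrow> disc_span a (f i)"
  shows "disc_span a (\<lambda>z. \<Sum>i\<in>I. f i z)"
  using assms
  by (induction I rule: infinite_finite_induct) (auto intro: disc_span_zero disc_span_add)

text \<open>The monomial expansion is triangular with nonzero leading coefficient, and its other
  terms have a smaller exponent of \<open>z\<close>.\<close>

lemma disc_span_monomial: "disc_span a (\<lambda>z. z ^ m * cnj z ^ n)"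
proof (induction m arbitrary: n rule: less_induct)
  case (less m)
  let ?C = "\<lambda>l. dpoly_coeff a m n l"
  let ?S = "\<lambda>z. \<Sum>l\<in>{1..min m n}. ?C l * (z ^ (m - l) * cnj z ^ (n - l))"
  have C0: "?C 0 \<noteq> 0" by (simp add: disc_const_def disc_coeff_def)
  have eq: "(\<lambda>z. z ^ m * cnj z ^ n) = (\<lambda>z. (1 / ?C 0) * (dpoly a m n z + (-1) * ?S z))"
  proof
    fix z :: complex
    have "{..min m n} = insert 0 {1..min m n}" by auto
    hence "dpoly a m n z = ?C 0 * (z ^ m * cnj z ^ n) + ?S z"
      unfolding disc_poly_expand by simp
    hence "?C 0 * (z ^ m * cnj z ^ n) = dpoly a m n z + (-1) * ?S z" by simp
    thus "z ^ m * cnj z ^ n = (1 / ?C 0) * (dpoly a m n z + (-1) * ?S z)"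
      using C0 by (metis nonzero_mult_div_cancel_left times_divide_eq_left mult_1_left)
  qed
  have "disc_span a (\<lambda>z. z ^ (m - l) * cnj z ^ (n - l))" if "l \<in> {1..min m n}" for l
    using that by (intro less.IH) auto
  thus ?case unfolding eq
    by (intro disc_span_scale disc_span_add disc_span_sum disc_span_disc_poly)
qed

lemma zpoly_span: "zpoly P \<Longrightarrow> disc_span a P"
  by (induction rule: zpoly.induct) (auto intro: disc_span_monomial disc_span_add disc_span_scale)

section \<open>Discrete means on the sphere\<close>

definition unity :: "nat \<Rightarrow> nat \<Rightarrow> complex" where
  "unity N w = exp (2 * of_real pi * \<i> * of_nat w / of_nat N)"

lemma cnj_unity_mult: "unity N w * cnj (unity N w) = 1" "cnj (unity N w) * unity N w = 1"
proof -
  have "cmod (unity N w) = 1" by (simp add: unity_def norm_exp)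
  thus "unity N w * cnj (unity N w) = 1" "cnj (unity N w) * unity N w = 1"
    using complex_norm_square[of "unity N w"] by (simp_all add: mult.commute)
qed

lemma norm_unity [simp]: "cmod (unity N w) = 1"
  by (simp add: unity_def norm_exp)

lemma unity_orthogonal:
  assumes "i < N" "j < N"
  shows "(\<Sum>w<N. unity N w ^ i * cnj (unity N w) ^ j) = (if i = j then of_nat N else 0)"
proof (cases "i = j")
  case True
  thus ?thesis by (simp add: cnj_unity_mult flip: power_mult_distrib)
next
  case False
  have N: "0 < N" using assms by simp
  define x where "x = unity N 1 ^ i * cnj (unity N 1) ^ j"
  have pow: "unity N w = unity N 1 ^ w" for w
    by (simp add: unity_def mult_ac flip: exp_of_nat_mult)
  have x: "unity N w ^ i * cnj (unity N w) ^ j = x ^ w" for w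
    by (simp add: x_def pow[of w] power_mult_distrib mult.commute flip: power_mult)
  have "unity N 1 ^ N = 1"
    using N by (simp add: unity_def flip: exp_of_nat_mult)
  moreover have "x ^ N = (unity N 1 ^ N) ^ i * cnj (unity N 1 ^ N) ^ j"
    by (simp only: x_def power_mult_distrib complex_cnj_power power_mult[symmetric] mult.commute)
  ultimately have "x ^ N = 1" by simp
  moreover have "x \<noteq> 1"
  proof
    assume "x = 1"
    have "unity N i = unity N i * (cnj (unity N j) * unity N j)" by (simp only: cnj_unity_mult mult_1_right)
    also have "\<dots> = x * unity N j"
      by (simp add: x_def pow[of i] pow[of j] mult.assoc)
    finally have "unity N i = unity N j" using \<open>x = 1\<close> by simp
    hence "i mod N = j mod N"
      using complex_root_unity_eq[of N i j] N by (simp add: unity_def mult_ac)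
    thus False using False assms by simp
  qed
  ultimately have "(\<Sum>w<N. x ^ w) = 0" using geometric_sum[of x N] by simp
  thus ?thesis using False by (simp only: x if_False)
qed

definition glue :: "real \<Rightarrow> complex \<Rightarrow> (nat \<Rightarrow> complex) \<Rightarrow> nat \<Rightarrow> complex" where
  "glue r e \<zeta> i = (case i of 0 \<Rightarrow> complex_of_real r * e | Suc j \<Rightarrow> complex_of_real (sqrt (1 - r\<^sup>2)) * \<zeta> j)"

text \<open>A left Riemann sum of step \<open>1 / n\<close> for
  \<open>2 * (d + 1) * r * (1 - r\<^sup>2) ^ d\<close>, the density of the modulus of one coordinate
  on the sphere in \<open>d + 2\<close> complex dimensions.\<close>

definition stick_weight :: "nat \<Rightarrow> nat \<Rightarrow> nat \<Rightarrow> real" where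
  "stick_weight n d s = 2 * real (d + 1) * (real s / real n) * (1 - (real s / real n)\<^sup>2) ^ d / real n"

text \<open>Weighted points on the unit sphere in \<open>d + 1\<close> complex dimensions. As \<open>n\<close> grows
  they approximate the rotation invariant probability measure: the first coordinate has the law of
  the disc, the remaining ones are a scaled point of the sphere of one dimension less.\<close>
primrec sphere_pts :: "nat \<Rightarrow> nat \<Rightarrow> (real \<times> (nat \<Rightarrow> complex)) list" where
  "sphere_pts n 0 = map (\<lambda>w. (1 / real (Suc n), \<lambda>i. if i = 0 then unity (Suc n) w else 0)) [0..<Suc n]"
| "sphere_pts n (Suc d) = concat (map (\<lambda>s. concat (map (\<lambda>w. map (\<lambda>(v, \<zeta>).
     (stick_weight n d s / real (Suc n) * v, glue (real s / real n) (unity (Suc n) w) \<zeta>)) (sphere_pts n d))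
     [0..<Suc n])) [0..<n])"

text \<open>Not normalized: the total weight \<open>smean n d (\<lambda>_. 1)\<close> is only known
  to tend to 1, so it appears as a factor in the estimates below.\<close>

definition smean :: "nat \<Rightarrow> nat \<Rightarrow> ((nat \<Rightarrow> complex) \<Rightarrow> complex) \<Rightarrow> complex" where
  "smean n d h = (\<Sum>(v, x)\<leftarrow>sphere_pts n d. complex_of_real v * h x)"

definition hip :: "nat \<Rightarrow> (nat \<Rightarrow> complex) \<Rightarrow> (nat \<Rightarrow> complex) \<Rightarrow> complex" where
  "hip q x y = (\<Sum>k<q. x k * cnj (y k))"

definition usphere :: "nat \<Rightarrow> (nat \<Rightarrow> complex) set" where
  "usphere q = {x. (\<Sum>k<q. (cmod (x k))\<^sup>2) = 1}"

lemma sum_list_upt: "sum_list (map f [0..<n]) = (\<Sum>i<n. f i)"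
  by (simp add: interv_sum_list_conv_sum_set_nat atLeast0LessThan)

lemma sum_list_concat_map: "sum_list (concat (map f xs)) = (\<Sum>x\<leftarrow>xs. sum_list (f x))"
  by (induction xs) auto

lemma smean_0: "smean n 0 h = (\<Sum>w<Suc n. h (\<lambda>i. if i = 0 then unity (Suc n) w else 0)) / of_nat (Suc n)"
  unfolding smean_def sphere_pts.simps map_map o_def split_def fst_conv snd_conv sum_list_upt
  by (simp only: sum_divide_distrib) (simp add: field_simps)

lemma smean_Suc:
  "smean n (Suc d) h = (\<Sum>s<n. \<Sum>w<Suc n. complex_of_real (stick_weight n d s / real (Suc n)) *
     smean n d (\<lambda>\<zeta>. h (glue (real s / real n) (unity (Suc n) w) \<zeta>)))"
  unfolding smean_def sphere_pts.simps map_concat map_map o_def split_def fst_conv snd_conv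
    sum_list_concat_map sum_list_upt
  by (simp only: sum_list_const_mult[symmetric] of_real_mult mult.assoc)

lemma smean_add: "smean n d (\<lambda>x. h x + g x) = smean n d h + smean n d g"
  by (simp add: smean_def ring_distribs sum_list_addf split_def)

lemma smean_scale: "smean n d (\<lambda>x. c * h x) = c * smean n d h"
proof -
  have "(\<Sum>(v, x)\<leftarrow>xs. complex_of_real v * (c * h x)) = c * (\<Sum>(v, x)\<leftarrow>xs. complex_of_real v * h x)" for xs
    by (induction xs) (auto simp: ring_distribs mult_ac)
  thus ?thesis by (simp add: smean_def)
qed

lemma smean_diff: "smean n d (\<lambda>x. h x - g x) = smean n d h - smean n d g"
  using smean_add[of n d h "\<lambda>x. (-1) * g x"] smean_scale[of n d "-1" g] by simp

lemma smean_sum: "smean n d (\<lambda>x. \<Sum>i\<in>I. h i x) = (\<Sum>i\<in>I. smean n d (h i))"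
proof -
  have zero: "smean n d (\<lambda>x. 0) = 0" using smean_scale[of n d 0 "\<lambda>x. 0"] by simp
  show ?thesis
    by (induction I rule: infinite_finite_induct) (auto simp: zero smean_add)
qed

lemma stick_weight_nonneg: "s < n \<Longrightarrow> 0 \<le> stick_weight n d s"
  unfolding stick_weight_def
  by (intro divide_nonneg_nonneg mult_nonneg_nonneg zero_le_power) (auto simp: power_le_one)

lemma sphere_pts_props:
  assumes "(v, x) \<in> set (sphere_pts n d)"
  shows "0 \<le> v \<and> x \<in> usphere (Suc d)"
  using assms
proof (induction d arbitrary: v x)
  case 0
  thus ?case by (auto simp: usphere_def)
next
  case (Suc d)
  then obtain s w v' \<zeta> where s: "s < n" and \<zeta>: "(v', \<zeta>) \<in> set (sphere_pts n d)"
    and v: "v = stick_weight n d s / real (Suc n) * v'" and x: "x = glue (real s / real n) (unity (Suc n) w) \<zeta>"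
    by auto
  define r where "r = real s / real n"
  have r: "0 \<le> r" "r \<le> 1" using s by (auto simp: r_def)
  have "(\<Sum>k<Suc (Suc d). (cmod (x k))\<^sup>2) = r\<^sup>2 + (\<Sum>k<Suc d. (1 - r\<^sup>2) * (cmod (\<zeta> k))\<^sup>2)"
    unfolding sum.lessThan_Suc_shift[of _ "Suc d"] x r_def[symmetric] using r
    by (simp add: glue_def norm_mult power_mult_distrib power_le_one abs_square_le_1)
  also have "\<dots> = 1" using Suc.IH[OF \<zeta>] by (simp add: usphere_def flip: sum_distrib_left)
  finally show ?case using Suc.IH[OF \<zeta>] v s stick_weight_nonneg[OF s, of d] by (simp add: usphere_def)
qed

lemma smean_nth: "smean n d h = (\<Sum>j<length (sphere_pts n d).
    complex_of_real (fst (sphere_pts n d ! j)) * h (snd (sphere_pts n d ! j)))"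
  by (simp add: smean_def sum_list_sum_nth split_def atLeast0LessThan)

text \<open>The weights themselves serve as the coefficient vector of the quadratic form.\<close>

lemma smean_double_nonneg:
  assumes "\<And>N x. (\<And>j. j < N \<Longrightarrow> x j \<in> usphere (Suc d)) \<Longrightarrow> psd N (\<lambda>j k. K (x j) (x k))"
  shows "smean n d (\<lambda>x. smean n d (\<lambda>y. K x y)) \<in> \<real>\<^sub>\<ge>\<^sub>0"
proof -
  let ?L = "sphere_pts n d"
  have "snd (?L ! j) \<in> usphere (Suc d)" if "j < length ?L" for j
    using sphere_pts_props[of "fst (?L ! j)" "snd (?L ! j)" n d] nth_mem[OF that] by simp
  hence "psd (length ?L) (\<lambda>j k. K (snd (?L ! j)) (snd (?L ! k)))" by (intro assms)
  from this[unfolded psd_def, rule_format, of "\<lambda>j. complex_of_real (fst (?L ! j))"]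
  show ?thesis unfolding smean_nth by (simp add: sum_distrib_left mult_ac)
qed

lemma schur_pos_smean:
  assumes "\<And>\<zeta>. \<zeta> \<in> usphere (Suc d) \<Longrightarrow> schur_pos X (K \<zeta>)"
  shows "schur_pos X (\<lambda>x y. smean n d (\<lambda>\<zeta>. K \<zeta> x y))"
  unfolding smean_nth
proof (intro schur_pos_sum schur_pos_scale assms)
  fix j assume "j \<in> {..<length (sphere_pts n d)}"
  thus "snd (sphere_pts n d ! j) \<in> usphere (Suc d)" "0 \<le> fst (sphere_pts n d ! j)"
    using sphere_pts_props[of "fst (sphere_pts n d ! j)" "snd (sphere_pts n d ! j)" n d] nth_mem by simp_all
qed

lemma norm_smean_le:
  assumes "\<And>x. x \<in> usphere (Suc d) \<Longrightarrow> cmod (h x) \<le> B"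
  shows "cmod (smean n d h) \<le> B * cmod (smean n d (\<lambda>_. 1))"
proof -
  have gen: "cmod (\<Sum>(v, x)\<leftarrow>xs. complex_of_real v * h x) \<le> B * (\<Sum>(v, x)\<leftarrow>xs. v)"
    if "\<And>v x. (v, x) \<in> set xs \<Longrightarrow> 0 \<le> v \<and> cmod (h x) \<le> B" for xs
    using that
  proof (induction xs)
    case (Cons p xs)
    obtain v x where p: "p = (v, x)" by (cases p)
    have vx: "0 \<le> v" "cmod (h x) \<le> B" using Cons.prems p by auto
    have "cmod (complex_of_real v * h x) \<le> v * B"
      using vx by (simp add: norm_mult mult_left_mono)
    moreover have "cmod (\<Sum>(v, x)\<leftarrow>xs. complex_of_real v * h x) \<le> B * (\<Sum>(v, x)\<leftarrow>xs. v)"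
      using Cons.prems by (intro Cons.IH) auto
    ultimately show ?case unfolding p
      by (simp add: ring_distribs mult.commute) (meson add_mono norm_triangle_le)
  qed simp
  have one: "smean n d (\<lambda>_. 1) = complex_of_real (\<Sum>(v, x)\<leftarrow>sphere_pts n d. v)"
  proof -
    have "(\<Sum>(v, x)\<leftarrow>xs. complex_of_real v * 1) = complex_of_real (\<Sum>(v, x)\<leftarrow>xs. v)"
      for xs :: "(real \<times> (nat \<Rightarrow> complex)) list"
      by (induction xs) auto
    thus ?thesis by (simp add: smean_def)
  qed
  have nonneg: "0 \<le> (\<Sum>(v, x)\<leftarrow>sphere_pts n d. v)"
    using sphere_pts_props by (intro sum_list_nonneg) fastforce
  have "0 \<le> v \<and> cmod (h x) \<le> B" if "(v, x) \<in> set (sphere_pts n d)" for v x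
    using sphere_pts_props[OF that] assms by blast
  from gen[OF this] have "cmod (smean n d h) \<le> B * (\<Sum>(v, x)\<leftarrow>sphere_pts n d. v)"
    unfolding smean_def .
  thus ?thesis using nonneg by (simp add: one)
qed

lemma hip_Suc: "hip (Suc q) x y = x 0 * cnj (y 0) + hip q (\<lambda>i. x (Suc i)) (\<lambda>i. y (Suc i))"
  by (simp add: hip_def sum.lessThan_Suc_shift del: sum.lessThan_Suc)

lemma hip_glue:
  "hip (Suc q) x (glue r e \<zeta>) = complex_of_real r * (x 0 * cnj e) + complex_of_real (sqrt (1 - r\<^sup>2)) * hip q (\<lambda>i. x (Suc i)) \<zeta>"
  "hip (Suc q) (glue r e \<zeta>) y = complex_of_real r * (e * cnj (y 0)) + complex_of_real (sqrt (1 - r\<^sup>2)) * hip q \<zeta> (\<lambda>i. y (Suc i))"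
  unfolding hip_Suc by (auto simp: glue_def hip_def sum_distrib_left mult_ac)

lemma cnj_hip: "cnj (hip q x y) = hip q y x"
  by (simp add: hip_def mult.commute)

lemma hip_self: "x \<in> usphere q \<Longrightarrow> hip q x x = 1"
proof -
  assume "x \<in> usphere q"
  moreover have "hip q x x = complex_of_real (\<Sum>k<q. (cmod (x k))\<^sup>2)"
    unfolding hip_def of_real_sum complex_norm_square ..
  ultimately show ?thesis by (simp add: usphere_def)
qed

lemma norm_hip_le_1:
  assumes "x \<in> usphere q" "y \<in> usphere q"
  shows "cmod (hip q x y) \<le> 1"
proof -
  have "cmod (hip q x y) \<le> (\<Sum>k<q. cmod (x k) * cmod (y k))"
    unfolding hip_def by (rule sum_norm_le) (simp add: norm_mult)
  also have "\<dots> \<le> (\<Sum>k<q. ((cmod (x k))\<^sup>2 + (cmod (y k))\<^sup>2) / 2)"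
  proof (rule sum_mono)
    fix k show "cmod (x k) * cmod (y k) \<le> ((cmod (x k))\<^sup>2 + (cmod (y k))\<^sup>2) / 2"
      using sum_squares_bound[of "cmod (x k)" "cmod (y k)"] by simp
  qed
  also have "\<dots> = 1" using assms by (simp add: usphere_def sum.distrib flip: sum_divide_distrib)
  finally show ?thesis .
qed

lemma usphere_coord_le:
  assumes "x \<in> usphere q" "k < q"
  shows "cmod (x k) \<le> 1"
proof -
  have "(cmod (x k))\<^sup>2 \<le> (\<Sum>k<q. (cmod (x k))\<^sup>2)"
    using assms(2) by (intro member_le_sum) auto
  thus ?thesis using assms(1) by (simp add: usphere_def abs_square_le_1)
qed

section \<open>Moments of the point sets and their limits\<close>

definition sphere_moment :: "nat \<Rightarrow> nat \<Rightarrow> nat \<Rightarrow> nat \<Rightarrow> (nat \<Rightarrow> complex) \<Rightarrow> (nat \<Rightarrow> complex) \<Rightarrow> complex" where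
  "sphere_moment n d p p' x y = smean n d (\<lambda>\<zeta>. hip (Suc d) x \<zeta> ^ p * hip (Suc d) \<zeta> y ^ p')"

lemma hip_1: "hip (Suc 0) x y = x 0 * cnj (y 0)"
  by (simp add: hip_def)

text \<open>The bounds on \<open>p\<close> and \<open>p'\<close> keep both exponents below the
  number \<open>Suc n\<close> of roots of unity, where orthogonality is exact.\<close>

lemma sphere_moment_0:
  assumes "p \<le> n" "p' \<le> n"
  shows "sphere_moment n 0 p p' x y = (if p = p' then (hip 1 x y) ^ p else 0)"
proof -
  have "sphere_moment n 0 p p' x y = (\<Sum>w<Suc n. x 0 ^ p * cnj (y 0) ^ p' * (unity (Suc n) w ^ p' * cnj (unity (Suc n) w) ^ p)) / of_nat (Suc n)"
    unfolding sphere_moment_def smean_0 by (simp add: hip_1 power_mult_distrib mult_ac del: sum.lessThan_Suc)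
  also have "\<dots> = x 0 ^ p * cnj (y 0) ^ p' * (if p' = p then 1 else 0)"
    using assms by (simp only: sum_distrib_left[symmetric] unity_orthogonal le_imp_less_Suc) (simp del: of_nat_Suc)
  finally show ?thesis by (simp add: hip_1 power_mult_distrib)
qed

text \<open>In the binomial expansion along the first coordinate, averaging over its phase keeps
  only the terms with equal powers on both sides. What remains is a radial Riemann sum times a
  moment of the tails.\<close>

lemma sphere_moment_Suc:
  assumes n: "p \<le> n" "p' \<le> n"
  shows "sphere_moment n (Suc d) p p' x y =
    (\<Sum>i\<le>min p p'. of_nat ((p choose i) * (p' choose i)) * (x 0 * cnj (y 0)) ^ i *
      (complex_of_real (\<Sum>s<n. stick_weight n d s * ((real s / real n) ^ (2 * i) * sqrt (1 - (real s / real n)\<^sup>2) ^ (p - i + (p' - i)))) *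
       sphere_moment n d (p - i) (p' - i) (\<lambda>i. x (Suc i)) (\<lambda>i. y (Suc i))))"
proof -
  define M where "M i j = sphere_moment n d i j (\<lambda>i. x (Suc i)) (\<lambda>i. y (Suc i))" for i j
  define r where "r s = complex_of_real (real s / real n)" for s
  define t where "t s = complex_of_real (sqrt (1 - (real s / real n)\<^sup>2))" for s
  define e where "e w = unity (Suc n) w" for w
  define W where "W s = complex_of_real (stick_weight n d s)" for s
  define C where "C i j = (of_nat (p choose i) * x 0 ^ i * (of_nat (p' choose j) * cnj (y 0) ^ j))" for i j
  let ?B = "\<lambda>s i j. C i j * (r s ^ (i + j) * t s ^ (p - i + (p' - j)))" and ?D = "\<lambda>s i. W s * C i i * (r s ^ (2 * i) * t s ^ (p - i + (p' - i))) * M (p - i) (p' - i)"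
  have inner: "smean n d (\<lambda>\<zeta>. hip (Suc (Suc d)) x (glue (real s / real n) (unity (Suc n) w) \<zeta>) ^ p *
       hip (Suc (Suc d)) (glue (real s / real n) (unity (Suc n) w) \<zeta>) y ^ p') =
     (\<Sum>i\<le>p. \<Sum>j\<le>p'. ?B s i j * (e w ^ j * cnj (e w) ^ i) * M (p - i) (p' - j))" for s w
  proof -
    let ?x = "\<lambda>i. x (Suc i)" and ?y = "\<lambda>i. y (Suc i)"
    have "hip (Suc (Suc d)) x (glue (real s / real n) (unity (Suc n) w) \<zeta>) ^ p *
       hip (Suc (Suc d)) (glue (real s / real n) (unity (Suc n) w) \<zeta>) y ^ p' =
      (\<Sum>i\<le>p. \<Sum>j\<le>p'. (?B s i j * (e w ^ j * cnj (e w) ^ i)) *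
         (hip (Suc d) ?x \<zeta> ^ (p - i) * hip (Suc d) \<zeta> ?y ^ (p' - j)))" for \<zeta>
      unfolding hip_glue binomial_ring sum_product r_def[symmetric] t_def[symmetric] e_def[symmetric] C_def
      by (intro sum.cong refl) (simp only: power_mult_distrib power_add mult_ac)
    thus ?thesis by (simp only: smean_sum smean_scale M_def sphere_moment_def)
  qed
  have "sphere_moment n (Suc d) p p' x y = (\<Sum>s<n. \<Sum>w<Suc n. W s / of_nat (Suc n) *
      (\<Sum>i\<le>p. \<Sum>j\<le>p'. ?B s i j * (e w ^ j * cnj (e w) ^ i) * M (p - i) (p' - j)))"
    unfolding sphere_moment_def smean_Suc inner W_def by simp
  also have "\<dots> = (\<Sum>s<n. \<Sum>i\<le>p. \<Sum>j\<le>p'. \<Sum>w<Suc n. W s / of_nat (Suc n) *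
       (?B s i j * (e w ^ j * cnj (e w) ^ i) * M (p - i) (p' - j)))"
  proof -
    have "(\<Sum>w<Suc n. \<Sum>i\<le>p. \<Sum>j\<le>p'. Y w i j) = (\<Sum>i\<le>p. \<Sum>j\<le>p'. \<Sum>w<Suc n. Y w i j)"
      for Y :: "nat \<Rightarrow> nat \<Rightarrow> nat \<Rightarrow> complex"
      by (subst sum.swap, rule sum.cong[OF refl], rule sum.swap)
    thus ?thesis by (simp only: sum_distrib_left)
  qed
  also have "\<dots> = (\<Sum>s<n. \<Sum>i\<le>p. \<Sum>j\<le>p'. W s / of_nat (Suc n) * C i j * (r s ^ (i + j) * t s ^ (p - i + (p' - j))) *
       M (p - i) (p' - j) * (\<Sum>w<Suc n. e w ^ j * cnj (e w) ^ i))"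
    by (intro sum.cong refl) (simp only: sum_distrib_left mult_ac)
  also have "\<dots> = (\<Sum>s<n. \<Sum>i\<le>p. \<Sum>j\<le>p'. if j = i then ?D s i else 0)"
  proof (intro sum.cong refl, goal_cases)
    case (1 s i j)
    hence "(\<Sum>w<Suc n. e w ^ j * cnj (e w) ^ i) = (if j = i then of_nat (Suc n) else 0)"
      unfolding e_def using n by (intro unity_orthogonal) auto
    thus ?case
      by (simp add: mult_2 del: of_nat_Suc sum.lessThan_Suc)
  qed
  also have "\<dots> = (\<Sum>s<n. \<Sum>i\<le>p. if i \<le> p' then ?D s i else 0)"
    by (intro sum.cong refl) (simp add: sum.delta)
  also have "\<dots> = (\<Sum>s<n. \<Sum>i\<le>min p p'. ?D s i)"
    by (intro sum.cong refl sum.mono_neutral_cong_right) auto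
  also have "\<dots> = (\<Sum>i\<le>min p p'. C i i * ((\<Sum>s<n. W s * (r s ^ (2 * i) * t s ^ (p - i + (p' - i)))) * M (p - i) (p' - i)))"
    by (subst sum.swap) (simp add: sum_distrib_left sum_distrib_right mult_ac)
  finally show ?thesis
    by (simp add: M_def C_def W_def r_def t_def power_mult_distrib mult_ac)
qed

lemma sphere_moment_neq:
  assumes "p \<le> n" "p' \<le> n" "p \<noteq> p'"
  shows "sphere_moment n d p p' x y = 0"
  using assms
proof (induction d arbitrary: p p' x y)
  case 0
  thus ?case by (simp add: sphere_moment_0)
next
  case (Suc d)
  have "sphere_moment n d (p - i) (p' - i) x y = 0" if "i \<in> {..min p p'}" for i x y
    using Suc.prems that by (intro Suc.IH) auto
  thus ?case unfolding sphere_moment_Suc[OF Suc.prems(1,2)]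
    by (intro sum.neutral ballI) (simp only: mult_zero_right)
qed

text \<open>The mean value theorem for the primitive writes the integral exactly as a sum over
  intermediate points \<open>\<xi> s\<close>; uniform continuity replaces these by the left end
  points.\<close>

lemma riemann_sum_tendsto:
  fixes g :: "real \<Rightarrow> real"
  assumes g: "continuous_on {0..1} g"
  shows "(\<lambda>n. \<Sum>s<n. g (real s / real n) / real n) \<longlonglongrightarrow> integral {0..1} g"
proof (rule LIMSEQ_I)
  fix e :: real assume e: "0 < e"
  obtain \<delta> where \<delta>: "0 < \<delta>" "\<And>x y. x \<in> {0..1} \<Longrightarrow> y \<in> {0..1} \<Longrightarrow> \<bar>y - x\<bar> < \<delta> \<Longrightarrow> \<bar>g y - g x\<bar> < e"
    using compact_uniformly_continuous[OF g compact_Icc] e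
    unfolding uniformly_continuous_on_def dist_real_def by metis
  define G where "G x = integral {0..x} g" for x
  obtain N where N: "0 < N" "1 / real N < \<delta>"
    using \<delta>(1) reals_Archimedean[of \<delta>] by (metis inverse_eq_divide zero_less_Suc)
  show "\<exists>N. \<forall>n\<ge>N. norm ((\<Sum>s<n. g (real s / real n) / real n) - integral {0..1} g) < e"
  proof (intro exI allI impI)
    fix n assume n: "N \<le> n"
    let ?x = "\<lambda>s. real s / real n"
    have n0: "0 < n" using n N by simp
    have nd: "1 / real n < \<delta>" using n N n0 by (meson frac_le le_less_trans less_eq_real_def of_nat_0_less_iff of_nat_mono order.refl zero_le_one)
    have "\<exists>x. \<bar>x - ?x s\<bar> < \<delta> \<and> x \<in> {0..1} \<and> G (?x (Suc s)) - G (?x s) = g x / real n" if s: "s < n" for s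
    proof -
      have lt: "?x s < ?x (Suc s)" using n0 by (simp add: divide_strict_right_mono)
      have le: "0 \<le> ?x s" "?x (Suc s) \<le> 1" using s n0 by auto
      have len: "?x (Suc s) - ?x s = 1 / real n" by (simp add: add_divide_distrib)
      have der: "(G has_real_derivative g x) (at x within {0..1})" if "x \<in> {0..1}" for x
        unfolding G_def[abs_def] using integral_has_real_derivative[OF g that] .
      have "\<exists>x\<in>{?x s<..<?x (Suc s)}. G (?x (Suc s)) - G (?x s) = (?x (Suc s) - ?x s) * g x"
      proof (rule mvt_simple[OF lt, where f' = "\<lambda>x h. h * g x"], goal_cases)
        case (1 x)
        have "(G has_real_derivative g x) (at x within {?x s..?x (Suc s)})"
          by (rule DERIV_subset[OF der]) (use 1 le in \<open>auto intro: order_trans[OF le(1)] order_trans[OF _ le(2)]\<close>)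
        thus ?case by (simp add: has_field_derivative_def mult_commute_abs)
      qed
      then obtain x where x: "?x s < x" "x < ?x (Suc s)"
        "G (?x (Suc s)) - G (?x s) = (?x (Suc s) - ?x s) * g x" by auto
      have "\<bar>x - ?x s\<bar> < \<delta>" using x(1,2) len nd by linarith
      moreover have "x \<in> {0..1}" using x(1,2) le unfolding atLeastAtMost_iff by linarith
      moreover have "G (?x (Suc s)) - G (?x s) = g x / real n" using x(3) len by simp
      ultimately show ?thesis by blast
    qed
    then obtain \<xi> where \<xi>: "\<And>s. s < n \<Longrightarrow> \<bar>\<xi> s - ?x s\<bar> < \<delta>" "\<And>s. s < n \<Longrightarrow> \<xi> s \<in> {0..1}"
      "\<And>s. s < n \<Longrightarrow> G (?x (Suc s)) - G (?x s) = g (\<xi> s) / real n" by metis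
    have "integral {0..1} g = (\<Sum>s<n. G (?x (Suc s)) - G (?x s))"
      using n0 by (subst sum_lessThan_telescope) (simp add: G_def)
    also have "\<dots> = (\<Sum>s<n. g (\<xi> s) / real n)" using \<xi> by (intro sum.cong) auto
    finally have "(\<Sum>s<n. g (?x s) / real n) - integral {0..1} g = (\<Sum>s<n. (g (?x s) - g (\<xi> s)) / real n)"
      by (simp add: diff_divide_distrib sum_subtractf)
    also have "\<bar>\<dots>\<bar> \<le> (\<Sum>s<n. \<bar>(g (?x s) - g (\<xi> s)) / real n\<bar>)" by (rule sum_abs)
    also have "\<dots> < (\<Sum>s<n. e / real n)"
    proof (rule sum_strict_mono)
      fix s assume "s \<in> {..<n}"
      hence s: "s < n" by simp
      have "\<bar>g (?x s) - g (\<xi> s)\<bar> < e"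
        using \<delta>(2)[of "\<xi> s" "?x s"] \<xi>[OF s] s by (simp add: abs_minus_commute)
      thus "\<bar>(g (?x s) - g (\<xi> s)) / real n\<bar> < e / real n"
        using n0 by (simp add: divide_strict_right_mono)
    qed (use n0 in auto)
    also have "\<dots> = e" using n0 by simp
    finally show "norm ((\<Sum>s<n. g (?x s) / real n) - integral {0..1} g) < e" by simp
  qed
qed

lemma stick_moment_tendsto:
  "(\<lambda>n. \<Sum>s<n. stick_weight n d s * ((real s / real n) ^ (2 * i) * sqrt (1 - (real s / real n)\<^sup>2) ^ (k + k)))
     \<longlonglongrightarrow> (real d + 1) * (fact i * fact (d + k) / fact (i + d + k + 1))"
proof -
  define g :: "real \<Rightarrow> real" where "g = (\<lambda>r. 2 * (real d + 1) * (r ^ (2 * i + 1) * (1 - r\<^sup>2) ^ (d + k)))"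
  have "stick_weight n d s * ((real s / real n) ^ (2 * i) * sqrt (1 - (real s / real n)\<^sup>2) ^ (k + k)) = g (real s / real n) / real n"
    if "s < n" for n s
  proof -
    define r where "r = real s / real n"
    have "0 \<le> 1 - r\<^sup>2" using that by (auto simp: r_def power_le_one)
    hence "sqrt (1 - r\<^sup>2) ^ (k + k) = (1 - r\<^sup>2) ^ k"
      by (simp add: power_add flip: power_mult_distrib)
    thus ?thesis unfolding stick_weight_def g_def r_def[symmetric] by (simp add: power_add mult_ac)
  qed
  hence "(\<lambda>n. \<Sum>s<n. stick_weight n d s * ((real s / real n) ^ (2 * i) * sqrt (1 - (real s / real n)\<^sup>2) ^ (k + k)))
     = (\<lambda>n. \<Sum>s<n. g (real s / real n) / real n)" by (intro ext sum.cong) auto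
  moreover have "integral {0..1} g = (real d + 1) * (fact i * fact (d + k) / fact (i + d + k + 1))"
  proof -
    have "2 * (real d + 1) * (fact i * fact (d + k) / (2 * fact (i + (d + k) + 1))) =
        (real d + 1) * (fact i * fact (d + k) / fact (i + d + k + 1))"
    proof -
      have "2 * A * (B / (2 * F)) = A * (B / F)" for A B F :: real by simp
      thus ?thesis by (simp only: add.assoc)
    qed
    thus ?thesis unfolding g_def
      using integral_unique[OF has_integral_mult_right[OF radial_integral[of i "d + k"], of "2 * (real d + 1)"]]
      by (simp only:)
  qed
  moreover have "(\<lambda>n. \<Sum>s<n. g (real s / real n) / real n) \<longlonglongrightarrow> integral {0..1} g"
    by (rule riemann_sum_tendsto) (auto simp: g_def intro!: continuous_intros)
  ultimately show ?thesis by simp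
qed

lemma uniform_limit_sum:
  fixes f :: "'i \<Rightarrow> 'a \<Rightarrow> 'b \<Rightarrow> 'c::real_normed_vector"
  assumes "\<And>i. i \<in> I \<Longrightarrow> uniform_limit S (f i) (l i) F"
  shows "uniform_limit S (\<lambda>n x. \<Sum>i\<in>I. f i n x) (\<lambda>x. \<Sum>i\<in>I. l i x) F"
  using assms
  by (induction I rule: infinite_finite_induct) (auto intro: uniform_limit_const uniform_limit_add)

lemma uniform_limit_of_tendsto:
  assumes "(t \<longlongrightarrow> l) F"
  shows "uniform_limit S (\<lambda>n x. t n) (\<lambda>x. l) F"
proof (rule uniform_limitI)
  fix e :: real assume "0 < e"
  from tendstoD[OF assms this] show "\<forall>\<^sub>F n in F. \<forall>x\<in>S. dist (t n) l < e" by eventually_elim auto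
qed

text \<open>Induction on the dimension passes to tails of vectors. The tail of a unit vector need
  not be a unit vector, but its coordinates stay bounded by 1.\<close>

definition polydisc :: "nat \<Rightarrow> ((nat \<Rightarrow> complex) \<times> (nat \<Rightarrow> complex)) set" where
  "polydisc q = {z. \<forall>i<q. cmod (fst z i) \<le> 1 \<and> cmod (snd z i) \<le> 1}"

lemma norm_hip_polydisc:
  assumes "z \<in> polydisc q"
  shows "cmod (hip q (fst z) (snd z)) \<le> real q"
proof -
  have "cmod (hip q (fst z) (snd z)) \<le> (\<Sum>k<q. 1)"
    unfolding hip_def using assms
    by (intro sum_norm_le) (auto simp: norm_mult polydisc_def intro: mult_le_one)
  thus ?thesis by simp
qed

text \<open>The limit is the reproducing property of the invariant measure: the average of
  \<open>\<langle>x, \<zeta>\<rangle>\<^sup>p \<langle>\<zeta>, y\<rangle>\<^sup>p\<close> is a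
  multiple of \<open>\<langle>x, y\<rangle>\<^sup>p\<close>. Uniformity matters because the double
  mean below uses these moments at all points of the sphere at once.\<close>

lemma sphere_moment_uniform_limit:
  "uniform_limit (polydisc (Suc d)) (\<lambda>n z. sphere_moment n d p p (fst z) (snd z))
     (\<lambda>z. complex_of_real (fact p * fact d / fact (p + d)) * hip (Suc d) (fst z) (snd z) ^ p) sequentially"
proof (induction d arbitrary: p)
  case 0
  have "\<forall>\<^sub>F n in sequentially. \<forall>z\<in>polydisc (Suc 0). hip (Suc 0) (fst z) (snd z) ^ p = sphere_moment n 0 p p (fst z) (snd z)"
    using eventually_ge_at_top[of p] by eventually_elim (simp add: sphere_moment_0)
  hence "uniform_limit (polydisc (Suc 0)) (\<lambda>n z. hip (Suc 0) (fst z) (snd z) ^ p)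
     (\<lambda>z. hip (Suc 0) (fst z) (snd z) ^ p) sequentially \<longleftrightarrow> ?case"
    by (intro uniform_limit_cong) auto
  thus ?case using uniform_limit_const by blast
next
  case (Suc d)
  let ?S = "polydisc (Suc (Suc d))"
  define tl :: "(nat \<Rightarrow> complex) \<times> (nat \<Rightarrow> complex) \<Rightarrow> (nat \<Rightarrow> complex) \<times> (nat \<Rightarrow> complex)"
    where "tl z = ((\<lambda>i. fst z (Suc i)), (\<lambda>i. snd z (Suc i)))" for z
  define u :: "(nat \<Rightarrow> complex) \<times> (nat \<Rightarrow> complex) \<Rightarrow> complex" where "u z = fst z 0 * cnj (snd z 0)" for z
  define K where "K i z = of_nat ((p choose i) * (p choose i)) * u z ^ i" for i z
  define t where "t i n = complex_of_real (\<Sum>s<n. stick_weight n d s *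
      ((real s / real n) ^ (2 * i) * sqrt (1 - (real s / real n)\<^sup>2) ^ (p - i + (p - i))))" for i n
  define T where "T i = complex_of_real ((real d + 1) * (fact i * fact (d + (p - i)) / fact (i + d + (p - i) + 1)))" for i
  define M where "M i n z = sphere_moment n d (p - i) (p - i) (fst (tl z)) (snd (tl z))" for i n z
  define m where "m i z = complex_of_real (fact (p - i) * fact d / fact (p - i + d)) * hip (Suc d) (fst (tl z)) (snd (tl z)) ^ (p - i)" for i z
  have tl: "tl z \<in> polydisc (Suc d)" if "z \<in> ?S" for z
    using that by (auto simp: tl_def polydisc_def)
  have u: "cmod (u z) \<le> 1" if "z \<in> ?S" for z
    using that by (auto simp: u_def polydisc_def norm_mult intro!: mult_le_one)
  have "uniform_limit ?S (\<lambda>n z. \<Sum>i\<le>p. K i z * (t i n * M i n z)) (\<lambda>z. \<Sum>i\<le>p. K i z * (T i * m i z)) sequentially"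
  proof (rule uniform_limit_sum)
    fix i assume i: "i \<in> {..p}"
    have t: "uniform_limit ?S (\<lambda>n z. t i n) (\<lambda>z. T i) sequentially"
      unfolding t_def T_def by (intro uniform_limit_of_tendsto tendsto_of_real stick_moment_tendsto)
    have M: "uniform_limit ?S (M i) (m i) sequentially"
    proof (rule uniform_limitI)
      fix e :: real assume "0 < e"
      from uniform_limitD[OF Suc.IH[of "p - i"] this]
      show "\<forall>\<^sub>F n in sequentially. \<forall>z\<in>?S. dist (M i n z) (m i z) < e"
        unfolding M_def m_def by eventually_elim (use tl in blast)
    qed
    have "cmod (K i z) \<le> real ((p choose i) * (p choose i)) * 1" if "z \<in> ?S" for z
      unfolding K_def norm_mult norm_of_nat norm_power
      using u[OF that] by (intro mult_left_mono power_le_one) auto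
    hence bK: "bounded (K i ` ?S)" unfolding bounded_iff by blast
    have bT: "bounded ((\<lambda>z. T i) ` ?S)" unfolding bounded_iff by blast
    have m: "cmod (m i z) \<le> cmod (complex_of_real (fact (p - i) * fact d / fact (p - i + d))) * real (Suc d) ^ (p - i)" if "z \<in> ?S" for z
      unfolding m_def norm_mult norm_power
      using norm_hip_polydisc[OF tl[OF that]] by (intro mult_left_mono power_mono) auto
    hence bm: "bounded (m i ` ?S)" unfolding bounded_iff by blast
    have "cmod (T i * m i z) \<le> cmod (T i) * (cmod (complex_of_real (fact (p - i) * fact d / fact (p - i + d))) * real (Suc d) ^ (p - i))" if "z \<in> ?S" for z
      unfolding norm_mult[of "T i"] by (intro mult_left_mono m that) auto
    hence bTm: "bounded ((\<lambda>z. T i * m i z) ` ?S)" unfolding bounded_iff by blast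
    show "uniform_limit ?S (\<lambda>n z. K i z * (t i n * M i n z)) (\<lambda>z. K i z * (T i * m i z)) sequentially"
      by (rule uniform_lim_mult[OF uniform_limit_const uniform_lim_mult[OF t M bT bm] bK bTm])
  qed
  also have "?this \<longleftrightarrow> ?case"
  proof (rule uniform_limit_cong)
    show "\<forall>\<^sub>F n in sequentially. \<forall>z\<in>?S. (\<Sum>i\<le>p. K i z * (t i n * M i n z)) = sphere_moment n (Suc d) p p (fst z) (snd z)"
      using eventually_ge_at_top[of p]
    proof eventually_elim
      case (elim n)
      show ?case
        unfolding sphere_moment_Suc[OF elim elim] K_def t_def M_def u_def tl_def by simp
    qed
    \<comment> \<open>The Beta factor reduces the square of the binomial coefficient to its first
      power, so that the sum closes by the binomial theorem.\<close>
    have coeff: "real ((p choose i) * (p choose i)) * ((real d + 1) * (fact i * fact (d + (p - i)) / fact (i + d + (p - i) + 1))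
         * (fact (p - i) * fact d / fact (p - i + d))) = fact p * fact (Suc d) / fact (p + Suc d) * real (p choose i)" if "i \<le> p" for i
    proof -
      have e: "i + d + (p - i) + 1 = p + Suc d" "p - i + d = d + (p - i)" using that by auto
      have regroup: "(P / (I * J) * (P / (I * J))) * (D * (I * X / Y) * (J * E / X)) = P * (D * E) / Y * (P / (I * J))"
        if "I \<noteq> 0" "J \<noteq> 0" "X \<noteq> 0" "Y \<noteq> 0" for P I J D X Y E :: real
        using that by (simp add: field_simps)
      have "fact (Suc d) = (real d + 1) * fact d" by simp
      thus ?thesis using that
        by (simp only: e of_nat_mult binomial_fact) (rule regroup, auto)
    qed
    fix z assume "z \<in> ?S"
    show "(\<Sum>i\<le>p. K i z * (T i * m i z)) =
        complex_of_real (fact p * fact (Suc d) / fact (p + Suc d)) * hip (Suc (Suc d)) (fst z) (snd z) ^ p"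
    proof -
      have "hip (Suc (Suc d)) (fst z) (snd z) = u z + hip (Suc d) (fst (tl z)) (snd (tl z))"
        by (simp add: hip_Suc[of "Suc d"] u_def tl_def)
      hence "complex_of_real (fact p * fact (Suc d) / fact (p + Suc d)) * hip (Suc (Suc d)) (fst z) (snd z) ^ p =
        (\<Sum>i\<le>p. complex_of_real (fact p * fact (Suc d) / fact (p + Suc d) * real (p choose i)) * (u z ^ i * hip (Suc d) (fst (tl z)) (snd (tl z)) ^ (p - i)))"
        by (simp only: binomial_ring sum_distrib_left of_real_mult of_real_of_nat_eq mult.assoc)
      also have "\<dots> = (\<Sum>i\<le>p. K i z * (T i * m i z))"
      proof (rule sum.cong[OF refl])
        fix i assume "i \<in> {..p}"
        hence "i \<le> p" by simp
        show "complex_of_real (fact p * fact (Suc d) / fact (p + Suc d) * real (p choose i)) * (u z ^ i * hip (Suc d) (fst (tl z)) (snd (tl z)) ^ (p - i)) = K i z * (T i * m i z)"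
          unfolding coeff[OF \<open>i \<le> p\<close>, symmetric] K_def T_def m_def
          by (simp only: of_real_mult of_real_of_nat_eq of_nat_mult mult_ac)
      qed
      finally show "(\<Sum>i\<le>p. K i z * (T i * m i z)) =
        complex_of_real (fact p * fact (Suc d) / fact (p + Suc d)) * hip (Suc (Suc d)) (fst z) (snd z) ^ p" ..
    qed
  qed
  finally show ?case .
qed

lemma sphere_moment_tendsto:
  "(\<lambda>n. sphere_moment n d p p x y) \<longlonglongrightarrow> complex_of_real (fact p * fact d / fact (p + d)) * hip (Suc d) x y ^ p"
  if "\<And>i. i < Suc d \<Longrightarrow> cmod (x i) \<le> 1" "\<And>i. i < Suc d \<Longrightarrow> cmod (y i) \<le> 1"
  using tendsto_uniform_limitI[OF sphere_moment_uniform_limit[of d p], of "(x, y)"] that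
  by (simp add: polydisc_def)

lemma smean_one_tendsto: "(\<lambda>n. smean n d (\<lambda>_. 1)) \<longlonglongrightarrow> 1"
  using sphere_moment_tendsto[of d "\<lambda>_. 0" "\<lambda>_. 0" 0] by (simp add: sphere_moment_def)

section \<open>The law of the inner product of two random unit vectors\<close>

definition double_mean :: "nat \<Rightarrow> nat \<Rightarrow> (complex \<Rightarrow> complex) \<Rightarrow> complex" where
  "double_mean n d F = smean n d (\<lambda>x. smean n d (\<lambda>y. F (hip (Suc d) x y)))"

text \<open>For equal exponents the inner mean tends to a constant on the sphere, because
  \<open>\<langle>x, x\<rangle> = 1\<close>. With \<open>d = a + 1\<close> this constant is the
  moment of the disc.\<close>

lemma double_mean_monomial_tendsto:
  "(\<lambda>n. double_mean n (Suc a) (\<lambda>z. z ^ p * cnj z ^ p')) \<longlonglongrightarrow> disc_mean a (\<lambda>z. z ^ p * cnj z ^ p')"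
proof -
  let ?d = "Suc a"
  have eq: "double_mean n ?d (\<lambda>z. z ^ p * cnj z ^ p') = smean n ?d (\<lambda>x. sphere_moment n ?d p p' x x)" for n
    unfolding double_mean_def sphere_moment_def cnj_hip ..
  show ?thesis
  proof (cases "p = p'")
    case False
    have "\<forall>\<^sub>F n in sequentially. 0 = double_mean n ?d (\<lambda>z. z ^ p * cnj z ^ p')"
      using eventually_ge_at_top[of "max p p'"]
    proof eventually_elim
      case (elim n)
      thus ?case using False smean_scale[of n ?d 0 "\<lambda>_. 0"] unfolding eq by (simp add: sphere_moment_neq)
    qed
    from iffD1[OF tendsto_cong[OF this] tendsto_const] show ?thesis using False by (simp add: disc_mean_monomial)
  next
    case True
    let ?c = "complex_of_real (fact p * fact ?d / fact (p + ?d))"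
    let ?X = "\<lambda>n. smean n ?d (\<lambda>x. sphere_moment n ?d p p x x)" and ?W = "\<lambda>n. smean n ?d (\<lambda>_. 1)"
    have "(\<lambda>n. ?X n - ?c * ?W n) \<longlonglongrightarrow> 0"
    proof (rule LIMSEQ_I)
      fix e :: real assume e: "0 < e"
      have "\<forall>\<^sub>F n in sequentially. cmod (?W n) < 2"
        using order_tendstoD(2)[OF tendsto_norm[OF smean_one_tendsto[of ?d]], of 2] by simp
      moreover have "\<forall>\<^sub>F n in sequentially. \<forall>z\<in>polydisc (Suc ?d). dist (sphere_moment n ?d p p (fst z) (snd z)) (?c * hip (Suc ?d) (fst z) (snd z) ^ p) < e / 2"
        using e by (intro uniform_limitD[OF sphere_moment_uniform_limit]) simp
      ultimately have "\<forall>\<^sub>F n in sequentially. norm (?X n - ?c * ?W n - 0) < e"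
      proof eventually_elim
        case (elim n)
        have "cmod (sphere_moment n ?d p p x x - ?c * 1) \<le> e / 2" if "x \<in> usphere (Suc ?d)" for x
        proof -
          have "(x, x) \<in> polydisc (Suc ?d)" using usphere_coord_le[OF that] by (auto simp: polydisc_def)
          with elim(2) have "dist (sphere_moment n ?d p p x x) (?c * hip (Suc ?d) x x ^ p) < e / 2" by fastforce
          thus ?thesis using hip_self[OF that] by (simp add: dist_norm)
        qed
        from norm_smean_le[OF this, where n = n]
        have "cmod (?X n - ?c * ?W n) \<le> e / 2 * cmod (?W n)"
          unfolding smean_diff smean_scale .
        also have "\<dots> < e / 2 * 2" using elim(1) e by (intro mult_strict_left_mono) auto
        finally show ?case by simp
      qed
      thus "\<exists>N. \<forall>n\<ge>N. norm (?X n - ?c * ?W n - 0) < e"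
        unfolding eventually_sequentially .
    qed
    from tendsto_add[OF this tendsto_mult[OF tendsto_const[of ?c] smean_one_tendsto[of ?d]]]
    have "(\<lambda>n. ?X n) \<longlonglongrightarrow> ?c" by simp
    thus ?thesis unfolding eq using True by (simp add: disc_mean_monomial)
  qed
qed

lemma double_mean_zpoly_tendsto:
  "zpoly P \<Longrightarrow> (\<lambda>n. double_mean n (Suc a) P) \<longlonglongrightarrow> disc_mean a P"
proof (induction rule: zpoly.induct)
  case (monom m n)
  show ?case by (rule double_mean_monomial_tendsto)
next
  case (add f g)
  have "disc_mean a (\<lambda>z. f z + g z) = disc_mean a f + disc_mean a g"
    by (intro disc_mean_add zpoly_continuous add.hyps)
  thus ?case using tendsto_add[OF add.IH] by (simp add: double_mean_def smean_add)
next
  case (scale f c)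
  show ?case using tendsto_mult[OF tendsto_const scale.IH, of c]
    by (simp add: double_mean_def smean_scale disc_mean_scale)
qed

lemma double_mean_tendsto:
  assumes F: "continuous_on (cball 0 1) F"
  shows "(\<lambda>n. double_mean n (Suc a) F) \<longlonglongrightarrow> disc_mean a F"
proof (rule LIMSEQ_I)
  fix e :: real assume e: "0 < e"
  \<comment> \<open>Replacing \<open>F\<close> by \<open>P\<close> costs \<open>4 * \<delta>\<close>
    in the double mean, whose two total weights are below 2, and
    \<open>2 * (a + 1) * \<delta>\<close> in the disc mean; the convergence for \<open>P\<close>
    costs one more \<open>\<delta>\<close>.\<close>
  define \<delta> where "\<delta> = e / (4 + 2 * (real a + 1) + 1)"
  have \<delta>: "0 < \<delta>" "(4 + 2 * (real a + 1) + 1) * \<delta> = e"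
    using e by (auto simp: \<delta>_def add_pos_nonneg)
  obtain P where P: "zpoly P" "\<And>z. z \<in> cball 0 1 \<Longrightarrow> cmod (F z - P z) < \<delta>"
    using zpoly_dense[OF F \<delta>(1)] by blast
  have "cmod (disc_mean a (\<lambda>z. F z - P z)) \<le> 2 * (real a + 1) * \<delta>"
    using P by (intro norm_disc_mean_le continuous_intros F zpoly_continuous) (auto intro: less_imp_le)
  hence L: "cmod (disc_mean a F - disc_mean a P) \<le> 2 * (real a + 1) * \<delta>"
    using P by (simp add: disc_mean_diff F zpoly_continuous)
  have "\<forall>\<^sub>F n in sequentially. cmod (smean n (Suc a) (\<lambda>_. 1)) < 2"
    using order_tendstoD(2)[OF tendsto_norm[OF smean_one_tendsto[of "Suc a"]], of 2] by simp
  moreover have "\<forall>\<^sub>F n in sequentially. dist (double_mean n (Suc a) P) (disc_mean a P) < \<delta>"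
    using double_mean_zpoly_tendsto[OF P(1)] \<delta>(1) by (rule tendstoD)
  ultimately have "\<forall>\<^sub>F n in sequentially. norm (double_mean n (Suc a) F - disc_mean a F) < e"
  proof eventually_elim
    case (elim n)
    let ?W = "cmod (smean n (Suc a) (\<lambda>_. 1))"
    have "cmod (smean n (Suc a) (\<lambda>y. F (hip (Suc (Suc a)) x y) - P (hip (Suc (Suc a)) x y))) \<le> \<delta> * ?W"
      if "x \<in> usphere (Suc (Suc a))" for x
      using P(2) norm_hip_le_1[OF that] by (intro norm_smean_le less_imp_le) auto
    from norm_smean_le[OF this, where n = n]
    have "cmod (double_mean n (Suc a) F - double_mean n (Suc a) P) \<le> \<delta> * ?W * ?W"
      unfolding double_mean_def smean_diff by simp
    also have "\<dots> \<le> \<delta> * 2 * 2" using \<delta>(1) elim(1) by (intro mult_mono) auto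
    finally have 1: "cmod (double_mean n (Suc a) F - double_mean n (Suc a) P) \<le> 4 * \<delta>" by simp
    have "double_mean n (Suc a) F - disc_mean a F = (double_mean n (Suc a) F - double_mean n (Suc a) P) +
       (double_mean n (Suc a) P - disc_mean a P) - (disc_mean a F - disc_mean a P)" by simp
    also have "cmod \<dots> \<le> cmod (double_mean n (Suc a) F - double_mean n (Suc a) P) +
       cmod (double_mean n (Suc a) P - disc_mean a P) + cmod (disc_mean a F - disc_mean a P)"
      by (meson norm_triangle_ineq norm_triangle_ineq4 order_trans add_right_mono)
    also have "\<dots> < 4 * \<delta> + \<delta> + 2 * (real a + 1) * \<delta>"
      using 1 L elim(2) by (simp add: dist_norm)
    also have "\<dots> = e" using \<delta>(2) by (simp add: algebra_simps)
    finally show ?case .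
  qed
  thus "\<exists>N. \<forall>n\<ge>N. norm (double_mean n (Suc a) F - disc_mean a F) < e"
    unfolding eventually_sequentially .
qed

lemma disc_mean_zonal_nonneg:
  assumes F: "continuous_on (cball 0 1) F"
    and psd: "\<And>N x. (\<And>j. j < N \<Longrightarrow> x j \<in> usphere (a + 2)) \<Longrightarrow> psd N (\<lambda>j k. F (hip (a + 2) (x j) (x k)))"
  shows "disc_mean a F \<in> \<real>\<^sub>\<ge>\<^sub>0"
proof (rule lim_in_nonneg_Reals)
  show "(\<lambda>n. double_mean n (Suc a) F) \<longlonglongrightarrow> disc_mean a F" by (rule double_mean_tendsto[OF F])
  show "double_mean n (Suc a) F \<in> \<real>\<^sub>\<ge>\<^sub>0" for n
    unfolding double_mean_def using psd by (intro smean_double_nonneg) simp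
qed

section \<open>Positive definiteness of the disc polynomials\<close>

lemma hip_add_left: "hip q (\<lambda>i. x i + c * y i) \<zeta> = c * hip q y \<zeta> + hip q x \<zeta>"
  by (simp add: hip_def ring_distribs sum.distrib sum_distrib_left mult_ac)

lemma hip_add_right: "hip q \<zeta> (\<lambda>i. x i + cnj c * y i) = c * hip q \<zeta> y + hip q \<zeta> x"
  by (simp add: hip_def ring_distribs sum.distrib sum_distrib_left mult_ac)

lemma hip_scale: "hip q (\<lambda>i. c * x i) y = c * hip q x y" "hip q x (\<lambda>i. complex_of_real r * y i) = complex_of_real r * hip q x y"
  by (auto simp: hip_def sum_distrib_left mult_ac)

text \<open>Under real scaling both sides are homogeneous of degree \<open>p\<close> in each vector,
  so the vectors can be shrunk into the polydisc. Polarization evaluates the moments at sums such as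
  \<open>x + s y\<close>, which leave it.\<close>

lemma sphere_moment_tendsto_all:
  "(\<lambda>n. sphere_moment n d p p x y) \<longlonglongrightarrow> complex_of_real (fact p * fact d / fact (p + d)) * hip (Suc d) x y ^ p"
proof -
  define B where "B = 1 + (\<Sum>i<Suc d. cmod (x i) + cmod (y i))"
  have B: "0 < B" unfolding B_def by (intro add_pos_nonneg sum_nonneg) auto
  have le: "cmod (x i) \<le> B" "cmod (y i) \<le> B" if "i < Suc d" for i
  proof -
    have "cmod (x i) + cmod (y i) \<le> (\<Sum>i<Suc d. cmod (x i) + cmod (y i))"
      using that by (intro member_le_sum) auto
    hence "cmod (x i) + cmod (y i) \<le> B" unfolding B_def by linarith
    thus "cmod (x i) \<le> B" "cmod (y i) \<le> B" using norm_ge_zero[of "x i"] norm_ge_zero[of "y i"] by linarith+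
  qed
  define b where "b = complex_of_real (1 / B)"
  have bB: "complex_of_real B * b = 1" using B by (simp add: b_def)
  let ?BB = "complex_of_real B * complex_of_real B" and ?K = "complex_of_real (fact p * fact d / fact (p + d))"
  have "(\<lambda>n. sphere_moment n d p p (\<lambda>i. b * x i) (\<lambda>i. b * y i)) \<longlonglongrightarrow>
     ?K * hip (Suc d) (\<lambda>i. b * x i) (\<lambda>i. b * y i) ^ p"
    using le B by (intro sphere_moment_tendsto) (auto simp: b_def norm_mult norm_divide)
  also have "(\<lambda>n. sphere_moment n d p p (\<lambda>i. b * x i) (\<lambda>i. b * y i)) = (\<lambda>n. (b * b) ^ p * sphere_moment n d p p x y)"
    unfolding sphere_moment_def b_def hip_scale power_mult_distrib
    by (simp only: smean_scale[symmetric] mult_ac)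
  also have "hip (Suc d) (\<lambda>i. b * x i) (\<lambda>i. b * y i) = b * b * hip (Suc d) x y"
    unfolding b_def hip_scale by (simp only: mult_ac)
  finally have "(\<lambda>n. ?BB ^ p * ((b * b) ^ p * sphere_moment n d p p x y)) \<longlonglongrightarrow>
     ?BB ^ p * (?K * (b * b * hip (Suc d) x y) ^ p)"
    by (rule tendsto_mult[OF tendsto_const])
  moreover have "?BB ^ p * ((b * b) ^ p * u) = u" for u
  proof -
    have "?BB ^ p * ((b * b) ^ p * u) = (complex_of_real B * b) ^ p * (complex_of_real B * b) ^ p * u"
      by (simp only: power_mult_distrib mult_ac)
    thus ?thesis by (simp add: bB)
  qed
  moreover have "?BB ^ p * (c * (b * b * h) ^ p) = c * h ^ p" for c h
  proof -
    have "?BB ^ p * (c * (b * b * h) ^ p) = (complex_of_real B * b) ^ p * (complex_of_real B * b) ^ p * (c * h ^ p)"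
      by (simp only: power_mult_distrib mult_ac)
    thus ?thesis by (simp add: bB)
  qed
  ultimately show ?thesis by simp
qed

section \<open>Mixed moments and their limits\<close>

text \<open>Discrete Fourier inversion: \<open>Suc p\<close> roots of unity separate the powers up
  to \<open>p\<close>.\<close>

lemma unity_coefficient:
  assumes "j \<le> p"
  shows "(\<Sum>w<Suc p. cnj (unity (Suc p) w) ^ j * (\<Sum>k\<le>p. A k * unity (Suc p) w ^ k)) = of_nat (Suc p) * A j"
proof -
  let ?u = "unity (Suc p)"
  have "(\<Sum>w<Suc p. cnj (?u w) ^ j * (\<Sum>k\<le>p. A k * ?u w ^ k)) =
     (\<Sum>w<Suc p. \<Sum>k\<le>p. A k * (?u w ^ k * cnj (?u w) ^ j))"
    by (simp only: sum_distrib_left mult_ac)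
  also have "\<dots> = (\<Sum>k\<le>p. A k * (\<Sum>w<Suc p. ?u w ^ k * cnj (?u w) ^ j))"
    by (subst sum.swap) (simp only: sum_distrib_left)
  also have "\<dots> = (\<Sum>k\<le>p. if k = j then of_nat (Suc p) * A j else 0)"
  proof (rule sum.cong[OF refl], goal_cases)
    case (1 k)
    hence "k < Suc p" "j < Suc p" using assms by auto
    from unity_orthogonal[OF this]
    show ?case
      by (simp del: of_nat_Suc sum.lessThan_Suc)
  qed
  also have "\<dots> = of_nat (Suc p) * A j" using assms by simp
  finally show ?thesis .
qed

text \<open>These moments appear when the difference \<open>\<langle>y, x\<rangle> - \<langle>y,
  \<zeta>\<rangle> \<langle>\<zeta>, x\<rangle>\<close> in the averaged kernel is expanded by the
  binomial theorem.\<close>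

definition mixed_moment :: "nat \<Rightarrow> nat \<Rightarrow> nat \<Rightarrow> nat \<Rightarrow> nat \<Rightarrow> nat \<Rightarrow> (nat \<Rightarrow> complex) \<Rightarrow> (nat \<Rightarrow> complex) \<Rightarrow> complex" where
  "mixed_moment n d p k l' l x y = smean n d (\<lambda>\<zeta>. (hip (Suc d) y \<zeta> ^ k * hip (Suc d) x \<zeta> ^ p) *
     (hip (Suc d) \<zeta> x ^ l * hip (Suc d) \<zeta> y ^ l'))"

text \<open>Polarization: the mixed moments are the Fourier coefficients of the pure moments in the
  direction of \<open>x + s y\<close> and \<open>y + t x\<close>, for phases \<open>s\<close> and \<open>t\<close>.\<close>
lemma mixed_moment_polarization:
  assumes "j \<le> p"
  shows "of_nat (Suc p) * of_nat (Suc p) * (of_nat (p choose j) * of_nat (p choose j) * mixed_moment n d (p - j) j (p - j) j x y) =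
    (\<Sum>s<Suc p. \<Sum>t<Suc p. cnj (unity (Suc p) s) ^ j * cnj (unity (Suc p) t) ^ j *
      sphere_moment n d p p (\<lambda>i. x i + unity (Suc p) s * y i) (\<lambda>i. y i + cnj (unity (Suc p) t) * x i))"
proof -
  let ?u = "unity (Suc p)"
  define A where "A k l = of_nat (p choose k) * of_nat (p choose l) * mixed_moment n d (p - k) k (p - l) l x y" for k l
  have "sphere_moment n d p p (\<lambda>i. x i + s * y i) (\<lambda>i. y i + cnj t * x i) = (\<Sum>k\<le>p. (\<Sum>l\<le>p. A k l * t ^ l) * s ^ k)" for s t
  proof -
    have "hip (Suc d) (\<lambda>i. x i + s * y i) \<zeta> ^ p * hip (Suc d) \<zeta> (\<lambda>i. y i + cnj t * x i) ^ p =
      (\<Sum>k\<le>p. \<Sum>l\<le>p. (of_nat (p choose k) * of_nat (p choose l) * t ^ l * s ^ k) *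
         ((hip (Suc d) y \<zeta> ^ k * hip (Suc d) x \<zeta> ^ (p - k)) * (hip (Suc d) \<zeta> x ^ l * hip (Suc d) \<zeta> y ^ (p - l))))" for \<zeta>
      unfolding hip_add_left hip_add_right binomial_ring sum_product
      by (intro sum.cong refl) (simp only: power_mult_distrib mult_ac)
    hence "sphere_moment n d p p (\<lambda>i. x i + s * y i) (\<lambda>i. y i + cnj t * x i) =
      (\<Sum>k\<le>p. \<Sum>l\<le>p. (of_nat (p choose k) * of_nat (p choose l) * t ^ l * s ^ k) * mixed_moment n d (p - k) k (p - l) l x y)"
      unfolding sphere_moment_def mixed_moment_def by (simp only: smean_sum smean_scale)
    thus ?thesis unfolding A_def by (simp only: sum_distrib_right sum_distrib_left mult_ac)
  qed
  note expand = this
  have "(\<Sum>s<Suc p. \<Sum>t<Suc p. cnj (?u s) ^ j * cnj (?u t) ^ j *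
      sphere_moment n d p p (\<lambda>i. x i + ?u s * y i) (\<lambda>i. y i + cnj (?u t) * x i)) =
     (\<Sum>t<Suc p. cnj (?u t) ^ j * (\<Sum>s<Suc p. cnj (?u s) ^ j * (\<Sum>k\<le>p. (\<Sum>l\<le>p. A k l * ?u t ^ l) * ?u s ^ k)))"
    unfolding expand by (subst sum.swap) (simp only: sum_distrib_left mult_ac)
  also have "\<dots> = (\<Sum>t<Suc p. cnj (?u t) ^ j * (of_nat (Suc p) * (\<Sum>l\<le>p. A j l * ?u t ^ l)))"
    by (intro sum.cong refl) (simp only: unity_coefficient[OF assms])
  also have "\<dots> = of_nat (Suc p) * (\<Sum>t<Suc p. cnj (?u t) ^ j * (\<Sum>l\<le>p. A j l * ?u t ^ l))"
    by (simp only: sum_distrib_left mult_ac)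
  also have "\<dots> = of_nat (Suc p) * (of_nat (Suc p) * A j j)"
    by (simp only: unity_coefficient[OF assms])
  finally show ?thesis by (simp only: A_def mult.assoc)
qed

text \<open>For unit vectors the polarized inner product is \<open>z + s + t + s t z'\<close> with
  \<open>z = \<langle>x, y\<rangle>\<close> and \<open>z' = \<langle>y, x\<rangle>\<close>, and the
  coefficient of \<open>s\<^sup>j t\<^sup>j\<close> in its power is wanted. Extracting
  \<open>t\<^sup>j\<close> leaves a multiple of \<open>(1 + s z')\<^sup>j (z + s)\<^sup>m\<close>,
  from which the coefficient of \<open>s\<^sup>j\<close> is read off.\<close>

lemma binomial_product_coefficient:
  fixes z z' :: complex
  shows "(\<Sum>s<Suc (m + j). \<Sum>t<Suc (m + j). cnj (unity (Suc (m + j)) s) ^ j * cnj (unity (Suc (m + j)) t) ^ j *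
      (z + unity (Suc (m + j)) s + unity (Suc (m + j)) t + unity (Suc (m + j)) s * unity (Suc (m + j)) t * z') ^ (m + j)) =
    of_nat (Suc (m + j)) * of_nat (Suc (m + j)) * (of_nat ((m + j) choose j) *
      (\<Sum>k\<le>min m j. of_nat ((m choose k) * (j choose k)) * (z ^ (m - k) * z' ^ (j - k))))"
proof -
  let ?p = "m + j"
  let ?u = "unity (Suc ?p)"
  let ?E = "\<lambda>k. of_nat (Suc ?p) * (of_nat (m choose k) * of_nat (j choose k) * (z ^ (m - k) * z' ^ (j - k)))"
  have "(\<Sum>s<Suc ?p. \<Sum>t<Suc ?p. cnj (?u s) ^ j * cnj (?u t) ^ j * (z + ?u s + ?u t + ?u s * ?u t * z') ^ ?p) =
     (\<Sum>s<Suc ?p. cnj (?u s) ^ j * (\<Sum>t<Suc ?p. cnj (?u t) ^ j * (\<Sum>l\<le>?p. (of_nat (?p choose l) * (1 + ?u s * z') ^ l * (z + ?u s) ^ (?p - l)) * ?u t ^ l)))"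
  proof -
    have "(z + s + t + s * t * z') ^ ?p = (\<Sum>l\<le>?p. (of_nat (?p choose l) * (1 + s * z') ^ l * (z + s) ^ (?p - l)) * t ^ l)" for s t
    proof -
      have "z + s + t + s * t * z' = t * (1 + s * z') + (z + s)" by (simp add: algebra_simps)
      thus ?thesis by (simp only: binomial_ring power_mult_distrib mult_ac)
    qed
    note expand = this
    show ?thesis unfolding expand by (simp only: sum_distrib_left mult_ac)
  qed
  also have "\<dots> = (\<Sum>s<Suc ?p. cnj (?u s) ^ j * (of_nat (Suc ?p) * (of_nat (?p choose j) * (1 + ?u s * z') ^ j * (z + ?u s) ^ (?p - j))))"
    by (subst unity_coefficient) auto
  also have "\<dots> = of_nat (Suc ?p) * of_nat (?p choose j) * (\<Sum>s<Suc ?p. cnj (?u s) ^ j * ((1 + ?u s * z') ^ j * (z + ?u s) ^ m))"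
    by (simp only: sum_distrib_left mult_ac add_diff_cancel_right')
  also have "(\<Sum>s<Suc ?p. cnj (?u s) ^ j * ((1 + ?u s * z') ^ j * (z + ?u s) ^ m)) =
     (\<Sum>s<Suc ?p. \<Sum>k\<le>m. \<Sum>l\<le>j. of_nat (m choose k) * of_nat (j choose l) * z ^ (m - k) * z' ^ l * (?u s ^ (k + l) * cnj (?u s) ^ j))"
  proof (rule sum.cong[OF refl], goal_cases)
    case (1 w)
    have 1: "(1 + ?u w * z') ^ j = (\<Sum>l\<le>j. of_nat (j choose l) * (?u w * z') ^ l)"
      using binomial_ring[of "?u w * z'" 1 j] by (simp add: add.commute)
    have 2: "(z + ?u w) ^ m = (\<Sum>k\<le>m. of_nat (m choose k) * ?u w ^ k * z ^ (m - k))"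
      using binomial_ring[of "?u w" z m] by (simp add: add.commute)
    show ?case
      unfolding 1 2 sum_product
      by (subst sum.swap) (simp only: sum_distrib_left power_mult_distrib power_add mult_ac)
  qed
  also have "\<dots> = (\<Sum>k\<le>m. \<Sum>l\<le>j. of_nat (m choose k) * of_nat (j choose l) * z ^ (m - k) * z' ^ l * (\<Sum>s<Suc ?p. ?u s ^ (k + l) * cnj (?u s) ^ j))"
  proof -
    have "(\<Sum>w<Suc ?p. \<Sum>k\<le>m. \<Sum>l\<le>j. Y w k l) = (\<Sum>k\<le>m. \<Sum>l\<le>j. \<Sum>w<Suc ?p. Y w k l)" for Y :: "nat \<Rightarrow> nat \<Rightarrow> nat \<Rightarrow> complex"
      by (subst sum.swap, rule sum.cong[OF refl], rule sum.swap)
    thus ?thesis by (simp only: sum_distrib_left)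
  qed
  also have "\<dots> = (\<Sum>k\<le>m. \<Sum>l\<le>j. if k + l = j then ?E k else 0)"
  proof (intro sum.cong refl, goal_cases)
    case (1 k l)
    hence *: "(\<Sum>s<Suc ?p. ?u s ^ (k + l) * cnj (?u s) ^ j) = (if k + l = j then of_nat (Suc ?p) else 0)"
      by (intro unity_orthogonal) auto
    show ?case
    proof (cases "k + l = j")
      case True
      hence "l = j - k" "k \<le> j" by auto
      moreover from this have "j choose (j - k) = j choose k" by (metis binomial_symmetric)
      ultimately show ?thesis unfolding * using True by (simp only: if_True simp_thms mult_ac)
    qed (simp only: * if_False mult_zero_right)
  qed
  also have "\<dots> = (\<Sum>k\<le>m. if k \<le> j then ?E k else 0)"
  proof (intro sum.cong refl, goal_cases)
    case (1 k)
    have "(\<Sum>l\<le>j. if k + l = j then c else 0) = (\<Sum>l\<le>j. if l = j - k then if k \<le> j then c else 0 else 0)" for c :: complex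
      by (intro sum.cong) auto
    thus ?case
      by (simp only: sum.delta finite_atMost) simp
  qed
  also have "\<dots> = (\<Sum>k\<le>min m j. ?E k)"
    by (intro sum.mono_neutral_cong_right) auto
  finally show ?thesis by (simp only: sum_distrib_left of_nat_mult mult_ac)
qed

lemma mixed_moment_tendsto:
  assumes x: "x \<in> usphere (Suc d)" and y: "y \<in> usphere (Suc d)"
  shows "(\<lambda>n. mixed_moment n d m j m j x y) \<longlonglongrightarrow> complex_of_real (fact d * fact m * fact j / fact (m + j + d)) *
     (\<Sum>k\<le>min m j. of_nat ((m choose k) * (j choose k)) * (hip (Suc d) x y ^ (m - k) * hip (Suc d) y x ^ (j - k)))"
proof -
  let ?p = "m + j"
  let ?u = "unity (Suc ?p)"
  define c where "c = complex_of_real (fact ?p * fact d / fact (?p + d))"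
  define D where "D = (of_nat (Suc ?p) * of_nat (Suc ?p) * (of_nat (?p choose j) * of_nat (?p choose j)) :: complex)"
  define S where "S = (\<Sum>k\<le>min m j. of_nat ((m choose k) * (j choose k)) * (hip (Suc d) x y ^ (m - k) * hip (Suc d) y x ^ (j - k)))"
  have D: "D \<noteq> 0" by (simp add: D_def del: of_nat_Suc)
  have "(\<lambda>n. D * mixed_moment n d m j m j x y) = (\<lambda>n. \<Sum>s<Suc ?p. \<Sum>t<Suc ?p. cnj (?u s) ^ j * cnj (?u t) ^ j *
      sphere_moment n d ?p ?p (\<lambda>i. x i + ?u s * y i) (\<lambda>i. y i + cnj (?u t) * x i))"
    using mixed_moment_polarization[of j ?p _ d x y] by (simp add: D_def mult.assoc del: of_nat_Suc sum.lessThan_Suc)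
  also have "\<dots> \<longlonglongrightarrow> (\<Sum>s<Suc ?p. \<Sum>t<Suc ?p. cnj (?u s) ^ j * cnj (?u t) ^ j *
      (c * hip (Suc d) (\<lambda>i. x i + ?u s * y i) (\<lambda>i. y i + cnj (?u t) * x i) ^ ?p))"
    unfolding c_def by (intro tendsto_sum tendsto_mult tendsto_const sphere_moment_tendsto_all)
  also have "(\<Sum>s<Suc ?p. \<Sum>t<Suc ?p. cnj (?u s) ^ j * cnj (?u t) ^ j *
      (c * hip (Suc d) (\<lambda>i. x i + ?u s * y i) (\<lambda>i. y i + cnj (?u t) * x i) ^ ?p)) =
     c * (\<Sum>s<Suc ?p. \<Sum>t<Suc ?p. cnj (?u s) ^ j * cnj (?u t) ^ j * (hip (Suc d) x y + ?u s + ?u t + ?u s * ?u t * hip (Suc d) y x) ^ ?p)"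
  proof -
    have "hip (Suc d) (\<lambda>i. x i + s * y i) (\<lambda>i. y i + cnj t * x i) = hip (Suc d) x y + s + t + s * t * hip (Suc d) y x" for s t
      unfolding hip_add_left hip_add_right hip_self[OF x] hip_self[OF y] by (simp add: algebra_simps)
    note expand = this
    show ?thesis unfolding expand by (simp only: sum_distrib_left mult_ac)
  qed
  also have "\<dots> = c * (of_nat (Suc ?p) * of_nat (Suc ?p) * (of_nat (?p choose j) * S))"
    unfolding binomial_product_coefficient S_def ..
  finally have "(\<lambda>n. 1 / D * (D * mixed_moment n d m j m j x y)) \<longlonglongrightarrow> 1 / D * (c * (of_nat (Suc ?p) * of_nat (Suc ?p) * (of_nat (?p choose j) * S)))"
    by (rule tendsto_mult[OF tendsto_const])
  moreover have "1 / D * (D * v) = v" for v using D by simp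
  moreover have "1 / D * (c * (of_nat (Suc ?p) * of_nat (Suc ?p) * (of_nat (?p choose j) * S))) = c / of_nat (?p choose j) * S"
    by (simp add: D_def del: of_nat_Suc)
  moreover have "c / of_nat (?p choose j) = complex_of_real (fact d * fact m * fact j / fact (m + j + d))"
  proof -
    have "c / of_nat (?p choose j) = complex_of_real (fact ?p * fact d / fact (?p + d) / real (?p choose j))" by (simp add: c_def)
    also have "real (?p choose j) = fact ?p / (fact j * fact m)" using binomial_fact[of j ?p, where ?'a = real] by simp
    finally show ?thesis by (simp add: mult_ac)
  qed
  ultimately show ?thesis unfolding S_def by simp
qed

text \<open>The coefficient of each monomial in the averaged kernel is an alternating sum of Beta
  type. It evaluates to that of the disc polynomial, up to a positive factor that does not depend on
  \<open>k\<close>.\<close>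

lemma projection_coefficient:
  assumes k: "k \<le> min m n"
  shows "(\<Sum>j\<in>{k..n}. (-1) ^ j * real (n choose j) * real (j choose k) * (fact (Suc a) * fact m * fact j / fact (m + j + Suc a))) * real (m choose k)
     = (fact (Suc a) * fact m * fact m * fact n / (fact (m + a) * fact (m + n + a + 1))) * disc_coeff a m n k"
    (is "(\<Sum>j\<in>{k..n}. ?T j) * _ = _")
proof -
  have "(\<Sum>j\<in>{k..n}. ?T j) =
    (\<Sum>i\<le>n-k. (-1) ^ k * fact (Suc a) * fact m * real (n choose k) * ((-1) ^ i * real ((n - k) choose i) * (fact (k + i) / fact (k + i + (m + a) + 1))))"
  proof (rule sum.reindex_bij_witness[of _ "\<lambda>i. k + i" "\<lambda>j. j - k"])
    fix j assume j: "j \<in> {k..n}"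
    have "(n choose j) * (j choose k) = (n choose k) * ((n - k) choose (j - k))"
      using j by (intro choose_mult) auto
    hence C: "real (n choose j) * real (j choose k) = real (n choose k) * real ((n - k) choose (j - k))"
      by (metis of_nat_mult)
    have e: "k + (j - k) = j" "j + (m + a) + 1 = m + j + Suc a" using j by auto
    have s: "(-1 :: real) ^ k * (-1) ^ (j - k) = (-1) ^ j" using j by (simp flip: power_add)
    have "(-1) ^ k * fact (Suc a) * fact m * real (n choose k) * ((-1) ^ (j - k) * real ((n - k) choose (j - k)) * (fact j / fact (m + j + Suc a))) =
      ((-1) ^ k * (-1) ^ (j - k)) * (real (n choose k) * real ((n - k) choose (j - k))) * (fact (Suc a) * fact m * (fact j / fact (m + j + Suc a)))"
      by (simp only: mult_ac)
    also have "\<dots> = ?T j"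
      unfolding s C[symmetric] by (simp only: times_divide_eq_right mult.assoc)
    finally show "(-1) ^ k * fact (Suc a) * fact m * real (n choose k) * ((-1) ^ (j - k) * real ((n - k) choose (j - k)) * (fact (k + (j - k)) / fact (k + (j - k) + (m + a) + 1))) =
      ?T j"
      unfolding e .
  qed (use k in auto)
  also have "\<dots> = (-1) ^ k * fact (Suc a) * fact m * real (n choose k) * (fact (m + a + (n - k)) * fact k / (fact (m + a) * fact (k + (n - k) + (m + a) + 1)))"
    by (simp only: sum_distrib_left[symmetric] alt_sum_fact_divide)
  finally have S: "(\<Sum>j\<in>{k..n}. ?T j) = \<dots>" .
  have b: "real (n choose k) = fact n / (fact k * fact (n - k))" "real (m choose k) = fact m / (fact k * fact (m - k))"
    using k by (auto simp: binomial_fact)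
  have e: "m + a + (n - k) = m + n + a - k" "k + (n - k) + (m + a) + 1 = m + n + a + 1" using k by auto
  have regroup: "s * A * M * (N / (K * U)) * (X * K / (Y * Z)) * (M / (K * V)) = (A * M * M * N / (Y * Z)) * (s * X / (K * V * U))"
    if "K \<noteq> 0" "U \<noteq> 0" "V \<noteq> 0" "Y \<noteq> 0" "Z \<noteq> 0" for s A M N K U X Y Z V :: real
    using that by (simp add: divide_simps)
  show ?thesis unfolding S b e disc_coeff_def by (rule regroup) auto
qed

lemma schur_pos_hip: "schur_pos X (\<lambda>x y. hip q x y)"
  unfolding hip_def by (intro schur_pos_sum schur_pos_rank_one)

text \<open>For a unit vector \<open>\<zeta>\<close> the kernel \<open>\<langle>x, \<zeta>\<rangle>\<^sup>m \<langle>\<zeta>, y\<rangle>\<^sup>m (\<langle>y, x\<rangle> - \<langle>y, \<zeta>\<rangle> \<langle>\<zeta>, x\<rangle>)\<^sup>n\<close> is positive, as its last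
  factor is the Gram kernel of the projections to the complement of \<open>\<zeta>\<close>. Each such function is
  harmonic of bidegree \<open>(m, n)\<close> in \<open>x\<close>, so its average over \<open>\<zeta>\<close> is a multiple of the zonal function.\<close>
lemma schur_pos_disc_poly:
  "schur_pos (usphere (a + 2)) (\<lambda>x y. dpoly a m n (hip (a + 2) x y))"
proof -
  let ?d = "Suc a"
  let ?h = "hip (Suc ?d)"
  define K where "K \<zeta> x y = (?h x \<zeta> * ?h \<zeta> y) ^ m * (?h y x - ?h y \<zeta> * ?h \<zeta> x) ^ n" for \<zeta> x y
  define L where "L x y = (\<Sum>j\<le>n. of_nat (n choose j) * (-1) ^ j * ?h y x ^ (n - j) *
      (complex_of_real (fact ?d * fact m * fact j / fact (m + j + ?d)) *
       (\<Sum>k\<le>min m j. of_nat ((m choose k) * (j choose k)) * (?h x y ^ (m - k) * ?h y x ^ (j - k)))))" for x y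
  define \<kappa> where "\<kappa> = (fact ?d * fact m * fact m * fact n / (fact (m + a) * fact (m + n + a + 1)) :: real)"
  have "schur_pos (usphere (Suc ?d)) (K \<zeta>)" if \<zeta>: "\<zeta> \<in> usphere (Suc ?d)" for \<zeta>
  proof -
    have "schur_pos (usphere (Suc ?d)) (\<lambda>x y. ?h x \<zeta> * cnj (?h y \<zeta>))" by (rule schur_pos_rank_one)
    hence 1: "schur_pos (usphere (Suc ?d)) (\<lambda>x y. ?h x \<zeta> * ?h \<zeta> y)" by (simp only: cnj_hip)
    \<comment> \<open>The Gram kernel is needed with \<open>y\<close> before \<open>x\<close>; the
      conjugations bring it to the rank one shape \<open>h x * cnj (h y)\<close>.\<close>
    have "(\<Sum>k<Suc ?d. cnj (x k - ?h x \<zeta> * \<zeta> k) * cnj (cnj (y k - ?h y \<zeta> * \<zeta> k))) = ?h y x - ?h y \<zeta> * ?h \<zeta> x" for x y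
    proof -
      have "(\<Sum>k<Suc ?d. cnj (x k - ?h x \<zeta> * \<zeta> k) * cnj (cnj (y k - ?h y \<zeta> * \<zeta> k))) =
        (\<Sum>k<Suc ?d. (y k * cnj (x k) - ?h y \<zeta> * (\<zeta> k * cnj (x k))) - (?h \<zeta> x * (y k * cnj (\<zeta> k)) - ?h \<zeta> x * ?h y \<zeta> * (\<zeta> k * cnj (\<zeta> k))))"
        by (intro sum.cong refl) (simp add: cnj_hip algebra_simps)
      also have "\<dots> = ?h y x - ?h y \<zeta> * ?h \<zeta> x - (?h \<zeta> x * ?h y \<zeta> - ?h \<zeta> x * ?h y \<zeta> * ?h \<zeta> \<zeta>)"
        by (simp only: hip_def sum_subtractf sum_distrib_left)
      finally show ?thesis by (simp add: hip_self[OF \<zeta>])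
    qed
    moreover have "schur_pos (usphere (Suc ?d)) (\<lambda>x y. \<Sum>k<Suc ?d. cnj (x k - ?h x \<zeta> * \<zeta> k) * cnj (cnj (y k - ?h y \<zeta> * \<zeta> k)))"
      by (intro schur_pos_sum schur_pos_rank_one)
    ultimately have 2: "schur_pos (usphere (Suc ?d)) (\<lambda>x y. ?h y x - ?h y \<zeta> * ?h \<zeta> x)" by (simp only:)
    show ?thesis unfolding K_def by (intro schur_pos_mult schur_pos_power 1 2)
  qed
  hence pos: "schur_pos (usphere (Suc ?d)) (\<lambda>x y. smean N ?d (\<lambda>\<zeta>. K \<zeta> x y))" for N
    by (rule schur_pos_smean)
  have smean_K: "smean N ?d (\<lambda>\<zeta>. K \<zeta> x y) = (\<Sum>j\<le>n. of_nat (n choose j) * (-1) ^ j * ?h y x ^ (n - j) * mixed_moment N ?d m j m j x y)" for N x y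
  proof -
    have "K \<zeta> x y = (\<Sum>j\<le>n. (of_nat (n choose j) * (-1) ^ j * ?h y x ^ (n - j)) *
        ((?h y \<zeta> ^ j * ?h x \<zeta> ^ m) * (?h \<zeta> x ^ j * ?h \<zeta> y ^ m)))" for \<zeta>
    proof -
      have "?h y x - ?h y \<zeta> * ?h \<zeta> x = (-1) * (?h y \<zeta> * ?h \<zeta> x) + ?h y x" by simp
      thus ?thesis unfolding K_def
        by (simp only: binomial_ring[of "(-1) * (?h y \<zeta> * ?h \<zeta> x)"]) (simp only: sum_distrib_left power_mult_distrib mult_ac)
    qed
    thus ?thesis unfolding mixed_moment_def by (simp only: smean_sum smean_scale)
  qed
  have lim: "(\<lambda>N. smean N ?d (\<lambda>\<zeta>. K \<zeta> x y)) \<longlonglongrightarrow> L x y"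
    if "x \<in> usphere (Suc ?d)" "y \<in> usphere (Suc ?d)" for x y
    unfolding smean_K L_def by (intro tendsto_sum tendsto_mult tendsto_const mixed_moment_tendsto that)
  have L: "schur_pos (usphere (Suc ?d)) L"
    by (rule schur_pos_lim[OF pos lim])
  let ?e = "\<lambda>x y k. ?h x y ^ (m - k) * ?h y x ^ (n - k)"
  have "L x y = complex_of_real \<kappa> * (\<Sum>k\<le>min m n. complex_of_real (disc_coeff a m n k) * ?e x y k)" for x y
  proof -
    let ?c = "\<lambda>j k. complex_of_real ((-1) ^ j * real (n choose j) * real (j choose k) * (fact ?d * fact m * fact j / fact (m + j + ?d)))"
    have "L x y = (\<Sum>j\<le>n. \<Sum>k\<le>min m j. ?c j k * of_nat (m choose k) * ?e x y k)"
      unfolding L_def sum_distrib_left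
    proof (intro sum.cong refl, goal_cases)
      case (1 j k)
      hence "?h y x ^ (n - k) = ?h y x ^ (n - j) * ?h y x ^ (j - k)" by (simp flip: power_add)
      thus ?case
        by (simp only: of_real_mult of_real_of_nat_eq of_real_power of_real_minus of_real_1 of_nat_mult mult_ac)
    qed
    also have "\<dots> = (\<Sum>j\<le>n. \<Sum>k\<le>min m n. if k \<le> j then ?c j k * of_nat (m choose k) * ?e x y k else 0)"
      by (intro sum.cong refl sum.mono_neutral_cong_left) auto
    also have "\<dots> = (\<Sum>k\<le>min m n. \<Sum>j\<le>n. if k \<le> j then ?c j k * of_nat (m choose k) * ?e x y k else 0)"
      by (rule sum.swap)
    also have "\<dots> = (\<Sum>k\<le>min m n. complex_of_real \<kappa> * (complex_of_real (disc_coeff a m n k) * ?e x y k))"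
    proof (rule sum.cong[OF refl])
      fix k assume k: "k \<in> {..min m n}"
      have "(\<Sum>j\<le>n. if k \<le> j then ?c j k * of_nat (m choose k) * ?e x y k else 0) =
        (\<Sum>j\<in>{k..n}. ?c j k * of_nat (m choose k) * ?e x y k)"
        by (intro sum.mono_neutral_cong_right) auto
      also have "\<dots> = complex_of_real ((\<Sum>j\<in>{k..n}. (-1) ^ j * real (n choose j) * real (j choose k) * (fact ?d * fact m * fact j / fact (m + j + ?d))) * real (m choose k))
         * ?e x y k"
        by (simp only: of_real_mult of_real_sum of_real_of_nat_eq sum_distrib_right)
      also have "\<dots> = complex_of_real \<kappa> * (complex_of_real (disc_coeff a m n k) * ?e x y k)"
        using projection_coefficient[of k m n a] k unfolding \<kappa>_def[symmetric] by (simp only: atMost_iff of_real_mult mult.assoc)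
      finally show "(\<Sum>j\<le>n. if k \<le> j then ?c j k * of_nat (m choose k) * ?e x y k else 0) = \<dots>" .
    qed
    finally show ?thesis by (simp only: sum_distrib_left)
  qed
  moreover have "dpoly a m n (?h x y) = complex_of_real (disc_const a m n) * (\<Sum>k\<le>min m n. complex_of_real (disc_coeff a m n k) * ?e x y k)" for x y
    unfolding disc_poly_expand cnj_hip by (simp only: of_real_mult sum_distrib_left mult.assoc)
  moreover have "0 < \<kappa>" by (simp add: \<kappa>_def)
  ultimately have eq: "dpoly a m n (?h x y) = complex_of_real (disc_const a m n / \<kappa>) * L x y" for x y
    by simp
  have "schur_pos (usphere (Suc ?d)) (\<lambda>x y. dpoly a m n (?h x y))"
    unfolding eq using disc_const_pos[of a m n] \<open>0 < \<kappa>\<close> by (intro schur_pos_scale L) simp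
  thus ?thesis by simp
qed

text \<open>A second coordinate provides the length missing from \<open>cnj z\<close>, so the vector
  \<open>y\<close> reaches norm 1.\<close>

lemma exists_usphere_hip:
  assumes "z \<in> cball 0 1"
  obtains x y where "x \<in> usphere (a + 2)" "y \<in> usphere (a + 2)" "hip (a + 2) x y = z"
proof -
  define x :: "nat \<Rightarrow> complex" where "x i = (if i = 0 then 1 else 0)" for i
  define y :: "nat \<Rightarrow> complex" where "y i = (if i = 0 then cnj z else if i = 1 then complex_of_real (sqrt (1 - (cmod z)\<^sup>2)) else 0)" for i
  have sum2: "(\<Sum>k<a + 2. g k) = g 0 + g 1 + (\<Sum>k<a. g (Suc (Suc k)))" for g :: "nat \<Rightarrow> 'b::comm_monoid_add"
    by (simp add: sum.lessThan_Suc_shift add.assoc del: sum.lessThan_Suc)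
  have "x \<in> usphere (a + 2)" unfolding usphere_def mem_Collect_eq sum2 by (simp add: x_def)
  moreover have "y \<in> usphere (a + 2)" unfolding usphere_def mem_Collect_eq sum2
    using assms by (simp add: y_def abs_square_le_1)
  moreover have "hip (a + 2) x y = z" unfolding hip_def sum2 by (simp add: x_def y_def)
  ultimately show ?thesis by (rule that)
qed

text \<open>Two unit vectors with inner product \<open>z\<close> give a positive 2 by 2 matrix with
  unit diagonal, and the value at \<open>z\<close> is its off-diagonal entry.\<close>

lemma norm_disc_poly_le_1:
  assumes "z \<in> cball 0 1"
  shows "cmod (dpoly a m n z) \<le> 1"
proof -
  obtain x y where xy: "x \<in> usphere (a + 2)" "y \<in> usphere (a + 2)" "hip (a + 2) x y = z"
    by (rule exists_usphere_hip[OF assms])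
  let ?v = "\<lambda>j::nat. if j = 0 then x else y"
  have psd: "psd 2 (\<lambda>j k. dpoly a m n (hip (a + 2) (?v j) (?v k)))"
    using schur_pos_disc_poly[of a m n] xy by (intro schur_pos_psd[of "usphere (a + 2)"]) auto
  show ?thesis
    using psd_bound(2)[OF psd, of 1] xy by (simp add: hip_self disc_poly_at_1)
qed

section \<open>Coefficients of disc expansions\<close>

text \<open>Conjugating all coordinates preserves the sphere and swaps the arguments of the inner
  product, which the group kernel has in this order.\<close>

lemma disc_mean_zonal_nonneg':
  assumes F: "continuous_on (cball 0 1) F"
    and psd: "\<And>N x. (\<And>j. j < N \<Longrightarrow> x j \<in> usphere (a + 2)) \<Longrightarrow> psd N (\<lambda>j k. F (hip (a + 2) (x k) (x j)))"
  shows "disc_mean a F \<in> \<real>\<^sub>\<ge>\<^sub>0"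
proof (rule disc_mean_zonal_nonneg[OF F])
  fix N :: nat and x :: "nat \<Rightarrow> nat \<Rightarrow> complex" assume x: "\<And>j. j < N \<Longrightarrow> x j \<in> usphere (a + 2)"
  have "psd N (\<lambda>j k. F (hip (a + 2) (\<lambda>i. cnj (x k i)) (\<lambda>i. cnj (x j i))))"
    using x by (intro psd) (simp add: usphere_def)
  moreover have "hip (a + 2) (\<lambda>i. cnj (x k i)) (\<lambda>i. cnj (x j i)) = hip (a + 2) (x j) (x k)" for j k
    by (simp add: hip_def mult.commute)
  ultimately show "psd N (\<lambda>j k. F (hip (a + 2) (x j) (x k)))" by simp
qed

abbreviation disc_fourier :: "nat \<Rightarrow> (complex \<Rightarrow> complex) \<Rightarrow> nat \<Rightarrow> nat \<Rightarrow> complex" where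
  "disc_fourier a F m n \<equiv> disc_mean a (\<lambda>z. F z * cnj (dpoly a m n z))"

text \<open>A Parseval pairing with a finite combination \<open>P\<close> of disc polynomials. Only
  \<open>P\<close> is expanded, so nothing about the convergence of the series of \<open>h\<close>
  is presupposed.\<close>

lemma disc_mean_nonneg_coefficients:
  assumes h: "continuous_on (cball 0 1) h"
    and coeff: "\<And>m n. disc_fourier a h m n \<in> \<real>\<^sub>\<ge>\<^sub>0"
    and P: "zpoly P" "\<And>m n. disc_fourier a P m n \<in> \<real>\<^sub>\<ge>\<^sub>0"
  shows "disc_mean a (\<lambda>z. h z * cnj (P z)) \<in> \<real>\<^sub>\<ge>\<^sub>0"
proof -
  let ?R = "\<lambda>p. dpoly a (fst p) (snd p)"
  obtain F c where F: "finite F" and P_eq: "P = (\<lambda>z. \<Sum>p\<in>F. c p * ?R p z)"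
    by (rule disc_spanE[OF zpoly_span[OF P(1), of a]])
  have "c p \<in> \<real>\<^sub>\<ge>\<^sub>0" if p: "p \<in> F" for p
  proof -
    have "disc_mean a (\<lambda>z. P z * cnj (?R p z)) = disc_mean a (\<lambda>z. \<Sum>r\<in>F. c r * (?R r z * cnj (?R p z)))"
      by (simp add: P_eq sum_distrib_right mult.assoc)
    also have "\<dots> = (\<Sum>r\<in>F. c r * disc_mean a (\<lambda>z. ?R r z * cnj (?R p z)))"
      by (subst disc_mean_sum) (auto intro!: continuous_intros disc_poly_continuous simp: disc_mean_scale)
    also have "\<dots> = (\<Sum>r\<in>F. if r = p then c p * complex_of_real (1 / Ncoef (a + 2) (fst p) (snd p)) else 0)"
      by (intro sum.cong refl) (simp only: disc_poly_orthogonal prod.collapse mult_zero_right split: if_splits, auto)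
    also have "\<dots> = c p * complex_of_real (1 / Ncoef (a + 2) (fst p) (snd p))"
      using p F by simp
    finally have "c p = complex_of_real (Ncoef (a + 2) (fst p) (snd p)) * disc_mean a (\<lambda>z. P z * cnj (?R p z))"
      using Ncoef_pos[of a "fst p" "snd p"] by simp
    thus ?thesis using P(2) Ncoef_pos[of a "fst p" "snd p"]
      by (auto intro!: nonneg_Reals_mult_I simp: less_imp_le)
  qed
  hence "cnj (c p) \<in> \<real>\<^sub>\<ge>\<^sub>0" if "p \<in> F" for p
    using that by (simp add: complex_nonneg_Reals_iff)
  moreover have "disc_mean a (\<lambda>z. h z * cnj (P z)) = (\<Sum>p\<in>F. cnj (c p) * disc_mean a (\<lambda>z. h z * cnj (?R p z)))"
  proof -
    have "disc_mean a (\<lambda>z. h z * cnj (P z)) = disc_mean a (\<lambda>z. \<Sum>p\<in>F. cnj (c p) * (h z * cnj (?R p z)))"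
      by (simp add: P_eq sum_distrib_left mult_ac)
    thus ?thesis
      using h by (subst (asm) disc_mean_sum) (auto intro!: continuous_intros disc_poly_continuous simp: disc_mean_scale)
  qed
  ultimately show ?thesis using coeff
    by (auto intro!: sum_in_nonneg_Reals nonneg_Reals_mult_I)
qed

lemma disc_mean_Re:
  assumes F: "continuous_on (cball 0 1) F"
  shows "disc_mean a (\<lambda>z. complex_of_real (Re (F z))) = complex_of_real (Re (disc_mean a F))"
proof -
  have Re: "complex_of_real (Re w) = 1 / 2 * (w + cnj w)" for w by (simp add: complex_eq_iff)
  have "disc_mean a (\<lambda>z. 1 / 2 * (F z + cnj (F z))) = 1 / 2 * (disc_mean a F + cnj (disc_mean a F))"
    using F by (simp only: disc_mean_scale disc_mean_add disc_mean_cnj continuous_on_cnj)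
  thus ?thesis unfolding Re .
qed

text \<open>The functions \<open>(|1 + z|\<^sup>2 / 4)\<^sup>k\<close> are positive definite and, as \<open>k\<close> grows, concentrate at \<open>z = 1\<close>.\<close>
lemma Re_at_1_nonneg:
  assumes h: "continuous_on (cball 0 1) h"
    and coeff: "\<And>m n. disc_fourier a h m n \<in> \<real>\<^sub>\<ge>\<^sub>0"
  shows "0 \<le> Re (h 1)"
proof (rule ccontr)
  assume "\<not> 0 \<le> Re (h 1)"
  define P where "P z = 1 / 4 * ((1 + z) * (1 + cnj z))" for z :: complex
  define \<rho> where "\<rho> z = (cmod (1 + z))\<^sup>2 / 4" for z :: complex
  have P_\<rho>: "P z = complex_of_real (\<rho> z)" for z
    using complex_norm_square[of "1 + z"] by (simp add: P_def \<rho>_def)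
  have zP: "zpoly P"
  proof -
    have "zpoly (\<lambda>z. 1 / 4 * ((1 + z ^ 1 * cnj z ^ 0) * (1 + z ^ 0 * cnj z ^ 1)))"
      by (intro zpoly.scale zpoly_mult zpoly.add zpoly.monom zpoly_const)
    thus ?thesis unfolding P_def[abs_def] by simp
  qed
  have P_pos: "disc_mean a (\<lambda>z. P z ^ k * cnj (dpoly a m n z)) \<in> \<real>\<^sub>\<ge>\<^sub>0" for k m n
  proof (rule disc_mean_zonal_nonneg)
    show "continuous_on (cball 0 1) (\<lambda>z. P z ^ k * cnj (dpoly a m n z))"
      by (intro continuous_intros zpoly_continuous[OF zP] disc_poly_continuous)
    fix N :: nat and x :: "nat \<Rightarrow> nat \<Rightarrow> complex" assume x: "\<And>j. j < N \<Longrightarrow> x j \<in> usphere (a + 2)"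
    have *: "schur_pos (usphere (a + 2)) (\<lambda>x y. hip (a + 2) y x)"
    proof -
      have "schur_pos (usphere (a + 2)) (\<lambda>x y. \<Sum>k<a + 2. cnj (x k) * cnj (cnj (y k)))"
        by (intro schur_pos_sum schur_pos_rank_one)
      thus ?thesis by (simp add: hip_def mult.commute)
    qed
    have "schur_pos (usphere (a + 2)) (\<lambda>x y. complex_of_real (1 / 4) * ((1 + hip (a + 2) x y) * (1 + hip (a + 2) y x)))"
      by (intro schur_pos_scale schur_pos_mult schur_pos_add schur_pos_one schur_pos_hip *) simp
    hence "schur_pos (usphere (a + 2)) (\<lambda>x y. P (hip (a + 2) x y))"
      by (simp add: P_def cnj_hip)
    hence "schur_pos (usphere (a + 2)) (\<lambda>x y. P (hip (a + 2) x y) ^ k * dpoly a n m (hip (a + 2) x y))"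
      by (intro schur_pos_mult schur_pos_power schur_pos_disc_poly)
    thus "psd N (\<lambda>j k'. P (hip (a + 2) (x j) (x k')) ^ k * cnj (dpoly a m n (hip (a + 2) (x j) (x k'))))"
      unfolding cnj_disc_poly by (rule schur_pos_psd) (rule x)
  qed
  have P_int: "0 \<le> Re (disc_mean a (\<lambda>z. h z * P z ^ k))" for k
  proof -
    have "disc_mean a (\<lambda>z. h z * cnj (P z ^ k)) \<in> \<real>\<^sub>\<ge>\<^sub>0"
      by (rule disc_mean_nonneg_coefficients[OF h coeff zpoly_power[OF zP] P_pos])
    thus ?thesis by (simp add: P_\<rho> complex_nonneg_Reals_iff)
  qed
  define g where "g z = Re (h z)" for z
  have g: "continuous_on (cball 0 1) g" unfolding g_def[abs_def] by (intro continuous_intros h)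
  define \<delta> where "\<delta> = - g 1 / 2"
  have \<delta>: "0 < \<delta>" "g 1 = - 2 * \<delta>" using \<open>\<not> 0 \<le> Re (h 1)\<close> by (auto simp: \<delta>_def g_def)
  obtain \<eta>0 where \<eta>0: "0 < \<eta>0" "\<And>z. z \<in> cball 0 1 \<Longrightarrow> dist z 1 < \<eta>0 \<Longrightarrow> dist (g z) (g 1) < \<delta>"
    using g[unfolded continuous_on_iff, rule_format, of 1 \<delta>] \<delta> by auto
  define \<eta> where "\<eta> = min \<eta>0 1"
  have \<eta>: "0 < \<eta>" "\<eta> \<le> 1" "\<And>z. z \<in> cball 0 1 \<Longrightarrow> cmod (1 - z) < \<eta> \<Longrightarrow> g z \<le> - \<delta>"
  proof -
    show "0 < \<eta>" "\<eta> \<le> 1" using \<eta>0 by (auto simp: \<eta>_def)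
    fix z assume "z \<in> cball 0 1" "cmod (1 - z) < \<eta>"
    hence "dist (g z) (g 1) < \<delta>" by (intro \<eta>0) (auto simp: \<eta>_def dist_norm norm_minus_commute)
    thus "g z \<le> - \<delta>" using \<delta>(2) by (auto simp: dist_real_def)
  qed
  \<comment> \<open>By the parallelogram law \<open>\<rho> z \<le> \<rho>0\<close> at distance at
    least \<open>\<eta>\<close> from 1. The second threshold lies strictly between
    \<open>\<rho>0\<close> and the value \<open>\<rho> 1 = 1\<close>, so that
    \<open>\<rho>0 / \<rho>1 < 1\<close>; the bound \<open>\<eta> \<le> 1\<close> keeps both
    positive.\<close>
  define \<rho>0 where "\<rho>0 = 1 - \<eta>\<^sup>2 / 4"
  define \<rho>1 where "\<rho>1 = 1 - \<eta>\<^sup>2 / 8"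
  have "\<eta>\<^sup>2 \<le> 1" "0 < \<eta>\<^sup>2" using \<eta> by (auto simp: power_le_one)
  hence \<rho>01: "0 < \<rho>0" "\<rho>0 < \<rho>1" "\<rho>1 < 1" "0 < \<rho>1" by (auto simp: \<rho>0_def \<rho>1_def)
  have \<rho>: "0 \<le> \<rho> z" "\<rho> z \<le> 1" "\<rho> z \<le> \<rho>0 \<or> cmod (1 - z) < \<eta>" if z: "z \<in> cball 0 1" for z
  proof -
    have "(cmod (1 + z))\<^sup>2 + (cmod (1 - z))\<^sup>2 = 2 + 2 * (cmod z)\<^sup>2"
      unfolding cmod_power2 by (simp add: power2_eq_square algebra_simps)
    moreover have "(cmod z)\<^sup>2 \<le> 1" using z by (simp add: power_le_one)
    ultimately have le: "(cmod (1 + z))\<^sup>2 \<le> 4 - (cmod (1 - z))\<^sup>2" by simp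
    have "0 \<le> (cmod (1 - z))\<^sup>2" by simp
    with le show "0 \<le> \<rho> z" "\<rho> z \<le> 1" unfolding \<rho>_def by (simp, linarith)
    show "\<rho> z \<le> \<rho>0 \<or> cmod (1 - z) < \<eta>"
    proof (cases "cmod (1 - z) < \<eta>")
      case False
      hence "\<eta>\<^sup>2 \<le> (cmod (1 - z))\<^sup>2" using \<eta>(1) by (intro power_mono) auto
      thus ?thesis using le unfolding \<rho>_def \<rho>0_def by linarith
    qed simp
  qed
  \<comment> \<open>A continuous substitute for the indicator of the region
    \<open>\<rho> > \<rho>1\<close>: it is at most 1, and where it is positive
    \<open>\<rho> z ^ k \<ge> \<rho>1 ^ k\<close>.\<close>
  define bump where "bump z = max 0 (\<rho> z - \<rho>1)" for z
  have cont_\<rho>: "continuous_on (cball 0 1) \<rho>" unfolding \<rho>_def[abs_def] by (intro continuous_intros) auto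
  have cont_bump: "continuous_on (cball 0 1) bump" unfolding bump_def[abs_def] by (intro continuous_intros cont_\<rho>)
  define I where "I = Re (disc_mean a (\<lambda>z. complex_of_real (bump z)))"
  have I_eq: "disc_mean a (\<lambda>z. complex_of_real (bump z)) = complex_of_real I"
    using disc_mean_of_real(1)[OF cont_bump, of a] by (simp add: I_def)
  have "I \<noteq> 0"
  proof
    assume "I = 0"
    hence "bump 1 = 0" using I_eq by (intro disc_mean_eq_0_imp[OF cont_bump, of a]) (auto simp: bump_def)
    thus False using \<rho>01 by (simp add: bump_def \<rho>_def)
  qed
  moreover have "0 \<le> I" unfolding I_def by (rule disc_mean_nonneg[OF cont_bump]) (auto simp: bump_def)
  ultimately have I: "0 < I" by simp
  obtain M where M: "0 < M" "\<And>z. z \<in> cball 0 1 \<Longrightarrow> \<bar>g z\<bar> \<le> M"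
    using compact_imp_bounded[OF compact_continuous_image[OF g compact_cball]]
    unfolding bounded_pos by auto
  \<comment> \<open>Near 1 the real part of the integrand lies below
    \<open>- \<delta> * \<rho>1 ^ k * bump z\<close>, elsewhere below
    \<open>M * \<rho>0 ^ k\<close>. As its mean is nonnegative for every \<open>k\<close>, the
    positive number \<open>\<delta> * I\<close> is bounded by a null sequence.\<close>
  have bound: "\<delta> * I \<le> M * (\<rho>0 / \<rho>1) ^ k" for k
  proof -
    let ?w = "\<lambda>z. (M * \<rho>0 ^ k - \<delta> * \<rho>1 ^ k * bump z) - g z * \<rho> z ^ k"
    have w: "0 \<le> ?w z" if z: "z \<in> cball 0 1" for z
    proof (cases "cmod (1 - z) < \<eta>")
      case True
      have "\<rho>1 ^ k * bump z \<le> \<rho> z ^ k"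
      proof (cases "\<rho>1 \<le> \<rho> z")
        case True
        have "\<rho>1 ^ k * bump z \<le> \<rho> z ^ k * 1"
          using True \<rho>01 \<rho>[OF z] by (intro mult_mono power_mono) (auto simp: bump_def)
        thus ?thesis by simp
      qed (use \<rho>[OF z] in \<open>simp add: bump_def\<close>)
      hence "\<delta> * (\<rho>1 ^ k * bump z) \<le> \<delta> * \<rho> z ^ k" using \<delta> by (intro mult_left_mono) auto
      also have "\<dots> \<le> - g z * \<rho> z ^ k"
        using \<eta>(3)[OF z True] \<rho>[OF z] by (intro mult_right_mono) auto
      also have "\<dots> \<le> M * \<rho>0 ^ k - g z * \<rho> z ^ k" using M \<rho>01 by simp
      finally show ?thesis by (simp add: mult.assoc)
    next
      case False
      hence le: "\<rho> z \<le> \<rho>0" using \<rho>[OF z] by simp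
      have "g z * \<rho> z ^ k \<le> M * \<rho>0 ^ k"
        using le M(1) abs_le_D1[OF M(2)[OF z]] \<rho>[OF z] by (intro mult_mono power_mono) auto
      thus ?thesis using le \<rho>01 by (simp add: bump_def)
    qed
    have cont: "continuous_on (cball 0 1) (\<lambda>z. g z * \<rho> z ^ k)" "continuous_on (cball 0 1) (\<lambda>z. M * \<rho>0 ^ k - \<delta> * \<rho>1 ^ k * bump z)"
      by (intro continuous_intros g cont_\<rho> cont_bump)+
    have "0 \<le> Re (disc_mean a (\<lambda>z. complex_of_real (?w z)))"
      using w by (intro disc_mean_nonneg continuous_intros cont)
    also have "disc_mean a (\<lambda>z. complex_of_real (?w z)) =
       disc_mean a (\<lambda>z. (complex_of_real (M * \<rho>0 ^ k) * 1 - complex_of_real (\<delta> * \<rho>1 ^ k) * complex_of_real (bump z)) - complex_of_real (g z * \<rho> z ^ k))"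
      by simp
    also have "\<dots> = (complex_of_real (M * \<rho>0 ^ k) * 1 - complex_of_real (\<delta> * \<rho>1 ^ k) * complex_of_real I)
        - disc_mean a (\<lambda>z. complex_of_real (g z * \<rho> z ^ k))"
    proof -
      have c1: "continuous_on (cball 0 1) (\<lambda>z::complex. complex_of_real (M * \<rho>0 ^ k) * 1)" by (intro continuous_intros)
      have c2: "continuous_on (cball 0 1) (\<lambda>z. complex_of_real (\<delta> * \<rho>1 ^ k) * complex_of_real (bump z))"
        by (intro continuous_intros cont_bump)
      have c3: "continuous_on (cball 0 1) (\<lambda>z. complex_of_real (g z * \<rho> z ^ k))"
        by (intro continuous_on_of_real cont)
      show ?thesis
        by (simp only: disc_mean_diff[OF continuous_on_diff[OF c1 c2] c3] disc_mean_diff[OF c1 c2] disc_mean_scale disc_mean_one I_eq)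
    qed
    also have "disc_mean a (\<lambda>z. complex_of_real (g z * \<rho> z ^ k)) = complex_of_real (Re (disc_mean a (\<lambda>z. h z * P z ^ k)))"
    proof -
      have "continuous_on (cball 0 1) (\<lambda>z. h z * P z ^ k)"
        by (intro continuous_intros h zpoly_continuous[OF zP])
      from disc_mean_Re[OF this, of a] show ?thesis by (simp add: P_\<rho> g_def flip: of_real_power)
    qed
    finally have "0 \<le> M * \<rho>0 ^ k - \<delta> * \<rho>1 ^ k * I - Re (disc_mean a (\<lambda>z. h z * P z ^ k))"
      by simp
    hence "\<delta> * I * \<rho>1 ^ k \<le> M * \<rho>0 ^ k" using P_int[of k] by (simp add: mult_ac)
    thus ?thesis using \<rho>01 by (simp add: power_divide field_simps)
  qed
  have "(\<lambda>k. M * (\<rho>0 / \<rho>1) ^ k) \<longlonglongrightarrow> M * 0"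
    using \<rho>01 by (intro tendsto_mult tendsto_const LIMSEQ_realpow_zero) auto
  hence "\<delta> * I \<le> M * 0" using bound by (intro LIMSEQ_le_const) auto
  thus False using \<delta> I by (simp add: mult_le_0_iff)
qed

text \<open>Such an \<open>h\<close> is orthogonal to all polynomials in \<open>z\<close> and
  \<open>cnj z\<close>. Approximating the second factor in the mean of \<open>h * cnj h\<close> by
  these shows that the squared norm is 0.\<close>

lemma disc_poly_complete:
  assumes h: "continuous_on (cball 0 1) h"
    and coeff: "\<And>m n. disc_fourier a h m n = 0"
    and z: "z \<in> cball 0 1"
  shows "h z = 0"
proof -
  let ?R = "\<lambda>p. dpoly a (fst p) (snd p)"
  have zero: "disc_mean a (\<lambda>z. h z * cnj (P z)) = 0" if P: "zpoly P" for P
  proof -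
    obtain F c where F: "finite F" and P_eq: "P = (\<lambda>z. \<Sum>p\<in>F. c p * ?R p z)"
      by (rule disc_spanE[OF zpoly_span[OF P, of a]])
    have "disc_mean a (\<lambda>z. h z * cnj (P z)) = disc_mean a (\<lambda>z. \<Sum>p\<in>F. cnj (c p) * (h z * cnj (?R p z)))"
      by (simp add: P_eq sum_distrib_left mult_ac)
    thus ?thesis using h
      by (subst (asm) disc_mean_sum) (auto intro!: continuous_intros disc_poly_continuous simp: disc_mean_scale coeff)
  qed
  obtain M where M: "0 < M" "\<And>z. z \<in> cball 0 1 \<Longrightarrow> cmod (h z) \<le> M"
    using compact_imp_bounded[OF compact_continuous_image[OF h compact_cball]]
    unfolding bounded_pos by auto
  let ?I = "disc_mean a (\<lambda>z. h z * cnj (h z))"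
  have small: "cmod ?I \<le> 2 * (real a + 1) * M * e" if e: "0 < e" for e
  proof -
    obtain P where P: "zpoly P" "\<And>z. z \<in> cball 0 1 \<Longrightarrow> cmod (h z - P z) < e"
      using zpoly_dense[OF h e] by blast
    have "?I = ?I - disc_mean a (\<lambda>z. h z * cnj (P z))" by (simp add: zero[OF P(1)])
    also have "\<dots> = disc_mean a (\<lambda>z. h z * cnj (h z) - h z * cnj (P z))"
      by (intro disc_mean_diff[symmetric] continuous_intros h zpoly_continuous[OF P(1)])
    also have "cmod \<dots> \<le> 2 * (real a + 1) * (M * e)"
    proof (rule norm_disc_mean_le)
      show "continuous_on (cball 0 1) (\<lambda>z. h z * cnj (h z) - h z * cnj (P z))"
        by (intro continuous_intros h zpoly_continuous[OF P(1)])
      fix z :: complex assume z: "z \<in> cball 0 1"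
      have "h z * cnj (h z) - h z * cnj (P z) = h z * cnj (h z - P z)" by (simp add: algebra_simps)
      also have "cmod \<dots> \<le> M * e"
        unfolding norm_mult complex_mod_cnj using M P(2)[OF z] z by (intro mult_mono) auto
      finally show "cmod (h z * cnj (h z) - h z * cnj (P z)) \<le> M * e" .
    qed
    finally show ?thesis by (simp add: mult.assoc)
  qed
  have "cmod ?I \<le> 0"
  proof (rule field_le_epsilon)
    fix e :: real assume e: "0 < e"
    have pos: "0 < 2 * (real a + 1) * M" using M by simp
    have "cmod ?I \<le> 2 * (real a + 1) * M * (e / (2 * (real a + 1) * M))"
      using e pos by (intro small) auto
    thus "cmod ?I \<le> 0 + e" using pos M(1) by simp
  qed
  hence "?I = 0" by simp
  hence I0: "disc_mean a (\<lambda>z. complex_of_real ((cmod (h z))\<^sup>2)) = 0" by (simp only: complex_norm_square)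
  have "continuous_on (cball 0 1) (\<lambda>z. (cmod (h z))\<^sup>2)" by (intro continuous_intros h)
  from disc_mean_eq_0_imp[OF this _ I0 z] have "(cmod (h z))\<^sup>2 = 0" by simp
  thus ?thesis by simp
qed

section \<open>Uniform convergence and uniqueness of the coefficients\<close>

lemma disc_expansion_uniform:
  assumes c: "\<And>p u. cmod (c p u) \<le> b p" and b: "b summable_on UNIV"
    and sum: "\<And>z u. z \<in> cball 0 1 \<Longrightarrow> ((\<lambda>p. c p u * dpoly a (fst p) (snd p) z) has_sum g z u) UNIV"
  shows "uniform_limit (cball 0 1 \<times> UNIV) (\<lambda>F (z, u). \<Sum>p\<in>F. c p u * dpoly a (fst p) (snd p) z)
    (\<lambda>(z, u). g z u) (finite_subsets_at_top UNIV)"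
  unfolding split_def
proof (rule Weierstrass_m_test_general'[OF _ _ b])
  fix p :: "nat \<times> nat" and x :: "complex \<times> 'a" assume x: "x \<in> cball 0 1 \<times> UNIV"
  have "cmod (c p (snd x) * dpoly a (fst p) (snd p) (fst x)) \<le> b p * 1"
    unfolding norm_mult using c x norm_disc_poly_le_1[of "fst x" a] order_trans[OF norm_ge_zero c]
    by (intro mult_mono) auto
  thus "cmod (c p (snd x) * dpoly a (fst p) (snd p) (fst x)) \<le> b p" by simp
qed (use sum in auto)

text \<open>By orthogonality any finite partial sum containing the index \<open>(m, n)\<close>
  already has the coefficient \<open>?v\<close>; uniform convergence carries this over to
  \<open>g\<close>.\<close>

lemma disc_expansion_coefficient:
  assumes c: "\<And>p. cmod (c p) \<le> b p" and b: "b summable_on UNIV"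
    and sum: "\<And>z. z \<in> cball 0 1 \<Longrightarrow> ((\<lambda>p. c p * dpoly a (fst p) (snd p) z) has_sum g z) UNIV"
  shows "continuous_on (cball 0 1) g"
    and "disc_fourier a g m n = c (m, n) / complex_of_real (Ncoef (a + 2) m n)"
proof -
  let ?R = "\<lambda>p. dpoly a (fst p) (snd p)"
  let ?S = "\<lambda>F z. \<Sum>p\<in>F. c p * ?R p z"
  have unif: "uniform_limit (cball 0 1) ?S g (finite_subsets_at_top UNIV)"
  proof (rule Weierstrass_m_test_general'[OF _ _ b])
    fix p :: "nat \<times> nat" and z :: complex assume z: "z \<in> cball 0 1"
    have "cmod (c p * ?R p z) \<le> b p * 1"
      unfolding norm_mult using c z norm_disc_poly_le_1[of z a] order_trans[OF norm_ge_zero c]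
      by (intro mult_mono) auto
    thus "cmod (c p * ?R p z) \<le> b p" by simp
  qed (use sum in auto)
  have cont_S: "continuous_on (cball 0 1) (?S F)" for F
    by (intro continuous_intros disc_poly_continuous)
  show g: "continuous_on (cball 0 1) g"
    by (rule uniform_limit_theorem[OF _ unif]) (auto intro!: always_eventually cont_S)
  let ?D = "disc_fourier a g m n"
  let ?v = "c (m, n) / complex_of_real (Ncoef (a + 2) m n)"
  have small: "cmod (?v - ?D) \<le> 2 * (real a + 1) * e" if e: "0 < e" for e
  proof -
    have "\<forall>\<^sub>F F in finite_subsets_at_top UNIV. \<forall>z\<in>cball 0 1. dist (?S F z) (g z) < e"
      using unif e by (rule uniform_limitD)
    moreover have "\<forall>\<^sub>F F in finite_subsets_at_top UNIV. finite F \<and> {(m, n)} \<subseteq> F \<and> F \<subseteq> UNIV"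
      unfolding eventually_finite_subsets_at_top by (intro exI[of _ "{(m, n)}"]) auto
    ultimately have "\<forall>\<^sub>F F in finite_subsets_at_top UNIV. (\<forall>z\<in>cball 0 1. dist (?S F z) (g z) < e) \<and> finite F \<and> (m, n) \<in> F"
      by eventually_elim auto
    then obtain F where F: "\<And>z. z \<in> cball 0 1 \<Longrightarrow> dist (?S F z) (g z) < e" "finite F" "(m, n) \<in> F"
      using eventually_happens'[OF finite_subsets_at_top_neq_bot] by blast
    have "disc_mean a (\<lambda>z. ?S F z * cnj (dpoly a m n z)) =
       disc_mean a (\<lambda>z. \<Sum>p\<in>F. c p * (?R p z * cnj (dpoly a m n z)))"
      by (simp add: sum_distrib_right mult.assoc)
    also have "\<dots> = (\<Sum>p\<in>F. c p * disc_mean a (\<lambda>z. ?R p z * cnj (dpoly a m n z)))"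
      by (subst disc_mean_sum) (auto intro!: continuous_intros disc_poly_continuous simp: disc_mean_scale)
    also have "\<dots> = (\<Sum>p\<in>F. if p = (m, n) then ?v else 0)"
      by (intro sum.cong refl) (auto simp: disc_poly_orthogonal)
    also have "\<dots> = ?v" using F by simp
    finally have v: "?v = disc_mean a (\<lambda>z. ?S F z * cnj (dpoly a m n z))" ..
    have "?v - ?D = disc_mean a (\<lambda>z. ?S F z * cnj (dpoly a m n z) - g z * cnj (dpoly a m n z))"
      unfolding v by (intro disc_mean_diff[symmetric] continuous_intros cont_S g disc_poly_continuous)
    also have "cmod \<dots> \<le> 2 * (real a + 1) * (e * 1)"
    proof (rule norm_disc_mean_le)
      show "continuous_on (cball 0 1) (\<lambda>z. ?S F z * cnj (dpoly a m n z) - g z * cnj (dpoly a m n z))"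
        by (intro continuous_intros g disc_poly_continuous)
      fix z :: complex assume z: "z \<in> cball 0 1"
      have "cmod ((?S F z - g z) * cnj (dpoly a m n z)) \<le> e * 1"
        unfolding norm_mult complex_mod_cnj
        using F(1)[OF z] e norm_disc_poly_le_1[OF z] by (intro mult_mono) (auto simp: dist_norm)
      thus "cmod (?S F z * cnj (dpoly a m n z) - g z * cnj (dpoly a m n z)) \<le> e * 1"
        by (simp only: left_diff_distrib)
    qed
    finally show ?thesis by simp
  qed
  have "cmod (?v - ?D) \<le> 0"
  proof (rule field_le_epsilon)
    fix e :: real assume e: "0 < e"
    have pos: "0 < 2 * (real a + 1)" by simp
    have "cmod (?v - ?D) \<le> 2 * (real a + 1) * (e / (2 * (real a + 1)))"
      using e pos by (intro small) auto
    thus "cmod (?v - ?D) \<le> 0 + e" using pos by simp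
  qed
  thus "?D = ?v" by simp
qed

section \<open>Positive definite functions on the unitary group\<close>

lemma pos_def_on_psd:
  "pos_def_on G mul iv g \<longleftrightarrow> continuous_on G g \<and>
     (\<forall>n x. (\<forall>j<n. x j \<in> G) \<longrightarrow> psd n (\<lambda>j k. g (mul (iv (x j)) (x k))))"
  unfolding pos_def_on_def psd_def Let_def complex_nonneg_Reals_iff by (auto simp: conj_commute)

lemma pos_def_on_bound:
  fixes \<phi> :: "'a::topological_group_add \<Rightarrow> complex"
  assumes "pos_def_on UNIV (+) uminus \<phi>"
  shows "\<phi> 0 \<in> \<real>\<^sub>\<ge>\<^sub>0" "cmod (\<phi> u) \<le> Re (\<phi> 0)"
proof -
  let ?x = "\<lambda>j::nat. if j = 0 then 0 else u"
  have psd: "psd 2 (\<lambda>j k. \<phi> (- ?x j + ?x k))"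
    using assms unfolding pos_def_on_psd by simp
  show "\<phi> 0 \<in> \<real>\<^sub>\<ge>\<^sub>0" "cmod (\<phi> u) \<le> Re (\<phi> 0)"
    using psd_bound[OF psd, of "\<phi> 0"] by simp_all
qed

text \<open>Positivity over initial segments of the naturals transfers to any finite index set;
  below the indices are pairs.\<close>

lemma psd_finite:
  assumes psd: "\<And>n x. (\<And>j. j < n \<Longrightarrow> x j \<in> G) \<Longrightarrow> psd n (\<lambda>j k. K (x j) (x k))"
    and I: "finite I" and y: "\<And>i. i \<in> I \<Longrightarrow> y i \<in> G"
  shows "(\<Sum>i\<in>I. \<Sum>j\<in>I. K (y i) (y j) * c i * cnj (c j)) \<in> \<real>\<^sub>\<ge>\<^sub>0"
    (is "(\<Sum>i\<in>I. \<Sum>j\<in>I. ?T i j) \<in> _")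
proof -
  obtain h where h: "bij_betw h {0..<card I} I" using ex_bij_betw_nat_finite[OF I] by blast
  have hI: "h p \<in> I" if "p < card I" for p using bij_betwE[OF h] that by simp
  have "psd (card I) (\<lambda>p r. K (y (h p)) (y (h r)))" using y hI by (intro psd) blast
  from this[unfolded psd_def, rule_format, of "\<lambda>p. c (h p)"]
  have "(\<Sum>p\<in>{0..<card I}. \<Sum>r\<in>{0..<card I}. ?T (h p) (h r)) \<in> \<real>\<^sub>\<ge>\<^sub>0"
    by (simp add: atLeast0LessThan)
  also have "(\<Sum>p\<in>{0..<card I}. \<Sum>r\<in>{0..<card I}. ?T (h p) (h r)) =
      (\<Sum>p\<in>{0..<card I}. \<Sum>j\<in>I. ?T (h p) j)"
    by (intro sum.cong refl sum.reindex_bij_betw[OF h, of "\<lambda>j. ?T (h p) j" for p])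
  also have "\<dots> = (\<Sum>i\<in>I. \<Sum>j\<in>I. ?T i j)"
    by (rule sum.reindex_bij_betw[OF h, of "\<lambda>i. \<Sum>j\<in>I. ?T i j"])
  finally show ?thesis .
qed

lemma unitary_column_usphere:
  assumes "A \<in> unitary_group q" "0 < q"
  shows "(\<lambda>k. A k 0) \<in> usphere q"
proof -
  have "(\<Sum>k<q. cnj (A k 0) * A k 0) = 1" using assms unfolding unitary_group_def by auto
  moreover have "(\<Sum>k<q. cnj (A k 0) * A k 0) = complex_of_real (\<Sum>k<q. (cmod (A k 0))\<^sup>2)"
    unfolding of_real_sum complex_norm_square by (simp only: mult.commute)
  ultimately have "complex_of_real (\<Sum>k<q. (cmod (A k 0))\<^sup>2) = complex_of_real 1" by simp
  thus ?thesis unfolding usphere_def mem_Collect_eq of_real_eq_iff .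
qed

text \<open>A Householder reflection, multiplied by a phase that is chosen so that the denominator \<open>s\<close>
  cannot vanish.\<close>
lemma exists_unitary_with_column:
  assumes x: "x \<in> usphere q" and q: "0 < q"
  obtains A where "A \<in> unitary_group q" "\<And>k. k < q \<Longrightarrow> A k 0 = x k"
proof -
  define w where "w = (if x 0 = 0 then 1 else - (x 0 / complex_of_real (cmod (x 0))))"
  have w: "w * cnj w = 1" "cnj w * x 0 = - complex_of_real (cmod (x 0))"
    using complex_norm_square[of "x 0", symmetric] by (auto simp: w_def power2_eq_square mult.commute)
  define y where "y i = cnj w * x i" for i
  define s where "s = complex_of_real (1 + cmod (x 0))"
  define e where "e i = (if i = 0 then 1 else 0 :: complex)" for i :: nat
  define v where "v i = e i - y i" for i
  define A where "A i j = (if i < q \<and> j < q then w * ((if i = j then 1 else 0) - v i * cnj (v j) / s) else 0)" for i j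
  have s: "s \<noteq> 0" "cnj s = s" "v 0 = s" "cnj (v 0) = s"
  proof -
    have "0 < 1 + cmod (x 0)" by (intro add_pos_nonneg) auto
    thus "s \<noteq> 0" unfolding s_def by (metis less_irrefl of_real_eq_0_iff)
    show "cnj s = s" "v 0 = s" "cnj (v 0) = s" by (simp_all add: s_def v_def y_def e_def w)
  qed
  have y1: "(\<Sum>k<q. y k * cnj (y k)) = 1"
  proof -
    have "(\<Sum>k<q. y k * cnj (y k)) = (\<Sum>k<q. (w * cnj w) * (x k * cnj (x k)))"
      by (intro sum.cong refl) (simp add: y_def mult_ac)
    thus ?thesis using hip_self[OF x] by (simp add: w hip_def)
  qed
  \<comment> \<open>The squared norm \<open>2 * s\<close> makes \<open>I - v v\<^sup>* / s\<close>
    unitary: the quadratic term of the product cancels the two linear ones.\<close>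
  have v2: "(\<Sum>k<q. v k * cnj (v k)) = 2 * s"
  proof -
    have "(\<Sum>k<q. v k * cnj (v k)) = (\<Sum>k<q. (if k = 0 then 1 - cnj (y 0) - y 0 else 0) + y k * cnj (y k))"
      by (intro sum.cong refl) (simp add: v_def e_def algebra_simps)
    also have "\<dots> = (1 - cnj (y 0) - y 0) + 1" using q by (simp add: sum.distrib y1)
    also have "\<dots> = 2 * s" by (simp add: y_def s_def w)
    finally show ?thesis .
  qed
  have "(\<Sum>k<q. cnj (A k i) * A k j) = (if i = j then 1 else 0)" if ij: "i < q" "j < q" for i j
  proof -
    define a where "a k = cnj (v k) * (v i / s)" for k
    define b where "b k = v k * (cnj (v j) / s)" for k
    have "(\<Sum>k<q. cnj (A k i) * A k j) = (\<Sum>k<q. (if k = i then if i = j then 1 else 0 else 0) - (if k = i then b i else 0) - (if k = j then a j else 0) + a k * b k)"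
    proof (intro sum.cong refl)
      fix k assume "k \<in> {..<q}"
      hence "cnj (A k i) * A k j = (w * cnj w) * (((if k = i then 1 else 0) - a k) * ((if k = j then 1 else 0) - b k))"
        using ij s by (simp add: A_def a_def b_def mult_ac)
      also have "\<dots> = (if k = i then if i = j then 1 else 0 else 0) - (if k = i then b i else 0) - (if k = j then a j else 0) + a k * b k"
        unfolding w(1) by (auto simp: algebra_simps)
      finally show "cnj (A k i) * A k j = \<dots>" .
    qed
    also have "\<dots> = (if i = j then 1 else 0) - b i - a j + (\<Sum>k<q. a k * b k)"
      using ij by (simp add: sum.distrib sum_subtractf)
    also have "(\<Sum>k<q. a k * b k) = (v i / s) * (cnj (v j) / s) * (\<Sum>k<q. v k * cnj (v k))"
      by (simp add: a_def b_def sum_distrib_left sum_divide_distrib mult_ac)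
    also have "\<dots> = 2 * (v i * (cnj (v j) / s))" using s by (simp add: v2)
    finally show ?thesis by (simp add: a_def b_def mult_ac)
  qed
  hence "A \<in> unitary_group q" unfolding unitary_group_def by (auto simp: A_def)
  moreover have "A k 0 = x k" if "k < q" for k
  proof -
    have "A k 0 = w * (e k - v k)" using that q s by (simp add: A_def e_def)
    also have "\<dots> = (w * cnj w) * x k" by (simp add: v_def y_def)
    finally show ?thesis by (simp add: w)
  qed
  ultimately show ?thesis by (rule that)
qed

lemma mat_mult_adj_corner: "mat_mult q (mat_adj A) B 0 0 = hip q (\<lambda>k. B k 0) (\<lambda>k. A k 0)"
  by (simp add: mat_mult_def mat_adj_def hip_def mult.commute)

text \<open>The kernel sees a matrix only through its first column, and every unit vector is such a
  column. The group is written additively but may be noncommutative, so the order in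
  \<open>- u j + u k\<close> matters, as does that of the arguments of \<open>hip\<close>.\<close>

lemma pos_def_unitary_iff:
  fixes f :: "complex \<Rightarrow> 'a::topological_group_add \<Rightarrow> complex"
  assumes q: "0 < q" and f: "continuous_on (cball 0 1 \<times> UNIV) (\<lambda>(z, u). f z u)"
  shows "pos_def_on (unitary_group q \<times> UNIV) (prod_mult q) prod_inv (\<lambda>(A, u). f (A 0 0) u) \<longleftrightarrow>
    (\<forall>n x u. (\<forall>j<n. x j \<in> usphere q) \<longrightarrow> psd n (\<lambda>j k. f (hip q (x k) (x j)) (- u j + u k)))"
    (is "?P \<longleftrightarrow> ?Q")
proof
  assume P: ?P
  show ?Q
  proof (intro allI impI)
    fix n :: nat and x :: "nat \<Rightarrow> nat \<Rightarrow> complex" and u :: "nat \<Rightarrow> 'a"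
    assume x: "\<forall>j<n. x j \<in> usphere q"
    have "\<exists>A. A \<in> unitary_group q \<and> (\<forall>k<q. A k 0 = x j k)" if j: "j < n" for j
    proof -
      have "x j \<in> usphere q" using x j by blast
      then obtain A where "A \<in> unitary_group q" "\<And>k. k < q \<Longrightarrow> A k 0 = x j k"
        using exists_unitary_with_column[OF _ q] by blast
      thus ?thesis by blast
    qed
    then obtain A where A: "\<And>j. j < n \<Longrightarrow> A j \<in> unitary_group q" "\<And>j k. j < n \<Longrightarrow> k < q \<Longrightarrow> A j k 0 = x j k"
      by metis
    have "psd n (\<lambda>j k. (\<lambda>(A, u). f (A 0 0) u) (prod_mult q (prod_inv (A j, u j)) (A k, u k)))"
      by (rule conjunct2[OF P[unfolded pos_def_on_psd], rule_format, of n "\<lambda>j. (A j, u j)"]) (use A(1) in auto)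
    also have "?this \<longleftrightarrow> psd n (\<lambda>j k. f (hip q (x k) (x j)) (- u j + u k))"
    proof (rule psd_cong)
      fix j k assume jk: "j < n" "k < n"
      have "hip q (\<lambda>i. A k i 0) (\<lambda>i. A j i 0) = hip q (x k) (x j)"
        unfolding hip_def using A(2) jk by (intro sum.cong) auto
      thus "(\<lambda>(A, u). f (A 0 0) u) (prod_mult q (prod_inv (A j, u j)) (A k, u k)) = f (hip q (x k) (x j)) (- u j + u k)"
        by (simp add: prod_mult_def prod_inv_def mat_mult_adj_corner)
    qed
    finally show "psd n (\<lambda>j k. f (hip q (x k) (x j)) (- u j + u k))" .
  qed
next
  assume Q: ?Q
  show ?P unfolding pos_def_on_psd
  proof (intro conjI allI impI)
    have cont: "continuous_on (unitary_group q \<times> (UNIV :: 'a set)) (\<lambda>x. (fst x 0 0, snd x))"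
    proof -
      have c0: "continuous_on UNIV (\<lambda>A :: nat \<Rightarrow> nat \<Rightarrow> complex. A 0 0)"
        by (rule continuous_on_product_then_coordinatewise)
          (rule continuous_on_product_then_coordinatewise, rule continuous_on_id)
      have "continuous_on (unitary_group q \<times> (UNIV :: 'a set)) (\<lambda>x. fst x 0 0)"
        by (rule continuous_on_compose2[OF c0 continuous_on_fst[OF continuous_on_id]]) auto
      from continuous_on_Pair[OF this continuous_on_snd[OF continuous_on_id]] show ?thesis .
    qed
    have "A 0 0 \<in> cball 0 1" if "A \<in> unitary_group q" for A
      using usphere_coord_le[OF unitary_column_usphere[OF that q], of 0] q by simp
    hence "(\<lambda>x. (fst x 0 0, snd x)) ` (unitary_group q \<times> (UNIV :: 'a set)) \<subseteq> cball 0 1 \<times> UNIV" by auto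
    from continuous_on_compose2[OF f cont this]
    show "continuous_on (unitary_group q \<times> UNIV) (\<lambda>(A, u). f (A 0 0) u)" by (simp add: split_def)
    fix n :: nat and X :: "nat \<Rightarrow> (nat \<Rightarrow> nat \<Rightarrow> complex) \<times> 'a"
    assume X: "\<forall>j<n. X j \<in> unitary_group q \<times> UNIV"
    define x where "x j = (\<lambda>k. fst (X j) k 0)" for j
    have "x j \<in> usphere q" if "j < n" for j
      unfolding x_def using X that q by (intro unitary_column_usphere) auto
    hence "psd n (\<lambda>j k. f (hip q (x k) (x j)) (- snd (X j) + snd (X k)))"
      using Q[rule_format, of n x "\<lambda>j. snd (X j)"] by blast
    thus "psd n (\<lambda>j k. (\<lambda>(A, u). f (A 0 0) u) (prod_mult q (prod_inv (X j)) (X k)))"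
      by (simp add: prod_mult_def prod_inv_def mat_mult_adj_corner x_def)
  qed
qed

section \<open>Expansions and positive definiteness on the sphere\<close>

lemma has_sum_finite_sum:
  fixes f :: "'i \<Rightarrow> 'x \<Rightarrow> complex"
  assumes "\<And>i. i \<in> I \<Longrightarrow> (f i has_sum s i) A"
  shows "((\<lambda>x. \<Sum>i\<in>I. f i x) has_sum (\<Sum>i\<in>I. s i)) A"
  using assms by (induction I rule: infinite_finite_induct) (auto intro: has_sum_add)

text \<open>Each term is a Hadamard product of two positive matrices; exchanging \<open>m\<close>
  and \<open>n\<close> absorbs the swapped arguments of the inner product. The limit over finite
  subsets stays in the closed set of nonnegative reals.\<close>

lemma pos_def_of_expansion:
  fixes f :: "complex \<Rightarrow> 'a::topological_group_add \<Rightarrow> complex"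
  assumes \<phi>: "\<And>m n. pos_def_on UNIV (+) uminus (\<phi> m n)"
    and sum: "\<And>z u. z \<in> cball 0 1 \<Longrightarrow> ((\<lambda>(m, n). \<phi> m n u * dpoly a m n z) has_sum f z u) UNIV"
    and x: "\<And>j. j < N \<Longrightarrow> x j \<in> usphere (a + 2)"
  shows "psd N (\<lambda>j k. f (hip (a + 2) (x k) (x j)) (- u j + u k))"
  unfolding psd_def
proof
  fix c :: "nat \<Rightarrow> complex"
  let ?z = "\<lambda>j k. hip (a + 2) (x k) (x j)" and ?u = "\<lambda>j k. - u j + u k"
  define t where "t p = (\<Sum>j<N. \<Sum>k<N. \<phi> (fst p) (snd p) (?u j k) * dpoly a (fst p) (snd p) (?z j k) * c j * cnj (c k))" for p
  have "((\<lambda>p. \<phi> (fst p) (snd p) (?u j k) * dpoly a (fst p) (snd p) (?z j k) * c j * cnj (c k)) has_sum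
      f (?z j k) (?u j k) * c j * cnj (c k)) UNIV" if "j < N" "k < N" for j k
    using sum[of "?z j k" "?u j k"] norm_hip_le_1[OF x[OF that(2)] x[OF that(1)]]
    by (intro has_sum_cmult_left) (simp add: split_def)
  hence "(t has_sum (\<Sum>j<N. \<Sum>k<N. f (?z j k) (?u j k) * c j * cnj (c k))) UNIV"
    unfolding t_def[abs_def] by (intro has_sum_finite_sum) auto
  moreover have "t p \<in> \<real>\<^sub>\<ge>\<^sub>0" for p
  proof -
    have A: "psd N (\<lambda>j k. \<phi> (fst p) (snd p) (?u j k))"
      using \<phi>[of "fst p" "snd p"] unfolding pos_def_on_psd by simp
    have "psd N (\<lambda>j k. \<phi> (fst p) (snd p) (?u j k) * dpoly a (snd p) (fst p) (hip (a + 2) (x j) (x k)))"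
      using schur_pos_disc_poly[of a "snd p" "fst p"] A x unfolding schur_pos_def by blast
    moreover have "dpoly a (snd p) (fst p) (hip (a + 2) (x j) (x k)) = dpoly a (fst p) (snd p) (?z j k)" for j k
      using disc_poly_cnj[of a "fst p" "snd p" "hip (a + 2) (x j) (x k)"] by (simp only: cnj_hip)
    ultimately show ?thesis unfolding psd_def t_def by simp
  qed
  ultimately show "(\<Sum>j<N. \<Sum>k<N. f (?z j k) (?u j k) * c j * cnj (c k)) \<in> \<real>\<^sub>\<ge>\<^sub>0"
    unfolding has_sum_def
    by (intro Lim_in_closed_set[OF closed_nonneg_Reals_complex _ finite_subsets_at_top_neq_bot])
      (auto intro!: always_eventually sum_in_nonneg_Reals)
qed

definition expansion_coeff :: "nat \<Rightarrow> (complex \<Rightarrow> 'a \<Rightarrow> complex) \<Rightarrow> nat \<Rightarrow> nat \<Rightarrow> 'a \<Rightarrow> complex" where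
  "expansion_coeff a f m n u = complex_of_real (Ncoef (a + 2) m n) *
     disc_mean a (\<lambda>z. f z u * cnj (dpoly a m n z))"

lemma continuous_on_slice:
  assumes "continuous_on (S \<times> UNIV) (\<lambda>(z, u). f z u)"
  shows "continuous_on S (\<lambda>z. f z u)"
proof -
  have "continuous_on S (\<lambda>z. (z, u))" by (intro continuous_intros)
  from continuous_on_compose2[OF assms this] show ?thesis by (simp add: image_subset_iff)
qed

text \<open>The quadratic form of the coefficient is, up to \<open>Ncoef\<close>, the disc mean of
  \<open>F\<close> times a conjugated disc polynomial. Testing the kernel of \<open>f\<close> on all
  pairs of a sphere point and a group point, with the product coefficients \<open>d i * c j\<close>,
  shows that \<open>F\<close> is positive on the sphere; the Hadamard product stays positive and has
  a nonnegative mean.\<close>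

lemma pos_def_expansion_coeff:
  fixes f :: "complex \<Rightarrow> 'a::topological_group_add \<Rightarrow> complex"
  assumes f: "continuous_on (cball 0 1 \<times> UNIV) (\<lambda>(z, u). f z u)"
    and psd: "\<And>n x u. (\<And>j. j < n \<Longrightarrow> x j \<in> usphere (a + 2)) \<Longrightarrow> psd n (\<lambda>j k. f (hip (a + 2) (x k) (x j)) (- u j + u k))"
  shows "pos_def_on UNIV (+) uminus (expansion_coeff a f m n)"
  unfolding pos_def_on_psd
proof (intro conjI allI impI)
  let ?R = "dpoly a m n"
  have "continuous_on ((UNIV :: 'a set) \<times> cball 0 1) (\<lambda>x. (snd x, fst x) :: complex \<times> 'a)"
    by (intro continuous_intros)
  from continuous_on_compose2[OF f this]
  have f': "continuous_on ((UNIV :: 'a set) \<times> cball 0 1) (\<lambda>x. f (snd x) (fst x))"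
    by (simp add: image_subset_iff)
  have "continuous_on ((UNIV :: 'a set) \<times> cball 0 1) (\<lambda>x. ?R (snd x))"
    by (rule continuous_on_compose2[OF disc_poly_continuous[of UNIV]]) (auto intro!: continuous_intros)
  with f' have "continuous_on ((UNIV :: 'a set) \<times> cball 0 1) (\<lambda>(u, z). f z u * cnj (?R z))"
    unfolding split_def by (intro continuous_intros)
  from continuous_on_disc_mean[OF this, of a]
  show "continuous_on UNIV (expansion_coeff a f m n)"
    unfolding expansion_coeff_def[abs_def] by (intro continuous_intros)
  fix N :: nat and u :: "nat \<Rightarrow> 'a"
  show "psd N (\<lambda>j k. expansion_coeff a f m n (- u j + u k))"
    unfolding psd_def
  proof
    fix c :: "nat \<Rightarrow> complex"
    define F where "F z = (\<Sum>j<N. \<Sum>k<N. f z (- u j + u k) * c j * cnj (c k))" for z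
    have F: "continuous_on (cball 0 1) F"
      unfolding F_def[abs_def] by (intro continuous_intros continuous_on_slice[OF f])
    have "disc_mean a (\<lambda>z. F z * cnj (?R z)) \<in> \<real>\<^sub>\<ge>\<^sub>0"
    proof (rule disc_mean_zonal_nonneg')
      show "continuous_on (cball 0 1) (\<lambda>z. F z * cnj (?R z))"
        by (intro continuous_intros F disc_poly_continuous)
      fix M :: nat and x :: "nat \<Rightarrow> nat \<Rightarrow> complex" assume x: "\<And>j. j < M \<Longrightarrow> x j \<in> usphere (a + 2)"
      have A: "psd M (\<lambda>i l. F (hip (a + 2) (x l) (x i)))"
        unfolding psd_def
      proof
        fix d :: "nat \<Rightarrow> complex"
        let ?K = "\<lambda>p r :: (nat \<Rightarrow> complex) \<times> 'a. f (hip (a + 2) (fst r) (fst p)) (- snd p + snd r)"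
        let ?S = "\<Sum>p\<in>{..<M} \<times> {..<N}. \<Sum>r\<in>{..<M} \<times> {..<N}. ?K (x (fst p), u (snd p)) (x (fst r), u (snd r)) * (d (fst p) * c (snd p)) * cnj (d (fst r) * c (snd r))"
        have "?S \<in> \<real>\<^sub>\<ge>\<^sub>0"
        proof (rule psd_finite[where G = "usphere (a + 2) \<times> UNIV" and K = ?K and y = "\<lambda>p. (x (fst p), u (snd p))" and c = "\<lambda>p. d (fst p) * c (snd p)"])
          fix L :: nat and X :: "nat \<Rightarrow> (nat \<Rightarrow> complex) \<times> 'a" assume X: "\<And>j. j < L \<Longrightarrow> X j \<in> usphere (a + 2) \<times> UNIV"
          show "psd L (\<lambda>j k. ?K (X j) (X k))"
            using psd[of L "\<lambda>j. fst (X j)" "\<lambda>j. snd (X j)"] X by (auto simp: mem_Times_iff)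
        qed (use x in auto)
        also have "?S
          = (\<Sum>i<M. \<Sum>j<N. \<Sum>l<M. \<Sum>k<N. f (hip (a + 2) (x l) (x i)) (- u j + u k) * (d i * c j) * cnj (d l * c k))"
        proof -
          let ?P = "{..<M} \<times> {..<N}"
          have pair: "(\<Sum>p\<in>?P. G (fst p) (snd p)) = (\<Sum>i<M. \<Sum>j<N. G i j)" for G :: "nat \<Rightarrow> nat \<Rightarrow> complex"
            by (simp add: sum.cartesian_product split_def)
          have "(\<Sum>p\<in>?P. \<Sum>r\<in>?P. T (fst p) (snd p) (fst r) (snd r)) = (\<Sum>i<M. \<Sum>j<N. \<Sum>l<M. \<Sum>k<N. T i j l k)"
            for T :: "nat \<Rightarrow> nat \<Rightarrow> nat \<Rightarrow> nat \<Rightarrow> complex"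
            by (rule trans[OF pair[of "\<lambda>i j. \<Sum>r\<in>?P. T i j (fst r) (snd r)"]]) (intro sum.cong refl pair)
          from this[of "\<lambda>i j l k. f (hip (a + 2) (x l) (x i)) (- u j + u k) * (d i * c j) * cnj (d l * c k)"]
          show ?thesis by (simp only: fst_conv snd_conv)
        qed
        also have "\<dots> = (\<Sum>i<M. \<Sum>l<M. F (hip (a + 2) (x l) (x i)) * d i * cnj (d l))"
          unfolding F_def
          by (rule sum.cong[OF refl], subst sum.swap) (simp add: sum_distrib_left sum_distrib_right mult_ac)
        finally show "(\<Sum>i<M. \<Sum>l<M. F (hip (a + 2) (x l) (x i)) * d i * cnj (d l)) \<in> \<real>\<^sub>\<ge>\<^sub>0" .
      qed
      have "psd M (\<lambda>i l. F (hip (a + 2) (x l) (x i)) * dpoly a m n (hip (a + 2) (x i) (x l)))"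
        using schur_pos_disc_poly[of a m n] A x unfolding schur_pos_def by blast
      \<comment> \<open>Conjugating the value compensates for the swap of the arguments, so the
        indices \<open>m\<close> and \<open>n\<close> keep their order here.\<close>
      moreover have "cnj (?R (hip (a + 2) (x l) (x i))) = dpoly a m n (hip (a + 2) (x i) (x l))" for i l
        using disc_poly_cnj[of a n m "hip (a + 2) (x i) (x l)"] by (simp only: cnj_hip cnj_disc_poly)
      ultimately show "psd M (\<lambda>i l. F (hip (a + 2) (x l) (x i)) * cnj (?R (hip (a + 2) (x l) (x i))))" by (simp only:)
    qed
    moreover have "(\<Sum>j<N. \<Sum>k<N. expansion_coeff a f m n (- u j + u k) * c j * cnj (c k)) =
      complex_of_real (Ncoef (a + 2) m n) * disc_mean a (\<lambda>z. F z * cnj (?R z))"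
    proof -
      have cont: "continuous_on (cball 0 1) (\<lambda>z. (c j * cnj (c k)) * (f z v * cnj (?R z)))" for j k v
        by (intro continuous_intros continuous_on_slice[OF f] disc_poly_continuous)
      have "disc_mean a (\<lambda>z. F z * cnj (?R z)) =
        disc_mean a (\<lambda>z. \<Sum>j<N. \<Sum>k<N. (c j * cnj (c k)) * (f z (- u j + u k) * cnj (?R z)))"
        by (simp only: F_def sum_distrib_left sum_distrib_right mult_ac)
      also have "\<dots> = (\<Sum>j<N. \<Sum>k<N. (c j * cnj (c k)) * disc_mean a (\<lambda>z. f z (- u j + u k) * cnj (?R z)))"
        by (simp only: disc_mean_sum continuous_on_sum cont disc_mean_scale)
      finally show ?thesis by (simp add: expansion_coeff_def sum_distrib_left mult_ac)
    qed
    ultimately show "(\<Sum>j<N. \<Sum>k<N. expansion_coeff a f m n (- u j + u k) * c j * cnj (c k)) \<in> \<real>\<^sub>\<ge>\<^sub>0"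
      using Ncoef_pos[of a m n] by (auto intro!: nonneg_Reals_mult_I simp: less_imp_le)
  qed
qed

lemma expansion_coeff_summable:
  fixes f :: "complex \<Rightarrow> 'a::topological_group_add \<Rightarrow> complex"
  assumes f: "continuous_on (cball 0 1 \<times> UNIV) (\<lambda>(z, u). f z u)"
    and pd: "\<And>m n. pos_def_on UNIV (+) uminus (expansion_coeff a f m n)"
  shows "(\<lambda>p. Re (expansion_coeff a f (fst p) (snd p) 0)) summable_on UNIV"
proof (rule nonneg_bdd_above_summable_on)
  let ?R = "\<lambda>p. dpoly a (fst p) (snd p)"
  let ?b = "\<lambda>p. expansion_coeff a f (fst p) (snd p) 0"
  have b: "?b p \<in> \<real>\<^sub>\<ge>\<^sub>0" for p by (rule pos_def_on_bound(1)[OF pd])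
  show "0 \<le> Re (?b p)" for p using b[of p] by (simp add: complex_nonneg_Reals_iff)
  have "(\<Sum>p\<in>F. Re (?b p)) \<le> Re (f 1 0)" if F: "finite F" for F
  proof -
    \<comment> \<open>The remainder after a finite partial sum: its coefficients vanish for indices
      in \<open>F\<close> and agree with those of \<open>f\<close> elsewhere.\<close>
    define h where "h z = f z 0 - (\<Sum>p\<in>F. ?b p * ?R p z)" for z
    have cS: "continuous_on (cball 0 1) (\<lambda>z. \<Sum>p\<in>F. ?b p * ?R p z)"
      by (intro continuous_intros disc_poly_continuous)
    have "0 \<le> Re (h 1)"
    proof (rule Re_at_1_nonneg)
      show "continuous_on (cball 0 1) h"
        unfolding h_def[abs_def] by (intro continuous_intros continuous_on_slice[OF f] disc_poly_continuous)
      fix m n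
      let ?N = "complex_of_real (Ncoef (a + 2) m n)"
      have "disc_fourier a h m n =
        disc_mean a (\<lambda>z. f z 0 * cnj (dpoly a m n z) - (\<Sum>p\<in>F. ?b p * (?R p z * cnj (dpoly a m n z))))"
        by (simp add: h_def left_diff_distrib sum_distrib_right mult.assoc)
      also have "\<dots> = disc_mean a (\<lambda>z. f z 0 * cnj (dpoly a m n z)) - disc_mean a (\<lambda>z. \<Sum>p\<in>F. ?b p * (?R p z * cnj (dpoly a m n z)))"
        by (intro disc_mean_diff continuous_intros continuous_on_slice[OF f] disc_poly_continuous)
      also have "disc_mean a (\<lambda>z. \<Sum>p\<in>F. ?b p * (?R p z * cnj (dpoly a m n z))) = (\<Sum>p\<in>F. ?b p * disc_mean a (\<lambda>z. ?R p z * cnj (dpoly a m n z)))"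
        by (subst disc_mean_sum) (auto intro!: continuous_intros disc_poly_continuous simp: disc_mean_scale)
      also have "\<dots> = (\<Sum>p\<in>F. if p = (m, n) then ?b (m, n) / ?N else 0)"
        by (intro sum.cong refl) (auto simp: disc_poly_orthogonal)
      also have "\<dots> = (if (m, n) \<in> F then ?b (m, n) / ?N else 0)" using F by simp
      also have "disc_mean a (\<lambda>z. f z 0 * cnj (dpoly a m n z)) = ?b (m, n) / ?N"
        using Ncoef_pos[of a m n] by (simp add: expansion_coeff_def)
      finally have "disc_fourier a h m n = (if (m, n) \<in> F then 0 else ?b (m, n) / ?N)"
        by simp
      thus "disc_fourier a h m n \<in> \<real>\<^sub>\<ge>\<^sub>0"
        using b[of "(m, n)"] Ncoef_pos[of a m n] by (auto intro!: nonneg_Reals_divide_I simp: less_imp_le)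
    qed
    thus ?thesis by (simp add: h_def disc_poly_at_1)
  qed
  thus "bdd_above (sum (\<lambda>p. Re (?b p)) ` {F. F \<subseteq> UNIV \<and> finite F})"
    by (intro bdd_aboveI[of _ "Re (f 1 0)"]) auto
qed

text \<open>The series converges to a continuous function \<open>S\<close> with the same
  coefficients as the slice of \<open>f\<close>, and completeness identifies the two.\<close>

lemma expansion_has_sum:
  fixes f :: "complex \<Rightarrow> 'a::topological_group_add \<Rightarrow> complex"
  assumes f: "continuous_on (cball 0 1 \<times> UNIV) (\<lambda>(z, u). f z u)"
    and pd: "\<And>m n. pos_def_on UNIV (+) uminus (expansion_coeff a f m n)"
    and z: "z \<in> cball 0 1"
  shows "((\<lambda>p. expansion_coeff a f (fst p) (snd p) u * dpoly a (fst p) (snd p) z) has_sum f z u) UNIV"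
proof -
  let ?R = "\<lambda>p. dpoly a (fst p) (snd p)"
  let ?c = "\<lambda>p. expansion_coeff a f (fst p) (snd p) u"
  let ?b = "\<lambda>p. Re (expansion_coeff a f (fst p) (snd p) 0)"
  have b: "?b summable_on UNIV" by (rule expansion_coeff_summable[OF f pd])
  have c: "cmod (?c p) \<le> ?b p" for p by (rule pos_def_on_bound(2)[OF pd])
  define S where "S z = infsum (\<lambda>p. ?c p * ?R p z) UNIV" for z
  have S: "((\<lambda>p. ?c p * ?R p z) has_sum S z) UNIV" if z: "z \<in> cball 0 1" for z
  proof -
    have "norm (?c p * ?R p z) \<le> ?b p * 1" for p
      unfolding norm_mult using c[of p] norm_disc_poly_le_1[OF z] order_trans[OF norm_ge_zero c[of p]]
      by (intro mult_mono) auto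
    hence "(\<lambda>p. ?c p * ?R p z) summable_on UNIV"
      by (intro abs_summable_summable[OF summable_on_comparison_test[OF b]]) auto
    thus ?thesis unfolding S_def by (rule has_sum_infsum)
  qed
  note coeff = disc_expansion_coefficient[OF c b S]
  have "f z u - S z = 0"
  proof (rule disc_poly_complete[OF _ _ z])
    show "continuous_on (cball 0 1) (\<lambda>z. f z u - S z)"
      by (intro continuous_intros continuous_on_slice[OF f] coeff(1))
    fix m n
    have "disc_mean a (\<lambda>z. (f z u - S z) * cnj (dpoly a m n z)) =
      disc_mean a (\<lambda>z. f z u * cnj (dpoly a m n z)) - disc_fourier a S m n"
      unfolding left_diff_distrib
      by (intro disc_mean_diff continuous_intros continuous_on_slice[OF f] coeff(1) disc_poly_continuous)
    also have "disc_mean a (\<lambda>z. f z u * cnj (dpoly a m n z)) = expansion_coeff a f m n u / complex_of_real (Ncoef (a + 2) m n)"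
      using Ncoef_pos[of a m n] by (simp add: expansion_coeff_def)
    finally show "disc_mean a (\<lambda>z. (f z u - S z) * cnj (dpoly a m n z)) = 0"
      by (simp only: coeff(2) fst_conv snd_conv diff_self)
  qed
  thus ?thesis using S[OF z] by simp
qed

theorem theorem6p1:
  fixes q :: nat
    and f :: "complex \<Rightarrow> 'a::topological_group_add \<Rightarrow> complex"
  assumes "2 \<le> q"
    and "locally_compact_space (euclidean :: 'a topology)"
    and "continuous_on (cball 0 1 \<times> UNIV) (\<lambda>(z, u). f z u)"
  shows
   "(pos_def_on (unitary_group q \<times> UNIV) (prod_mult q) prod_inv (\<lambda>(A, u). f (A 0 0) u)
      \<longleftrightarrow>
    (\<exists>\<phi> :: nat \<Rightarrow> nat \<Rightarrow> 'a \<Rightarrow> complex.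
        (\<forall>m n. pos_def_on UNIV (+) uminus (\<phi> m n)) \<and>
        (\<lambda>(m, n). \<phi> m n 0) summable_on UNIV \<and>
        (\<forall>z\<in>cball 0 1. \<forall>u. ((\<lambda>(m, n). \<phi> m n u * disc_poly (real q - 2) m n z) has_sum f z u) UNIV)))
    \<and>
    (\<forall>\<phi> :: nat \<Rightarrow> nat \<Rightarrow> 'a \<Rightarrow> complex.
        ((\<forall>m n. pos_def_on UNIV (+) uminus (\<phi> m n)) \<and>
         (\<lambda>(m, n). \<phi> m n 0) summable_on UNIV \<and>
         (\<forall>z\<in>cball 0 1. \<forall>u. ((\<lambda>(m, n). \<phi> m n u * disc_poly (real q - 2) m n z) has_sum f z u) UNIV))
      \<longrightarrow>
        uniform_limit (cball 0 1 \<times> UNIV)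
          (\<lambda>F (z, u). \<Sum>(m, n)\<in>F. \<phi> m n u * disc_poly (real q - 2) m n z)
          (\<lambda>(z, u). f z u) (finite_subsets_at_top UNIV) \<and>
        (\<forall>m n u. \<phi> m n u =
           complex_of_real (Ncoef q m n * (real q - 1) / pi) *
           integral {0..1} (\<lambda>r. integral {0..2 * pi} (\<lambda>\<theta>.
              f (complex_of_real r * exp (\<i> * complex_of_real \<theta>)) u *
              cnj (disc_poly (real q - 2) m n (complex_of_real r * exp (\<i> * complex_of_real \<theta>))) *
              complex_of_real (r * (1 - r\<^sup>2) ^ (q - 2))))))"
proof -
  \<comment> \<open>The shift by 2 replaces the subtractions in the statement by sums.\<close>
  obtain a where a: "q = a + 2" using assms(1) by (metis add.commute le_Suc_ex)
  have q: "real q - 2 = real a" "q - 2 = a" "real q - 1 = real a + 1" "0 < q" using a by auto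
  note f = assms(3)
  let ?expands = "\<lambda>\<phi> :: nat \<Rightarrow> nat \<Rightarrow> 'a \<Rightarrow> complex. (\<forall>m n. pos_def_on UNIV (+) uminus (\<phi> m n)) \<and>
        (\<lambda>(m, n). \<phi> m n 0) summable_on UNIV \<and>
        (\<forall>z\<in>cball 0 1. \<forall>u. ((\<lambda>(m, n). \<phi> m n u * disc_poly (real q - 2) m n z) has_sum f z u) UNIV)"
  have iff: "pos_def_on (unitary_group q \<times> UNIV) (prod_mult q) prod_inv (\<lambda>(A, u). f (A 0 0) u) \<longleftrightarrow> (\<exists>\<phi>. ?expands \<phi>)"
  proof
    assume "pos_def_on (unitary_group q \<times> UNIV) (prod_mult q) prod_inv (\<lambda>(A, u). f (A 0 0) u)"
    hence psd: "psd n (\<lambda>j k. f (hip (a + 2) (x k) (x j)) (- u j + u k))"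
      if "\<And>j. j < n \<Longrightarrow> x j \<in> usphere (a + 2)" for n x u
      unfolding pos_def_unitary_iff[OF q(4) f] unfolding a using that by blast
    have pd: "pos_def_on UNIV (+) uminus (expansion_coeff a f m n)" for m n
      by (rule pos_def_expansion_coeff[OF f psd])
    \<comment> \<open>Summability is known for real parts; at the neutral element the coefficients
      are real.\<close>
    have "(\<lambda>p. complex_of_real (Re (expansion_coeff a f (fst p) (snd p) 0))) summable_on UNIV"
      using expansion_coeff_summable[OF f pd] by (rule summable_on_of_real)
    also have "(\<lambda>p. complex_of_real (Re (expansion_coeff a f (fst p) (snd p) 0))) = (\<lambda>(m, n). expansion_coeff a f m n 0)"
      using pos_def_on_bound(1)[OF pd] by (auto simp: fun_eq_iff complex_nonneg_Reals_iff complex_eq_iff)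
    finally have "?expands (expansion_coeff a f)"
      unfolding q(1) using pd expansion_has_sum[OF f pd] by (simp add: split_def)
    thus "\<exists>\<phi>. ?expands \<phi>" by blast
  next
    assume "\<exists>\<phi>. ?expands \<phi>"
    then obtain \<phi> where \<phi>: "?expands \<phi>" by blast
    show "pos_def_on (unitary_group q \<times> UNIV) (prod_mult q) prod_inv (\<lambda>(A, u). f (A 0 0) u)"
      unfolding pos_def_unitary_iff[OF q(4) f]
    proof (intro allI impI)
      fix n :: nat and x :: "nat \<Rightarrow> nat \<Rightarrow> complex" and u :: "nat \<Rightarrow> 'a"
      assume x: "\<forall>j<n. x j \<in> usphere q"
      show "psd n (\<lambda>j k. f (hip q (x k) (x j)) (- u j + u k))"
        unfolding a using \<phi> x unfolding a q(1)[unfolded a] by (intro pos_def_of_expansion[of \<phi>]) auto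
    qed
  qed
  \<comment> \<open>This is derived for an arbitrary admissible sequence, so that uniform
    convergence and the integral formula hold for every expansion and not just the constructed
    one.\<close>
  have expands: "cmod (\<phi> (fst p) (snd p) u) \<le> Re (\<phi> (fst p) (snd p) 0)"
    "(\<lambda>p. Re (\<phi> (fst p) (snd p) 0)) summable_on UNIV"
    "z \<in> cball 0 1 \<Longrightarrow> ((\<lambda>p. \<phi> (fst p) (snd p) u * dpoly a (fst p) (snd p) z) has_sum f z u) UNIV"
    if \<phi>: "?expands \<phi>" for \<phi> p z u
  proof -
    show "cmod (\<phi> (fst p) (snd p) u) \<le> Re (\<phi> (fst p) (snd p) 0)"
      using \<phi> by (intro pos_def_on_bound(2)) blast
    show "(\<lambda>p. Re (\<phi> (fst p) (snd p) 0)) summable_on UNIV"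
      using summable_on_bounded_linear[OF bounded_linear_Re, of "\<lambda>(m, n). \<phi> m n 0" UNIV] \<phi>
      by (simp add: o_def split_def)
    show "((\<lambda>p. \<phi> (fst p) (snd p) u * dpoly a (fst p) (snd p) z) has_sum f z u) UNIV" if "z \<in> cball 0 1"
      using \<phi> that unfolding q(1) by (simp add: split_def)
  qed
  show ?thesis
  proof (intro conjI allI impI, goal_cases)
    case 1
    show ?case by (rule iff)
  next
    case (2 \<phi>)
    show ?case using disc_expansion_uniform[OF expands(1-3)[OF 2]] unfolding q(1) by (simp add: split_def)
  next
    case (3 \<phi> m n u)
    have "\<phi> m n u = complex_of_real (Ncoef q m n) * disc_mean a (\<lambda>z. f z u * cnj (dpoly a m n z))"
      using disc_expansion_coefficient(2)[OF expands(1-3)[OF 3], of u m n] Ncoef_pos[of a m n] by (simp add: a)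
    thus ?case
      unfolding disc_mean_def q(1-3) by (simp only: of_real_mult times_divide_eq_right[symmetric] mult.assoc)
  qed
qed

end
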